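(* Let $1<\alpha\le 1+\frac1{1000}$ and $0<\theta<\alpha-1$. There exist a sequence of functions $(\varphi_s)$, uniformly in $C_c^\infty(\frac12,2)$, a compact set $\Gamma\subset\mathbb C$ and a constant $C_I$ such that the corresponding truncated discrete Hilbert transforms $\mathbb H_M$ satisfy $$\|(\lambda\,\mathrm{Id}+\mathbb H_M)^{-1}\|_{\ell^2\to\ell^2}\le C_I\qquad\text{for all } M \text{ and all }\lambda\in\Gamma$$ (in particular these operators are invertible on $\ell^2(\mathbb Z)$), and the estimate $$\|(\lambda\,\mathrm{Id}+\mathbb H_M)^{-1}\|_{\ell^1\to\ell^{1,\infty}}\le C$$ does not, for any constant $C$, hold uniformly in $\lambda\in\Gamma$ and $M$.
   Context: All operators are convolution operators on $\mathbb Z$. $[t]$ denotes the integer part. The parameter $s$ is dyadic, $s=2^k$, $k\in\{0,1,2,\dots\}$. "$(\varphi_s)$ is uniformly in $C_c^\infty(\frac12,2)$" means that each $\varphi_s$ is a smooth function with compact support in $(\frac12,2)$ and $\sup_s\|\varphi_s^{(k)}\|_\infty<\infty$ for every $k\ge0$. For a non-negative number $M$ define $$\mathbb H_Mf(x)=\sum_{\substack{M^\theta\le s\le M\\ s\text{ dyadic}}}\ \sum_{m>0}\varphi_s\Big(\frac{m^\alpha}{s}\Big)\frac{f(x-[m^\alpha])-f(x+[m^\alpha])}{m},\qquad x\in\mathbb Z .$$ $\|T\|_{\ell^1\to\ell^{1,\infty}}$ is the weak type $(1,1)$ constant, i.e. the least $A$ with $\#\{x\in\mathbb Z:|Tf(x)|>t\}\le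 A\|f\|_{\ell^1}/t$ for all $t>0$ and $f\in\ell^1(\mathbb Z)$. *)

theory Defs
  imports "HOL-Analysis.Analysis"
begin

definition dyadic :: "nat set" where
  "dyadic = range (\<lambda>k. 2 ^ k)"

text \<open>Only the values of \<open>\<phi>\<close> at dyadic indices matter.\<close>

definition uniformly_in_Cc_smooth :: "(nat \<Rightarrow> real \<Rightarrow> real) \<Rightarrow> real \<Rightarrow> real \<Rightarrow> bool" where
  "uniformly_in_Cc_smooth \<phi> a b \<longleftrightarrow>
     (\<forall>s\<in>dyadic.
        (\<forall>k. (deriv ^^ k) (\<phi> s) differentiable_on UNIV) \<and>
        compact (closure {x. \<phi> s x \<noteq> 0}) \<and>
        closure {x. \<phi> s x \<noteq> 0} \<subseteq> {a<..<b}) \<and>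
     (\<forall>k. \<exists>B. \<forall>s\<in>dyadic. \<forall>x. \<bar>(deriv ^^ k) (\<phi> s) x\<bar> \<le> B)"

definition ell1 :: "(int \<Rightarrow> complex) set" where
  "ell1 = {f. (\<lambda>x. cmod (f x)) summable_on UNIV}"

definition ell1_norm :: "(int \<Rightarrow> complex) \<Rightarrow> real" where
  "ell1_norm f = (\<Sum>\<^sub>\<infinity>x. cmod (f x))"

definition ell2 :: "(int \<Rightarrow> complex) set" where
  "ell2 = {f. (\<lambda>x. (cmod (f x))\<^sup>2) summable_on UNIV}"

definition ell2_norm :: "(int \<Rightarrow> complex) \<Rightarrow> real" where
  "ell2_norm f = sqrt (\<Sum>\<^sub>\<infinity>x. (cmod (f x))\<^sup>2)"

text \<open>Both operator norms below are extended reals: they are \<open>\<infinity>\<close> if no finite constant exists.\<close>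

definition ell2_opnorm :: "((int \<Rightarrow> complex) \<Rightarrow> int \<Rightarrow> complex) \<Rightarrow> ereal" where
  "ell2_opnorm T = Inf {ereal A | A. 0 \<le> A \<and>
     (\<forall>f\<in>ell2. T f \<in> ell2 \<and> ell2_norm (T f) \<le> A * ell2_norm f)}"

text \<open>Finiteness of the level sets is demanded explicitly because \<open>card\<close> is \<open>0\<close> on infinite sets.\<close>

definition weak11_norm :: "((int \<Rightarrow> complex) \<Rightarrow> int \<Rightarrow> complex) \<Rightarrow> ereal" where
  "weak11_norm T = Inf {ereal A | A. 0 \<le> A \<and>
     (\<forall>f\<in>ell1. \<forall>t>0. finite {x. cmod (T f x) > t} \<and>
        real (card {x. cmod (T f x) > t}) \<le> A * ell1_norm f / t)}"

text \<open>The sum over \<open>m\<close> has only finitely many nonzero terms when each \<open>\<phi> s\<close> has compact support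
  in \<open>(1/2, 2)\<close>, and the one over \<open>s\<close> is finite because of \<open>s \<le> M\<close>.\<close>

definition trunc_hilbert ::
  "real \<Rightarrow> real \<Rightarrow> (nat \<Rightarrow> real \<Rightarrow> real) \<Rightarrow> real \<Rightarrow> (int \<Rightarrow> complex) \<Rightarrow> int \<Rightarrow> complex" where
  "trunc_hilbert \<alpha> \<theta> \<phi> M f x =
     (\<Sum>s | s \<in> dyadic \<and> M powr \<theta> \<le> real s \<and> real s \<le> M.
        \<Sum>\<^sub>\<infinity>m\<in>{0::nat<..}.
          complex_of_real (\<phi> s (real m powr \<alpha> / real s)) *
            (f (x - \<lfloor>real m powr \<alpha>\<rfloor>) - f (x + \<lfloor>real m powr \<alpha>\<rfloor>)) / of_nat m)"

definition scalar_plus ::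
  "complex \<Rightarrow> ((int \<Rightarrow> complex) \<Rightarrow> int \<Rightarrow> complex) \<Rightarrow> (int \<Rightarrow> complex) \<Rightarrow> int \<Rightarrow> complex" where
  "scalar_plus z T f x = z * f x + T f x"

definition ell2_invertible :: "((int \<Rightarrow> complex) \<Rightarrow> int \<Rightarrow> complex) \<Rightarrow> bool" where
  "ell2_invertible T \<longleftrightarrow> bij_betw T ell2 ell2"

text \<open>The inverse of an operator on \<open>ell2\<close>; it acts on \<open>ell1\<close> through the inclusion of \<open>ell1\<close>
  in \<open>ell2\<close>, and is meaningful only for operators satisfying \<open>ell2_invertible\<close>.\<close>

definition ell2_inverse ::
  "((int \<Rightarrow> complex) \<Rightarrow> int \<Rightarrow> complex) \<Rightarrow> (int \<Rightarrow> complex) \<Rightarrow> int \<Rightarrow> complex" where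
  "ell2_inverse T = inv_into ell2 T"

end

theory Submission
  imports Defs "HOL-Computational_Algebra.Polynomial" "HOL-Real_Asymp.Real_Asymp"
begin

text \<open>The set \<open>\<Gamma>\<close> is \<open>{1}\<close>. Each \<open>\<H>\<^sub>M\<close> is convolution with a finitely supported, real,
odd kernel, hence a bounded skew-adjoint operator on \<open>ell2\<close>. Therefore \<open>1 + \<H>\<^sub>M\<close> does not shrink norms
(\<open>sqsum_le_one_plus_odd\<close>) and is onto (\<open>one_plus_odd_surj\<close>), and its inverse is a contraction for every \<open>M\<close>.
What remains is to choose the functions \<open>\<phi>\<^sub>s\<close> so that no weak type bound survives. They are all equal to
one bump or to zero, according to whether the dyadic number \<open>s\<close> is active.

The source of unboundedness is that a product of two functions in weak \<open>\<ell>\<^sup>1\<close>, one in each of two independent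
variables, need not be in weak \<open>\<ell>\<^sup>1\<close>: the loss is the number of scales. Let \<open>A\<close> collect \<open>N\<close> consecutive active
scales near \<open>2^\<sigma>\<close>, each four times the last, and \<open>B\<close> collect \<open>N\<close> such scales near \<open>2^\<tau>\<close>, where
\<open>2^\<tau>\<close> is about \<open>M\<close> and \<open>2^\<sigma>\<close> is about \<open>M powr \<theta>\<close>.
At the scale \<open>2^(\<tau> + 2j)\<close> the kernel of \<open>B\<close> takes values of size \<open>1/m\<close> on about \<open>m\<close> points, where
\<open>m powr \<alpha> = 2^(\<tau> + 2j)\<close>, and similarly for \<open>A\<close>. Because \<open>\<theta> < \<alpha> - 1\<close>, the numbers
\<open>\<lfloor>m powr \<alpha>\<rfloor>\<close> occurring in \<open>B\<close> are so sparse that adding to them the numbers occurring in \<open>A\<close> produces hardly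
any coincidences. So for each of the \<open>N\<close> pairs of scales with \<open>i + j = N - 1\<close> the kernel of \<open>A B\<close> has one and the
same size \<open>1/Q\<close> on about \<open>Q\<close> points, and its weak norm is at least of order \<open>N\<close>.

The kernel of \<open>A B\<close> is then located in the inverse. With \<open>u = (1 + A + B)\<^sup>-\<^sup>1 \<delta>\<close> and \<open>r = (1 + A)\<^sup>-\<^sup>1 \<delta>\<close>
one has, since all operators commute,
  \<open>u - r = - B (1 + A)\<^sup>-\<^sup>2 \<delta> + B\<^sup>2 (1 + A)\<^sup>-\<^sup>2 u = - B \<delta> + 2 A B \<delta> + e\<^sub>1 - e\<^sub>2\<close>,
where skewness bounds the \<open>\<ell>\<^sup>2\<close> norms of \<open>e\<^sub>1\<close> and \<open>e\<^sub>2\<close> by multiples of those of \<open>B B \<delta>\<close> and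
\<open>B A A \<delta>\<close> (\<open>resolvent_expansion\<close>). The terms \<open>u\<close> and \<open>r\<close> are both images of \<open>\<delta>\<close> under inverses
\<open>(1 + \<H>\<^sub>M)\<^sup>-\<^sup>1\<close>, for two different values of \<open>M\<close>, so a uniform weak type bound would control both; and \<open>B \<delta>\<close> vanishes
at the relevant points. As soon as \<open>e\<^sub>1\<close> and \<open>e\<^sub>2\<close> are negligible at height \<open>1/Q\<close>, the number \<open>N\<close> of scales is
bounded by the weak type constant (\<open>weak_bound_forces_few_scales\<close>), which is absurd because \<open>N\<close> is free.

That \<open>e\<^sub>1\<close> and \<open>e\<^sub>2\<close> are negligible is additive number theory. The norm of \<open>B B \<delta>\<close> is governed by the
number of solutions of \<open>\<lfloor>m powr \<alpha>\<rfloor> + \<lfloor>n powr \<alpha>\<rfloor> = x\<close>, which is at most of order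
\<open>n powr (2 - \<alpha>)\<close> up to a logarithm (\<open>card_floor_pow_sum\<close>); this is smaller than the trivial bound by a factor
\<open>n powr (\<alpha> - 1)\<close>, and \<open>\<theta> < \<alpha> - 1\<close> is exactly what makes this factor beat the number of points contributed by
\<open>A\<close>. The corresponding count for differences (\<open>card_floor_pow_diff\<close>) shows that the translates making up
\<open>B A A \<delta>\<close> are almost orthogonal and that coincidences among the points of \<open>A B \<delta>\<close> are rare.\<close>

section \<open>A smooth bump\<close>

definition bump_quad :: "real \<Rightarrow> real" where "bump_quad x = (x - 3/4) * (7/4 - x)"

text \<open>This family contains the bump and is closed under differentiation, so one computation handles the derivatives of
all orders.\<close>

definition bump_term :: "real poly \<Rightarrow> nat \<Rightarrow> real \<Rightarrow> real" where
  "bump_term P k x = (if bump_quad x > 0 then poly P x * exp (- 1 / bump_quad x) / bump_quad x ^ k else 0)"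

lemma bump_quad_pos_iff: "bump_quad x > 0 \<longleftrightarrow> 3/4 < x \<and> x < 7/4"
  by (auto simp: bump_quad_def zero_less_mult_iff)

text \<open>At the zeros of the quadratic every member of the family vanishes to second order, whatever power stands in the
denominator: the exponential series dominates its term of degree \<open>k + 2\<close>.\<close>

lemma exp_neg_inverse_le: assumes "(q::real) > 0" shows "exp (- 1 / q) / q ^ k \<le> fact (k+2) * q^2"
proof -
  define F :: real where "F = fact (k+2)"
  have F: "F > 0" by (simp add: F_def)
  have "(1/q)^(k+2) /\<^sub>R F \<le> exp (1/q)"
    unfolding exp_def F_def using sum_le_suminf[of "\<lambda>n. (1/q)^n /\<^sub>R fact n" "{k+2}"]
      assms summable_exp_generic[of "1/q"] by simp
  hence "1 / (q^(k+2) * F) \<le> exp (1/q)" by (simp add: power_one_over field_simps)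
  hence "1 \<le> exp (1/q) * (q^(k+2) * F)" using assms F by (simp add: divide_le_eq)
  hence "1 \<le> exp (1/q) * (q^k * (F * q^2))" by (simp add: power_add power2_eq_square mult_ac)
  hence "exp (-(1/q)) * 1 \<le> exp (-(1/q)) * (exp (1/q) * (q^k * (F * q^2)))" by (intro mult_left_mono) auto
  also have "\<dots> = q^k * (F * q^2)" by (simp add: exp_minus)
  finally have "exp (-(1/q)) \<le> q^k * (F * q^2)" by simp
  thus ?thesis using assms unfolding F_def[symmetric] by (simp add: divide_le_eq mult_ac)
qed

lemma bump_term_has_deriv:
  "\<exists>Q j. \<forall>x. (bump_term P k has_real_derivative bump_term Q j x) (at x)"
proof -
  let ?d = "[:5/2, -2:] :: real poly"
  let ?q = "[:-21/16, 5/2, -1:] :: real poly"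
  have q: "poly ?q x = bump_quad x" for x by (simp add: bump_quad_def algebra_simps)
  define Q where "Q = pderiv P * ?q^2 + P * ?d - smult (real k) (P * ?d * ?q)"
  have dq: "(bump_quad has_real_derivative poly ?d x) (at x)" for x
    unfolding bump_quad_def by (auto intro!: derivative_eq_intros simp: algebra_simps)
  have "(bump_term P k has_real_derivative bump_term Q (k+2) x) (at x)" for x
  proof -
    consider "bump_quad x > 0" | "bump_quad x < 0" | "bump_quad x = 0" by linarith
    thus ?thesis
    proof cases
      case 1
      have op: "open {x. bump_quad x > 0}" unfolding bump_quad_def by (intro open_Collect_less continuous_intros)
      have "((\<lambda>x. poly P x * exp (- 1 / bump_quad x) / bump_quad x ^ k) has_real_derivative
          ((poly (pderiv P) x * exp (- 1 / bump_quad x) + poly P x * (exp (- 1 / bump_quad x) * (poly ?d x / (bump_quad x)^2))) * bump_quad x ^ k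
            - poly P x * exp (- 1 / bump_quad x) * (real k * bump_quad x ^ (k-1) * poly ?d x)) / (bump_quad x ^ k * bump_quad x ^ k)) (at x)"
        by (rule derivative_eq_intros dq refl poly_DERIV | use 1 in \<open>simp add: power2_eq_square\<close>)+
      moreover have "((poly (pderiv P) x * exp (- 1 / bump_quad x) + poly P x * (exp (- 1 / bump_quad x) * (poly ?d x / (bump_quad x)^2))) * bump_quad x ^ k
            - poly P x * exp (- 1 / bump_quad x) * (real k * bump_quad x ^ (k-1) * poly ?d x)) / (bump_quad x ^ k * bump_quad x ^ k)
          = bump_term Q (k+2) x"
      proof -
        have a: "poly Q x = poly (pderiv P) x * bump_quad x^2 + poly P x * poly ?d x - real k * (poly P x * poly ?d x * bump_quad x)"
          unfolding Q_def by (simp only: poly_add poly_diff poly_mult poly_smult poly_power q)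
        have b: "real k * bump_quad x ^ (k-1) = real k * bump_quad x ^ k / bump_quad x" using 1 by (cases k) auto
        show ?thesis unfolding bump_term_def a b using 1 by (simp add: field_simps power2_eq_square)
      qed
      ultimately have "((\<lambda>x. poly P x * exp (- 1 / bump_quad x) / bump_quad x ^ k) has_real_derivative bump_term Q (k+2) x) (at x)" by simp
      thus ?thesis
        by (rule has_field_derivative_transform_within_open[OF _ op]) (use 1 in \<open>auto simp: bump_term_def\<close>)
    next
      case 2
      have op: "open {x. bump_quad x < 0}" unfolding bump_quad_def by (intro open_Collect_less continuous_intros)
      have "((\<lambda>x. 0) has_real_derivative bump_term Q (k+2) x) (at x)" using 2 by (simp add: bump_term_def)
      thus ?thesis
        by (rule has_field_derivative_transform_within_open[OF _ op]) (use 2 in \<open>auto simp: bump_term_def\<close>)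
    next
      case 3
      (* At a zero of the quadratic the difference quotient is at most of the order of the quadratic itself. *)
      have lim: "((\<lambda>h. fact (k+2) * \<bar>poly P (x+h)\<bar> * (bump_quad (x+h) / h) * bump_quad (x+h)) \<longlongrightarrow> 
           fact (k+2) * \<bar>poly P (x+0)\<bar> * poly ?d x * bump_quad (x+0)) (at 0)"
      proof (intro tendsto_intros)
        show "((\<lambda>h. bump_quad (x + h) / h) \<longlongrightarrow> poly ?d x) (at 0)" using dq[of x] 3 by (simp add: DERIV_def)
        show "((\<lambda>h. bump_quad (x+h)) \<longlongrightarrow> bump_quad (x+0)) (at 0)" unfolding bump_quad_def by (intro tendsto_intros)
      qed
      have "((\<lambda>h. (bump_term P k (x + h) - bump_term P k x) / h) \<longlongrightarrow> 0) (at 0)"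
      proof (rule Lim_null_comparison[OF _ tendsto_rabs_zero])
        show "((\<lambda>h. fact (k+2) * \<bar>poly P (x+h)\<bar> * (bump_quad (x+h) / h) * bump_quad (x+h)) \<longlongrightarrow> 0) (at 0)" using lim 3 by simp
        have "norm ((bump_term P k (x + h) - bump_term P k x) / h) \<le> \<bar>fact (k+2) * \<bar>poly P (x+h)\<bar> * (bump_quad (x+h) / h) * bump_quad (x+h)\<bar>" for h
        proof (cases "bump_quad (x+h) > 0")
          case True
          have "norm ((bump_term P k (x + h) - bump_term P k x) / h) = \<bar>poly P (x+h)\<bar> * (exp (- 1 / bump_quad (x+h)) / bump_quad (x+h) ^ k) / \<bar>h\<bar>"
            using 3 True by (simp add: bump_term_def abs_mult)
          also have "\<dots> \<le> \<bar>poly P (x+h)\<bar> * (fact (k+2) * bump_quad (x+h)^2) / \<bar>h\<bar>"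
            by (intro divide_right_mono mult_left_mono exp_neg_inverse_le True) auto
          also have "\<dots> = \<bar>fact (k+2) * \<bar>poly P (x+h)\<bar> * (bump_quad (x+h) / h) * bump_quad (x+h)\<bar>" using True
            by (simp add: abs_mult power2_eq_square)
          finally show ?thesis .
        qed (use 3 in \<open>simp add: bump_term_def\<close>)
        thus "\<forall>\<^sub>F h in at 0. norm ((bump_term P k (x + h) - bump_term P k x) / h) \<le> \<bar>fact (k+2) * \<bar>poly P (x+h)\<bar> * (bump_quad (x+h) / h) * bump_quad (x+h)\<bar>"
          by simp
      qed
      thus ?thesis using 3 by (simp add: DERIV_def bump_term_def)
    qed
  qed
  thus ?thesis by blast
qed

lemma deriv_iter_bump: "\<exists>Q j. (deriv ^^ i) (bump_term P k) = bump_term Q j"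
proof (induction i)
  case (Suc i)
  then obtain Q j where "(deriv ^^ i) (bump_term P k) = bump_term Q j" by blast
  moreover obtain Q' j' where "\<forall>x. (bump_term Q j has_real_derivative bump_term Q' j' x) (at x)"
    using bump_term_has_deriv by blast
  hence "deriv (bump_term Q j) = bump_term Q' j'" by (auto intro!: DERIV_imp_deriv)
  ultimately show ?case by auto
qed auto

lemma bump_term_differentiable: "bump_term P k differentiable_on UNIV"
  using bump_term_has_deriv[of P k]
  by (auto simp: differentiable_on_def real_differentiable_def intro: differentiable_at_withinI)

lemma bump_term_bounded: "\<exists>B\<ge>0. \<forall>x. \<bar>bump_term P k x\<bar> \<le> B"
proof -
  have "continuous_on {3/4..7/4} (bump_term P k)"
    using bump_term_differentiable differentiable_imp_continuous_on continuous_on_subset by blast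
  hence "bounded (bump_term P k ` {3/4..7/4})" by (intro compact_imp_bounded compact_continuous_image) auto
  then obtain B where "\<forall>y\<in>bump_term P k ` {3/4..7/4}. norm y \<le> B" unfolding bounded_iff by blast
  hence B: "\<bar>bump_term P k x\<bar> \<le> B" if "x \<in> {3/4..7/4}" for x using that by simp
  have "\<bar>bump_term P k x\<bar> \<le> max B 0" for x
    using B[of x] by (cases "bump_quad x > 0") (auto simp: bump_quad_pos_iff bump_term_def)
  thus ?thesis by (metis max.cobounded2)
qed

definition bump :: "real \<Rightarrow> real" where "bump = bump_term 1 0"

lemma bump_nonneg: "0 \<le> bump x" and bump_le_1: "bump x \<le> 1"
  by (auto simp: bump_def bump_term_def)

lemma bump_nonzero: "bump x \<noteq> 0 \<Longrightarrow> 3/4 < x \<and> x < 7/4"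
  by (auto simp: bump_def bump_term_def bump_quad_pos_iff split: if_splits)

lemma bump_lower: "1 \<le> x \<Longrightarrow> x \<le> 5/4 \<Longrightarrow> exp (-8) \<le> bump x"
proof -
  assume x: "1 \<le> x" "x \<le> 5/4"
  have "1/4 * (1/2) \<le> bump_quad x" unfolding bump_quad_def by (rule mult_mono) (use x in auto)
  thus ?thesis by (auto simp: bump_def bump_term_def field_simps)
qed

text \<open>Only two profiles occur, so the bounds that are uniform in \<open>s\<close> are maxima of two numbers.\<close>

lemma uniformly_in_Cc_smooth_bump:
  "uniformly_in_Cc_smooth (\<lambda>s. if P s then bump else (\<lambda>x. 0)) (1/2) 2"
proof -
  have z: "(\<lambda>x. 0) = bump_term 0 0" by (auto simp: bump_term_def)
  have r: "(if P s then bump else (\<lambda>x. 0)) = bump_term (if P s then 1 else 0) 0" for s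
    unfolding bump_def z by auto
  have cl: "closure {x. bump_term Q j x \<noteq> 0} \<subseteq> {3/4..7/4}" for Q j
    by (rule closure_minimal) (auto simp: bump_term_def bump_quad_pos_iff split: if_splits)
  have "compact (closure {x. bump_term Q j x \<noteq> 0})" for Q j
    using cl[of Q j] bounded_subset[OF bounded_closed_interval] by (auto simp: compact_eq_bounded_closed)
  moreover have "closure {x. bump_term Q j x \<noteq> 0} \<subseteq> {1/2<..<2}" for Q j using cl[of Q j] by fastforce
  moreover have "(deriv ^^ i) (bump_term Q j) differentiable_on UNIV" for i Q j
    using deriv_iter_bump[of i Q j] bump_term_differentiable by auto
  moreover have "\<exists>B. \<forall>s\<in>dyadic. \<forall>x. \<bar>(deriv ^^ i) (bump_term (if P s then 1 else 0) 0) x\<bar> \<le> B" for i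
  proof -
    have "\<exists>B\<ge>0. \<forall>x. \<bar>(deriv ^^ i) (bump_term Q 0) x\<bar> \<le> B" for Q
      using deriv_iter_bump[of i Q 0] bump_term_bounded by auto
    then obtain B0 B1 where "\<And>x. \<bar>(deriv ^^ i) (bump_term 0 0) x\<bar> \<le> B0" "\<And>x. \<bar>(deriv ^^ i) (bump_term 1 0) x\<bar> \<le> B1"
      by metis
    thus ?thesis by (intro exI[of _ "max B0 B1"]) (auto simp: le_max_iff_disj)
  qed
  ultimately show ?thesis unfolding uniformly_in_Cc_smooth_def r by auto
qed

section \<open>Square-summable functions on the integers\<close>

definition sqsum :: "(int \<Rightarrow> complex) \<Rightarrow> real" where
  "sqsum f = (\<Sum>\<^sub>\<infinity>x. (cmod (f x))\<^sup>2)"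

definition ell2_ip :: "(int \<Rightarrow> complex) \<Rightarrow> (int \<Rightarrow> complex) \<Rightarrow> complex" where
  "ell2_ip f g = (\<Sum>\<^sub>\<infinity>x. f x * cnj (g x))"

lemma ell2_summable: "f \<in> ell2 \<Longrightarrow> (\<lambda>x. (cmod (f x))\<^sup>2) summable_on UNIV"
  by (simp add: ell2_def)

lemma sqsum_nonneg: "0 \<le> sqsum f"
  by (auto simp: sqsum_def intro: infsum_nonneg)

lemma ell2_norm_sqsum: "ell2_norm f = sqrt (sqsum f)"
  by (simp add: ell2_norm_def sqsum_def)

lemma ell2_mono:
  assumes "(\<lambda>x. h x) summable_on UNIV" "\<And>x. (cmod (f x))\<^sup>2 \<le> h x"
  shows "f \<in> ell2"
  unfolding ell2_def mem_Collect_eq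
  by (rule summable_on_comparison_test[OF assms(1)]) (use assms(2) in auto)

lemma sqsum_mono:
  assumes "(\<lambda>x. h x) summable_on UNIV" "\<And>x. (cmod (f x))\<^sup>2 \<le> h x"
  shows "sqsum f \<le> infsum h UNIV"
  unfolding sqsum_def
  by (rule infsum_mono[OF ell2_summable[OF ell2_mono[OF assms]] assms(1)]) (use assms(2) in auto)

text \<open>Young's inequality. A small \<open>d\<close> leaves the coefficient of \<open>f\<close> close to \<open>1\<close>, which keeps the
iteration in \<open>one_plus_odd_surj\<close> bounded.\<close>

lemma sqsum_add_weighted: assumes "f \<in> ell2" "g \<in> ell2" "d > 0"
  shows "sqsum (\<lambda>x. f x + g x) \<le> (1 + d) * sqsum f + (1 + 1/d) * sqsum g"
proof -
  note s = summable_on_add[OF summable_on_cmult_right[OF ell2_summable[OF assms(1)], of "1+d"]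
      summable_on_cmult_right[OF ell2_summable[OF assms(2)], of "1+1/d"]]
  have "(cmod (a + b))\<^sup>2 \<le> (1 + d) * (cmod a)\<^sup>2 + (1 + 1/d) * (cmod b)\<^sup>2" for a b
  proof -
    have "(cmod (a+b))\<^sup>2 \<le> (cmod a + cmod b)\<^sup>2" by (intro power_mono norm_triangle_ineq) auto
    also have "\<dots> = (1 + d) * (cmod a)\<^sup>2 + (1 + 1/d) * (cmod b)\<^sup>2 - (d * cmod a - cmod b)\<^sup>2 / d"
      using assms(3) by (simp add: power2_eq_square field_simps)
    also have "\<dots> \<le> (1 + d) * (cmod a)\<^sup>2 + (1 + 1/d) * (cmod b)\<^sup>2" using assms(3) by simp
    finally show ?thesis .
  qed
  hence "sqsum (\<lambda>x. f x + g x) \<le> (\<Sum>\<^sub>\<infinity>x. (1 + d) * (cmod (f x))\<^sup>2 + (1 + 1/d) * (cmod (g x))\<^sup>2)"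
    by (intro sqsum_mono[OF s])
  also have "\<dots> = (1 + d) * sqsum f + (1 + 1/d) * sqsum g"
    unfolding sqsum_def using assms(1,2)[THEN ell2_summable]
    by (subst infsum_add) (auto intro!: summable_on_cmult_right simp: infsum_cmult_right)
  finally show ?thesis .
qed

lemma ell2_add: assumes "f \<in> ell2" "g \<in> ell2"
  shows "(\<lambda>x. f x + g x) \<in> ell2" "sqsum (\<lambda>x. f x + g x) \<le> 2 * sqsum f + 2 * sqsum g"
proof -
  show "(\<lambda>x. f x + g x) \<in> ell2"
  proof (rule ell2_mono)
    show "(\<lambda>x. 2 * (cmod (f x))\<^sup>2 + 2 * (cmod (g x))\<^sup>2) summable_on UNIV"
      using assms by (intro summable_on_add summable_on_cmult_right ell2_summable)
    fix x
    have "(cmod (f x + g x))\<^sup>2 \<le> (cmod (f x) + cmod (g x))\<^sup>2" by (intro power_mono norm_triangle_ineq) auto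
    also have "\<dots> \<le> 2 * (cmod (f x))\<^sup>2 + 2 * (cmod (g x))\<^sup>2"
      using zero_le_power2[of "cmod (f x) - cmod (g x)"] by (simp add: power2_eq_square algebra_simps)
    finally show "(cmod (f x + g x))\<^sup>2 \<le> 2 * (cmod (f x))\<^sup>2 + 2 * (cmod (g x))\<^sup>2" .
  qed
  show "sqsum (\<lambda>x. f x + g x) \<le> 2 * sqsum f + 2 * sqsum g"
    using sqsum_add_weighted[OF assms, of 1] by simp
qed

lemma ell2_scale: assumes "f \<in> ell2" shows "(\<lambda>x. c * f x) \<in> ell2" "sqsum (\<lambda>x. c * f x) = (cmod c)\<^sup>2 * sqsum f"
  using assms by (auto simp: ell2_def sqsum_def norm_mult power_mult_distrib infsum_cmult_right intro: summable_on_cmult_right)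

lemma ell2_uminus: "f \<in> ell2 \<Longrightarrow> (\<lambda>x. - f x) \<in> ell2" "sqsum (\<lambda>x. - f x) = sqsum f"
  by (auto simp: ell2_def sqsum_def)

lemma ell2_diff: assumes "f \<in> ell2" "g \<in> ell2"
  shows "(\<lambda>x. f x - g x) \<in> ell2" "sqsum (\<lambda>x. f x - g x) \<le> 2 * sqsum f + 2 * sqsum g"
  using ell2_add[OF assms(1) ell2_uminus(1)[OF assms(2)]] by (simp_all add: ell2_uminus)

lemma ell2_zero: "(\<lambda>x. 0) \<in> ell2" by (simp add: ell2_def)

lemma ell2_sum: "finite I \<Longrightarrow> (\<And>i. i \<in> I \<Longrightarrow> f i \<in> ell2) \<Longrightarrow> (\<lambda>x. \<Sum>i\<in>I. f i x) \<in> ell2"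
  by (induction I rule: finite_induct) (auto intro: ell2_zero ell2_add)

lemma bij_shift: "bij_betw (\<lambda>x::int. x + c) UNIV UNIV"
  by (rule bij_betwI[of _ _ _ "\<lambda>x. x - c"]) auto

lemma ell2_shift: assumes "f \<in> ell2" shows "(\<lambda>x. f (x + c)) \<in> ell2" "sqsum (\<lambda>x. f (x + c)) = sqsum f"
  using assms summable_on_reindex_bij_betw[OF bij_shift[of c], of "\<lambda>x. (cmod (f x))\<^sup>2"]
    infsum_reindex_bij_betw[OF bij_shift[of c], of "\<lambda>x. (cmod (f x))\<^sup>2"]
  by (simp_all add: ell2_def sqsum_def)

lemma ell2_shift': assumes "f \<in> ell2" shows "(\<lambda>x. f (x - c)) \<in> ell2" "sqsum (\<lambda>x. f (x - c)) = sqsum f"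
  using ell2_shift[OF assms, of "-c"] by simp_all

lemma ell2_ip_summable: assumes "f \<in> ell2" "g \<in> ell2" shows "(\<lambda>x. f x * cnj (g x)) summable_on UNIV"
proof (rule abs_summable_summable)
  show "(\<lambda>x. norm (f x * cnj (g x))) summable_on UNIV"
  proof (rule summable_on_comparison_test[OF summable_on_add[OF assms[THEN ell2_summable]]])
    fix x show "norm (f x * cnj (g x)) \<le> (cmod (f x))\<^sup>2 + (cmod (g x))\<^sup>2"
    proof -
      have "0 \<le> cmod (f x) * cmod (g x)" by simp
      thus ?thesis using sum_squares_bound[of "cmod (f x)" "cmod (g x)"] unfolding norm_mult complex_mod_cnj by linarith
    qed
  qed auto
qed

lemma infsum_of_real_complex: "(\<Sum>\<^sub>\<infinity>x\<in>A. complex_of_real (h x)) = of_real (infsum h A)"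
proof (cases "h summable_on A")
  case True thus ?thesis by (rule infsumI[OF has_sum_of_real[OF has_sum_infsum]])
next
  case False
  hence "\<not> (\<lambda>x. complex_of_real (h x)) summable_on A"
    using summable_on_bounded_linear[OF bounded_linear_Re, of "\<lambda>x. complex_of_real (h x)" A] by (auto simp: o_def)
  thus ?thesis using False by (simp add: infsum_not_exists)
qed

lemma finite_sum_infsum:
  fixes h :: "'i \<Rightarrow> int \<Rightarrow> real"
  assumes "finite I" "\<And>i. i \<in> I \<Longrightarrow> h i summable_on UNIV"
  shows "(\<lambda>x. \<Sum>i\<in>I. h i x) summable_on UNIV" "(\<Sum>\<^sub>\<infinity>x. \<Sum>i\<in>I. h i x) = (\<Sum>i\<in>I. infsum (h i) UNIV)"
  using assms by (induction I rule: finite_induct) (auto intro: summable_on_add simp: infsum_add)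

lemma ell2_ip_self: assumes "f \<in> ell2" shows "ell2_ip f f = of_real (sqsum f)"
proof -
  have "(\<lambda>x. f x * cnj (f x)) = (\<lambda>x. of_real ((cmod (f x))\<^sup>2))" by (auto simp: complex_norm_square simp del: of_real_power)
  thus ?thesis unfolding ell2_ip_def sqsum_def
    by (simp only: infsum_of_real_complex)
qed

lemma ell2_ip_cnj: "ell2_ip g f = cnj (ell2_ip f g)"
  unfolding ell2_ip_def by (subst infsum_cnj[symmetric]) (simp add: mult.commute)

lemma ell2_ip_add: "f \<in> ell2 \<Longrightarrow> g \<in> ell2 \<Longrightarrow> h \<in> ell2 \<Longrightarrow> ell2_ip (\<lambda>x. f x + g x) h = ell2_ip f h + ell2_ip g h"
  unfolding ell2_ip_def by (subst infsum_add[symmetric]) (auto intro!: ell2_ip_summable simp: algebra_simps)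

lemma ell2_ip_scale: "ell2_ip (\<lambda>x. c * f x) g = c * ell2_ip f g"
  unfolding ell2_ip_def by (simp add: infsum_cmult_right' mult.assoc)

lemma ell2_ip_diff: "f \<in> ell2 \<Longrightarrow> g \<in> ell2 \<Longrightarrow> h \<in> ell2 \<Longrightarrow> ell2_ip (\<lambda>x. f x - g x) h = ell2_ip f h - ell2_ip g h"
  using ell2_ip_add[of f "\<lambda>x. (-1) * g x" h] ell2_ip_scale[of "-1" g h] ell2_uminus(1)[of g] by simp

lemma ell2_ip_sum: "finite I \<Longrightarrow> (\<And>i. i \<in> I \<Longrightarrow> f i \<in> ell2) \<Longrightarrow> g \<in> ell2 \<Longrightarrow>
    ell2_ip (\<lambda>x. \<Sum>i\<in>I. f i x) g = (\<Sum>i\<in>I. ell2_ip (f i) g)"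
proof (induction I rule: finite_induct)
  case empty thus ?case by (simp add: ell2_ip_def)
next
  case (insert a I) thus ?case by (simp add: ell2_ip_add ell2_sum)
qed

lemma ell2_ip_shift: "ell2_ip (\<lambda>x. f (x - c)) g = ell2_ip f (\<lambda>x. g (x + c))"
  using infsum_reindex_bij_betw[OF bij_shift[of c], of "\<lambda>x. f (x - c) * cnj (g x)"]
  by (simp add: ell2_ip_def)

lemma sqsum_add_ip:
  assumes "f \<in> ell2" "g \<in> ell2"
  shows "sqsum (\<lambda>x. f x + g x) = sqsum f + sqsum g + 2 * Re (ell2_ip f g)"
proof -
  let ?h = "\<lambda>x. f x + g x"
  have h: "?h \<in> ell2" using assms by (rule ell2_add)
  have "of_real (sqsum ?h) = ell2_ip ?h ?h" using ell2_ip_self[OF h] by simp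
  also have "\<dots> = ell2_ip f ?h + ell2_ip g ?h" using assms h by (rule ell2_ip_add)
  also have "\<dots> = cnj (ell2_ip ?h f) + cnj (ell2_ip ?h g)" by (simp add: ell2_ip_cnj[symmetric])
  also have "\<dots> = cnj (ell2_ip f f + ell2_ip g f) + cnj (ell2_ip f g + ell2_ip g g)" using assms by (simp add: ell2_ip_add)
  also have "\<dots> = of_real (sqsum f) + of_real (sqsum g) + (ell2_ip f g + cnj (ell2_ip f g))"
    using assms by (simp add: ell2_ip_self ell2_ip_cnj[of g f])
  finally have "Re (of_real (sqsum ?h)) = Re (of_real (sqsum f) + of_real (sqsum g) + (ell2_ip f g + cnj (ell2_ip f g)))" by simp
  thus ?thesis by simp
qed

section \<open>Odd convolution operators and their resolvents\<close>

text \<open>Convolution with the measure that puts mass \<open>w i\<close> at the point \<open>y i\<close>; reversing the sign of \<open>y\<close> gives the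
adjoint. The truncated Hilbert transforms are differences of such an operator and its adjoint.\<close>

definition shift_sum :: "'i set \<Rightarrow> ('i \<Rightarrow> real) \<Rightarrow> ('i \<Rightarrow> int) \<Rightarrow> (int \<Rightarrow> complex) \<Rightarrow> int \<Rightarrow> complex" where
  "shift_sum I w y f x = (\<Sum>i\<in>I. of_real (w i) * f (x - y i))"

definition odd_sum :: "'i set \<Rightarrow> ('i \<Rightarrow> real) \<Rightarrow> ('i \<Rightarrow> int) \<Rightarrow> (int \<Rightarrow> complex) \<Rightarrow> int \<Rightarrow> complex" where
  "odd_sum I w y f x = shift_sum I w y f x - shift_sum I w (\<lambda>i. - y i) f x"

lemma shift_sum_add: "shift_sum I w y (\<lambda>x. f x + g x) = (\<lambda>x. shift_sum I w y f x + shift_sum I w y g x)"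
  and shift_sum_diff: "shift_sum I w y (\<lambda>x. f x - g x) = (\<lambda>x. shift_sum I w y f x - shift_sum I w y g x)"
  and shift_sum_scale: "shift_sum I w y (\<lambda>x. c * f x) = (\<lambda>x. c * shift_sum I w y f x)"
  by (auto simp: shift_sum_def fun_eq_iff sum.distrib sum_subtractf sum_distrib_left algebra_simps)

lemma odd_sum_add: "odd_sum I w y (\<lambda>x. f x + g x) = (\<lambda>x. odd_sum I w y f x + odd_sum I w y g x)"
  and odd_sum_diff: "odd_sum I w y (\<lambda>x. f x - g x) = (\<lambda>x. odd_sum I w y f x - odd_sum I w y g x)"
  and odd_sum_scale: "odd_sum I w y (\<lambda>x. c * f x) = (\<lambda>x. c * odd_sum I w y f x)"
  by (simp_all add: odd_sum_def fun_eq_iff shift_sum_add shift_sum_diff shift_sum_scale algebra_simps)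

lemma shift_sum_comm: "shift_sum I w y (shift_sum J v z f) = shift_sum J v z (shift_sum I w y f)"
proof
  fix x
  have "shift_sum I w y (shift_sum J v z f) x = (\<Sum>i\<in>I. \<Sum>j\<in>J. of_real (w i) * (of_real (v j) * f (x - y i - z j)))"
    by (simp add: shift_sum_def sum_distrib_left)
  also have "\<dots> = (\<Sum>j\<in>J. \<Sum>i\<in>I. of_real (w i) * (of_real (v j) * f (x - y i - z j)))" by (rule sum.swap)
  also have "\<dots> = shift_sum J v z (shift_sum I w y f) x"
    by (simp add: shift_sum_def sum_distrib_left algebra_simps)
  finally show "shift_sum I w y (shift_sum J v z f) x = shift_sum J v z (shift_sum I w y f) x" .
qed

lemma odd_shift_comm: "odd_sum I w y (shift_sum J v z f) = shift_sum J v z (odd_sum I w y f)"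
proof -
  have "odd_sum I w y g = (\<lambda>x. shift_sum I w y g x - shift_sum I w (\<lambda>i. - y i) g x)" for g
    by (auto simp: odd_sum_def)
  thus ?thesis by (simp add: shift_sum_diff shift_sum_comm[of J])
qed

lemma odd_sum_comm: "odd_sum I w y (odd_sum J v z f) = odd_sum J v z (odd_sum I w y f)"
proof -
  have "odd_sum I w y g = (\<lambda>x. shift_sum I w y g x - shift_sum I w (\<lambda>i. - y i) g x)" for g
    by (auto simp: odd_sum_def)
  thus ?thesis by (simp add: odd_sum_diff odd_shift_comm)
qed

context fixes I :: "'i set" and w :: "'i \<Rightarrow> real" and y :: "'i \<Rightarrow> int" assumes fin: "finite I"
begin

lemma shift_sum_ell2: "f \<in> ell2 \<Longrightarrow> shift_sum I w y f \<in> ell2"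
  unfolding shift_sum_def[abs_def] using fin by (intro ell2_sum ell2_scale ell2_shift') auto

lemma shift_sum_uminus_ell2: "f \<in> ell2 \<Longrightarrow> shift_sum I w (\<lambda>i. - y i) f \<in> ell2"
  unfolding shift_sum_def[abs_def] using fin by (intro ell2_sum ell2_scale ell2_shift') auto

lemma odd_sum_ell2: "f \<in> ell2 \<Longrightarrow> odd_sum I w y f \<in> ell2"
  unfolding odd_sum_def[abs_def] by (intro ell2_diff shift_sum_ell2 shift_sum_uminus_ell2)

lemma ell2_ip_shift_sum_adjoint:
  assumes "f \<in> ell2" "g \<in> ell2"
  shows "ell2_ip (shift_sum I w y f) g = ell2_ip f (shift_sum I w (\<lambda>i. - y i) g)"
proof -
  have "ell2_ip (shift_sum I w y f) g = (\<Sum>i\<in>I. of_real (w i) * ell2_ip (\<lambda>x. f (x - y i)) g)"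
    unfolding shift_sum_def[abs_def] using fin assms
    by (subst ell2_ip_sum) (auto intro!: ell2_scale ell2_shift' simp: ell2_ip_scale)
  also have "\<dots> = cnj (\<Sum>i\<in>I. of_real (w i) * ell2_ip (\<lambda>x. g (x + y i)) f)"
    by (simp add: ell2_ip_shift ell2_ip_cnj[symmetric])
  also have "\<dots> = cnj (ell2_ip (shift_sum I w (\<lambda>i. - y i) g) f)"
    unfolding shift_sum_def[abs_def] using fin assms
    by (subst ell2_ip_sum) (auto intro!: ell2_scale ell2_shift simp: ell2_ip_scale)
  finally show ?thesis by (simp add: ell2_ip_cnj[symmetric])
qed

text \<open>A convolution operator commutes with its adjoint, hence is normal. For the square of an odd convolution
operator this replaces the differences \<open>y i - y j\<close>, among which \<open>0\<close> is far too frequent, by the sums \<open>y i + y j\<close>.\<close>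

lemma sqsum_shift_sum_uminus:
  assumes "f \<in> ell2" shows "sqsum (shift_sum I w (\<lambda>i. - y i) f) = sqsum (shift_sum I w y f)"
proof -
  let ?P = "shift_sum I w y" and ?Q = "shift_sum I w (\<lambda>i. - y i)"
  have "complex_of_real (sqsum (?Q f)) = ell2_ip (?Q f) (?Q f)" using assms by (simp add: ell2_ip_self shift_sum_uminus_ell2)
  also have "\<dots> = ell2_ip (?P (?Q f)) f" using assms by (simp add: ell2_ip_shift_sum_adjoint shift_sum_uminus_ell2)
  also have "\<dots> = cnj (ell2_ip f (?Q (?P f)))" by (simp add: shift_sum_comm[of I w y] ell2_ip_cnj[symmetric])
  also have "\<dots> = cnj (ell2_ip (?P f) (?P f))" using assms by (simp add: ell2_ip_shift_sum_adjoint shift_sum_ell2)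
  also have "\<dots> = of_real (sqsum (?P f))" using assms by (simp add: ell2_ip_self shift_sum_ell2)
  finally show ?thesis by simp
qed

lemma sqsum_odd_sum_le: assumes "f \<in> ell2" shows "sqsum (odd_sum I w y f) \<le> 4 * sqsum (shift_sum I w y f)"
  using ell2_diff(2)[OF shift_sum_ell2[OF assms] shift_sum_uminus_ell2[OF assms]]
  by (simp add: odd_sum_def[abs_def] sqsum_shift_sum_uminus[OF assms])

text \<open>An operator minus its adjoint is skew.\<close>

lemma odd_sum_skew: assumes "f \<in> ell2" shows "Re (ell2_ip f (odd_sum I w y f)) = 0"
proof -
  have "ell2_ip (odd_sum I w y f) f = ell2_ip (shift_sum I w y f) f - ell2_ip (shift_sum I w (\<lambda>i. - y i) f) f"
    unfolding odd_sum_def[abs_def] using assms by (intro ell2_ip_diff shift_sum_ell2 shift_sum_uminus_ell2)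
  also have "ell2_ip (shift_sum I w (\<lambda>i. - y i) f) f = cnj (ell2_ip (shift_sum I w y f) f)"
    using assms by (simp add: ell2_ip_shift_sum_adjoint ell2_ip_cnj[symmetric])
  finally show ?thesis by (simp add: ell2_ip_cnj[of f])
qed

lemma sqsum_one_plus_odd: assumes "f \<in> ell2"
  shows "sqsum (\<lambda>x. f x + odd_sum I w y f x) = sqsum f + sqsum (odd_sum I w y f)"
  using sqsum_add_ip[OF assms odd_sum_ell2[OF assms]] odd_sum_skew[OF assms] by simp

text \<open>The a priori inequality behind every estimate for inverses below: to bound a solution it suffices to bound the
right-hand side.\<close>

lemma sqsum_le_one_plus_odd: "f \<in> ell2 \<Longrightarrow> sqsum f \<le> sqsum (\<lambda>x. f x + odd_sum I w y f x)"
  using sqsum_one_plus_odd sqsum_nonneg[of "odd_sum I w y f"] by simp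

lemma sqsum_shift_sum_bound: assumes "f \<in> ell2"
  shows "sqsum (shift_sum I w y f) \<le> (\<Sum>i\<in>I. \<bar>w i\<bar>)\<^sup>2 * sqsum f"
proof -
  let ?V = "\<Sum>i\<in>I. \<bar>w i\<bar>"
  have V: "?V \<ge> 0" by (simp add: sum_nonneg)
  have pt: "(cmod (shift_sum I w y f x))\<^sup>2 \<le> ?V * (\<Sum>i\<in>I. \<bar>w i\<bar> * (cmod (f (x - y i)))\<^sup>2)" for x
  proof -
    have "cmod (shift_sum I w y f x) \<le> (\<Sum>i\<in>I. \<bar>w i\<bar> * cmod (f (x - y i)))"
      unfolding shift_sum_def by (rule order.trans[OF norm_sum]) (simp add: norm_mult)
    also have "\<dots> = (\<Sum>i\<in>I. sqrt \<bar>w i\<bar> * (sqrt \<bar>w i\<bar> * cmod (f (x - y i))))"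
      by (simp add: mult.assoc[symmetric] del: real_sqrt_abs)
    finally have "(cmod (shift_sum I w y f x))\<^sup>2 \<le> (\<Sum>i\<in>I. sqrt \<bar>w i\<bar> * (sqrt \<bar>w i\<bar> * cmod (f (x - y i))))\<^sup>2"
      by (intro power_mono) auto
    also have "\<dots> \<le> (\<Sum>i\<in>I. (sqrt \<bar>w i\<bar>)\<^sup>2) * (\<Sum>i\<in>I. (sqrt \<bar>w i\<bar> * cmod (f (x - y i)))\<^sup>2)"
      by (rule Cauchy_Schwarz_ineq_sum)
    finally show ?thesis by (simp add: power_mult_distrib)
  qed
  have s1: "(\<lambda>x. \<Sum>i\<in>I. \<bar>w i\<bar> * (cmod (f (x - y i)))\<^sup>2) summable_on UNIV"
    using assms fin by (intro finite_sum_infsum summable_on_cmult_right ell2_summable ell2_shift') auto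
  have "sqsum (shift_sum I w y f) \<le> (\<Sum>\<^sub>\<infinity>x. ?V * (\<Sum>i\<in>I. \<bar>w i\<bar> * (cmod (f (x - y i)))\<^sup>2))"
    by (rule sqsum_mono[OF summable_on_cmult_right[OF s1] pt])
  also have "\<dots> = ?V * (\<Sum>i\<in>I. \<bar>w i\<bar> * sqsum (\<lambda>x. f (x - y i)))"
    using assms fin s1 unfolding sqsum_def
    by (subst infsum_cmult_right, simp, subst finite_sum_infsum(2))
       (auto intro!: summable_on_cmult_right ell2_summable ell2_shift' simp: infsum_cmult_right')
  also have "\<dots> = ?V\<^sup>2 * sqsum f" using assms by (simp add: ell2_shift'(2) power2_eq_square mult.assoc flip: sum_distrib_right)
  finally show ?thesis .
qed

lemma sqsum_odd_sum_bound: assumes "f \<in> ell2"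
  shows "sqsum (odd_sum I w y f) \<le> 4 * (\<Sum>i\<in>I. \<bar>w i\<bar>)\<^sup>2 * sqsum f"
  using sqsum_odd_sum_le[OF assms] sqsum_shift_sum_bound[OF assms] by simp

end

lemma cmod_le_sqsum: assumes "f \<in> ell2" shows "(cmod (f x))\<^sup>2 \<le> sqsum f"
  unfolding sqsum_def using finite_sum_le_infsum[OF ell2_summable[OF assms], of "{x}"] by simp

lemma finite_sum_le_sqsum: assumes "f \<in> ell2" "finite F" shows "(\<Sum>x\<in>F. (cmod (f x))\<^sup>2) \<le> sqsum f"
  unfolding sqsum_def using finite_sum_le_infsum[OF ell2_summable[OF assms(1)], of F] assms(2) by simp

lemma sqsum_zero_imp: assumes "f \<in> ell2" "sqsum f \<le> 0" shows "f = (\<lambda>x. 0)"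
proof
  fix x
  have "(cmod (f x))\<^sup>2 \<le> 0" using cmod_le_sqsum[OF assms(1), of x] assms(2) by linarith
  thus "f x = 0" by simp
qed

text \<open>Fatou's lemma for counting measure.\<close>

lemma ell2_pointwise_limit:
  assumes "\<And>n. g n \<in> ell2" "\<And>n. sqsum (g n) \<le> B" "\<And>x. (\<lambda>n. g n x) \<longlonglongrightarrow> f x"
  shows "f \<in> ell2"
  unfolding ell2_def mem_Collect_eq
proof (rule nonneg_bounded_partial_sums_imp_summable_on[of _ _ B])
  have "(\<Sum>x\<in>F. (cmod (f x))\<^sup>2) \<le> B" if "finite F" for F
  proof (rule LIMSEQ_le_const2)
    show "(\<lambda>n. \<Sum>x\<in>F. (cmod (g n x))\<^sup>2) \<longlonglongrightarrow> (\<Sum>x\<in>F. (cmod (f x))\<^sup>2)"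
      by (intro tendsto_intros assms)
    show "\<exists>N. \<forall>n\<ge>N. (\<Sum>x\<in>F. (cmod (g n x))\<^sup>2) \<le> B"
      using finite_sum_le_sqsum[OF assms(1) that] assms(2) order.trans by blast
  qed
  thus "\<forall>\<^sub>F F in finite_subsets_at_top UNIV. (\<Sum>x\<in>F. (cmod (f x))\<^sup>2) \<le> B"
    by (simp add: eventually_finite_subsets_at_top_weakI)
qed auto

text \<open>The map \<open>f \<mapsto> f - e (f + H f - g)\<close> contracts for small \<open>e > 0\<close>: by skewness the squared norm of its linear part
is at most \<open>(1 - e)\<^sup>2 + e\<^sup>2 L\<close>, where \<open>L\<close> bounds the squared norm of \<open>H\<close>. Its iterates converge
pointwise, which is enough because \<open>H\<close> is a finite sum of translations, and they stay bounded in \<open>ell2\<close>.\<close>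

lemma one_plus_odd_surj:
  assumes fin: "finite I" and g: "g \<in> ell2"
  shows "\<exists>f\<in>ell2. (\<lambda>x. f x + odd_sum I w y f x) = g"
proof -
  let ?H = "odd_sum I w y"
  define L where "L = 4 * (\<Sum>i\<in>I. \<bar>w i\<bar>)\<^sup>2"
  define e where "e = 1 / (1 + L)"
  have L: "L \<ge> 0" by (simp add: L_def)
  have e: "e > 0" "e \<le> 1" "e * (1 + L) = 1" using L by (auto simp: e_def)
  define q where "q = sqrt (1 - e)"
  have q: "0 \<le> q" "q < 1" "q\<^sup>2 = 1 - e" using e by (auto simp: q_def)
  define T where "T = (\<lambda>f x. (1 - of_real e) * f x - of_real e * ?H f x)"
  have T2: "T f \<in> ell2" if "f \<in> ell2" for f
    unfolding T_def using that fin by (intro ell2_diff ell2_scale odd_sum_ell2)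
  have Tn: "sqsum (T f) \<le> q\<^sup>2 * sqsum f" if f: "f \<in> ell2" for f
  proof -
    have H: "?H f \<in> ell2" using fin f by (rule odd_sum_ell2)
    have a: "(\<lambda>x. (1 - of_real e) * f x) \<in> ell2" "(\<lambda>x. - of_real e * ?H f x) \<in> ell2"
      by (rule ell2_scale[OF f], rule ell2_scale[OF H])
    have c: "(cmod (1 - of_real e))\<^sup>2 = (1 - e)\<^sup>2" "(cmod (- of_real e))\<^sup>2 = e\<^sup>2"
      using norm_of_real[of "1 - e", where ?'a = complex] by simp_all
    have "T f = (\<lambda>x. (1 - of_real e) * f x + - of_real e * ?H f x)" by (auto simp: T_def)
    hence "sqsum (T f) = (1 - e)\<^sup>2 * sqsum f + e\<^sup>2 * sqsum (?H f)
       + 2 * Re (ell2_ip (\<lambda>x. (1 - of_real e) * f x) (\<lambda>x. - of_real e * ?H f x))"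
      using sqsum_add_ip[OF a] unfolding ell2_scale(2)[OF f] ell2_scale(2)[OF H] c by simp
    also have "ell2_ip (\<lambda>x. (1 - of_real e) * f x) (\<lambda>x. - of_real e * ?H f x) = of_real (- (1 - e) * e) * ell2_ip f (?H f)"
      by (subst ell2_ip_scale, subst ell2_ip_cnj, subst ell2_ip_scale) (simp add: ell2_ip_cnj[symmetric] algebra_simps)
    also have "2 * Re (of_real (- (1 - e) * e) * ell2_ip f (?H f)) = 0" using odd_sum_skew[OF fin f] by simp
    also have "(1 - e)\<^sup>2 * sqsum f + e\<^sup>2 * sqsum (?H f) + 0 \<le> (1 - e)\<^sup>2 * sqsum f + e\<^sup>2 * (L * sqsum f)"
      using sqsum_odd_sum_bound[OF fin f, of w y] unfolding L_def by (simp add: mult_left_mono)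
    also have "\<dots> = (1 - 2 * e + e * (e * (1 + L))) * sqsum f" by (simp add: algebra_simps power2_eq_square)
    also have "\<dots> = q\<^sup>2 * sqsum f" unfolding e(3) q(3) by (simp add: algebra_simps)
    finally show ?thesis .
  qed
  define s where "s = rec_nat (\<lambda>x. 0) (\<lambda>n f x. T f x + of_real e * g x)"
  have s0: "s 0 = (\<lambda>x. 0)" and sS: "s (Suc n) = (\<lambda>x. T (s n) x + of_real e * g x)" for n
    by (simp_all add: s_def)
  have s2: "s n \<in> ell2" for n
    by (induction n) (auto simp: s0 sS intro!: ell2_zero ell2_add ell2_scale T2 g)
  define B where "B = sqrt (sqsum (s 1))"
  have Tdiff: "(\<lambda>x. T f x - T h x) = T (\<lambda>x. f x - h x)" for f h
    by (auto simp: T_def odd_sum_diff algebra_simps)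
  have d: "sqsum (\<lambda>x. s (Suc n) x - s n x) \<le> (q ^ n * B)\<^sup>2" for n
  proof (induction n)
    case 0 show ?case by (simp add: B_def s0 sqsum_nonneg)
  next
    case (Suc n)
    have "(\<lambda>x. s (Suc (Suc n)) x - s (Suc n) x) = (\<lambda>x. T (s (Suc n)) x - T (s n) x)"
      by (subst sS, subst (2) sS) auto
    hence "sqsum (\<lambda>x. s (Suc (Suc n)) x - s (Suc n) x) = sqsum (T (\<lambda>x. s (Suc n) x - s n x))" by (simp add: Tdiff)
    also have "\<dots> \<le> q\<^sup>2 * sqsum (\<lambda>x. s (Suc n) x - s n x)" by (intro Tn ell2_diff s2)
    also have "\<dots> \<le> q\<^sup>2 * (q ^ n * B)\<^sup>2" by (intro mult_left_mono Suc) auto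
    finally show ?case by (simp add: power_mult_distrib power2_eq_square mult_ac)
  qed
  have B: "B \<ge> 0" by (simp add: B_def sqsum_nonneg)
  have floor_pow: "cmod (s (Suc n) x - s n x) \<le> q ^ n * B" for n x
  proof -
    have "(\<lambda>x. s (Suc n) x - s n x) \<in> ell2" by (rule ell2_diff(1)[OF s2 s2])
    from cmod_le_sqsum[OF this, of x] d[of n] have "(cmod (s (Suc n) x - s n x))\<^sup>2 \<le> (q ^ n * B)\<^sup>2" by linarith
    thus ?thesis by (rule power2_le_imp_le) (use q(1) B in auto)
  qed
  have "summable (\<lambda>n. s (Suc n) x - s n x)" for x
    by (rule summable_comparison_test'[of "\<lambda>n. q ^ n * B" 0])
       (use q floor_pow in \<open>auto intro!: summable_mult2 summable_geometric\<close>)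
  hence "convergent (\<lambda>n. s n x)" for x
    unfolding summable_iff_convergent using sum_lessThan_telescope[of "\<lambda>n. s n x" for x] by (simp add: s0)
  then obtain f where f: "\<And>x. (\<lambda>n. s n x) \<longlonglongrightarrow> f x" unfolding convergent_def by metis
  have "sqsum (s n) \<le> (1 + 1/e) * sqsum g" for n
  proof (induction n)
    case 0 show ?case using e sqsum_nonneg[of g] by (simp add: s0 sqsum_def)
  next
    case (Suc n)
    have "sqsum (s (Suc n)) \<le> (1 + e) * sqsum (T (s n)) + (1 + 1/e) * sqsum (\<lambda>x. of_real e * g x)"
      unfolding sS using e by (intro sqsum_add_weighted T2 s2 ell2_scale g) auto
    also have "\<dots> \<le> (1 + e) * ((1 - e) * sqsum (s n)) + (1 + 1/e) * (e\<^sup>2 * sqsum g)"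
      using Tn[OF s2, of n] e q(3) by (intro add_mono mult_left_mono) (auto simp: ell2_scale[OF g])
    also have "\<dots> = (1 - e\<^sup>2) * sqsum (s n) + (1 + 1/e) * (e\<^sup>2 * sqsum g)" by (simp add: algebra_simps power2_eq_square)
    also have "\<dots> \<le> (1 - e\<^sup>2) * ((1 + 1/e) * sqsum g) + (1 + 1/e) * (e\<^sup>2 * sqsum g)"
      using e by (intro add_right_mono mult_left_mono Suc) (auto simp: power_le_one)
    also have "\<dots> = (1 + 1/e) * sqsum g" by (simp add: algebra_simps)
    finally show ?case .
  qed
  hence f2: "f \<in> ell2" using ell2_pointwise_limit[OF s2 _ f] by blast
  have "f x + ?H f x = g x" for x
  proof -
    have "(\<lambda>n. T (s n) x + of_real e * g x) \<longlonglongrightarrow> T f x + of_real e * g x"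
      unfolding T_def odd_sum_def shift_sum_def by (intro tendsto_intros f)
    moreover have "(\<lambda>n. s (Suc n) x) \<longlonglongrightarrow> f x" by (rule LIMSEQ_Suc[OF f])
    ultimately have "f x = T f x + of_real e * g x" unfolding sS using LIMSEQ_unique by blast
    hence "of_real e * (f x + ?H f x) = of_real e * g x" by (simp add: T_def algebra_simps)
    thus ?thesis using e by simp
  qed
  thus ?thesis using f2 by blast
qed

section \<open>Additive coincidences among integer parts of powers\<close>

definition floor_pow :: "real \<Rightarrow> nat \<Rightarrow> int" where "floor_pow \<alpha> m = \<lfloor>real m powr \<alpha>\<rfloor>"

lemma powr_increment_lower:
  fixes \<alpha> x h :: real
  assumes "1 \<le> \<alpha>" "0 < x" "0 \<le> h"
  shows "h * x powr (\<alpha> - 1) \<le> (x + h) powr \<alpha> - x powr \<alpha>"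
proof -
  have e: "t powr \<alpha> = t * t powr (\<alpha> - 1)" if "0 \<le> t" for t :: real
    using powr_mult_base[OF that, of "\<alpha> - 1"] by simp
  have "(x + h) * x powr (\<alpha> - 1) \<le> (x + h) * (x + h) powr (\<alpha> - 1)"
    using assms by (intro mult_left_mono powr_mono2) auto
  thus ?thesis using assms by (simp add: e algebra_simps)
qed

lemma powr_increment_upper:
  fixes \<alpha> x h :: real
  assumes "1 \<le> \<alpha>" "0 < x" "0 \<le> h"
  shows "(x + h) powr \<alpha> - x powr \<alpha> \<le> \<alpha> * h * (x + h) powr (\<alpha> - 1)"
proof (cases "h = 0")
  case False
  hence "x < x + h" using assms by simp
  then obtain z where z: "x < z" "z < x + h" "(x + h) powr \<alpha> - x powr \<alpha> = (x + h - x) * (\<alpha> * z powr (\<alpha> - 1))"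
    using MVT2[of x "x + h" "\<lambda>t. t powr \<alpha>" "\<lambda>t. \<alpha> * t powr (\<alpha> - 1)"] assms has_real_derivative_powr
    by (meson less_le_trans)
  have "z powr (\<alpha> - 1) \<le> (x + h) powr (\<alpha> - 1)" using z assms by (intro powr_mono2) auto
  thus ?thesis using z(3) assms by (simp add: mult_left_mono mult_ac)
qed simp

text \<open>Quantitative convexity of the power function, from applying the mean value theorem twice.\<close>

lemma powr_second_difference:
  fixes \<alpha> x x' h b :: real
  assumes "1 < \<alpha>" "\<alpha> < 2" "0 < x" "x \<le> x'" "0 \<le> h" "x' + h \<le> b"
  shows "\<alpha> * (\<alpha> - 1) * b powr (\<alpha> - 2) * h * (x' - x)
    \<le> ((x' + h) powr \<alpha> - x' powr \<alpha>) - ((x + h) powr \<alpha> - x powr \<alpha>)"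
proof (cases "x = x' \<or> h = 0")
  case False
  hence xx: "x < x'" "0 < h" using assms by auto
  have dp: "((\<lambda>s. s powr r) has_real_derivative r * t powr (r - 1)) (at t)"
    "((\<lambda>s. (s + h) powr r) has_real_derivative r * (t + h) powr (r - 1)) (at t)" if "x \<le> t" for t r
    using that assms has_real_derivative_powr[of t r] has_real_derivative_powr[of "t + h" r]
      DERIV_shift[of "\<lambda>s. s powr r" "r * (t + h) powr (r - 1)" t h] by auto
  obtain z where z: "x < z" "z < x'"
    "((x' + h) powr \<alpha> - x' powr \<alpha>) - ((x + h) powr \<alpha> - x powr \<alpha>) = (x' - x) * (\<alpha> * (z + h) powr (\<alpha> - 1) - \<alpha> * z powr (\<alpha> - 1))"
    using MVT2[OF xx(1), of "\<lambda>t. (t + h) powr \<alpha> - t powr \<alpha>" "\<lambda>t. \<alpha> * (t + h) powr (\<alpha> - 1) - \<alpha> * t powr (\<alpha> - 1)"]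
      DERIV_diff[OF dp(2) dp(1)] by blast
  have "z < z + h" using xx by simp
  moreover have "((\<lambda>s. s powr (\<alpha> - 1)) has_real_derivative (\<alpha> - 1) * t powr (\<alpha> - 2)) (at t)" if "z \<le> t" "t \<le> z + h" for t
    using dp(1)[of t "\<alpha> - 1"] that z by simp
  ultimately obtain t where t: "z < t" "t < z + h" "(z + h) powr (\<alpha> - 1) - z powr (\<alpha> - 1) = (z + h - z) * ((\<alpha> - 1) * t powr (\<alpha> - 2))"
    using MVT2[of z "z + h" "\<lambda>t. t powr (\<alpha> - 1)" "\<lambda>t. (\<alpha> - 1) * t powr (\<alpha> - 2)"] by blast
  have "b powr (\<alpha> - 2) \<le> t powr (\<alpha> - 2)" using t(1,2) z(1,2) assms by (intro powr_mono2') linarith+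
  hence "(x' - x) * (\<alpha> * (h * ((\<alpha> - 1) * b powr (\<alpha> - 2)))) \<le> (x' - x) * (\<alpha> * (h * ((\<alpha> - 1) * t powr (\<alpha> - 2))))"
    using assms by (intro mult_left_mono) auto
  also have "\<dots> = (x' - x) * (\<alpha> * ((z + h) powr (\<alpha> - 1) - z powr (\<alpha> - 1)))" unfolding t(3) by simp
  finally show ?thesis unfolding z(3) by (simp add: algebra_simps)
qed auto

lemma floor_pow_add_le: assumes "1 \<le> \<alpha>" shows "floor_pow \<alpha> m + int h \<le> floor_pow \<alpha> (m + h)"
proof (cases "m = 0")
  case True
  have "real h \<le> real h powr \<alpha>"
    using powr_mono[of 1 \<alpha> "real h"] assms by (cases "h = 0") auto
  thus ?thesis using True unfolding floor_pow_def by (simp add: le_floor_iff)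
next
  case False
  have "real h * 1 \<le> real h * real m powr (\<alpha> - 1)"
    using False assms by (intro mult_left_mono ge_one_powr_ge_zero) auto
  also have "\<dots> \<le> (real m + real h) powr \<alpha> - real m powr \<alpha>"
    using False assms by (intro powr_increment_lower) auto
  finally have "real m powr \<alpha> + of_int (int h) \<le> real (m + h) powr \<alpha>" by simp
  hence "\<lfloor>real m powr \<alpha> + of_int (int h)\<rfloor> \<le> \<lfloor>real (m + h) powr \<alpha>\<rfloor>" by (rule floor_mono)
  thus ?thesis unfolding floor_pow_def by simp
qed

lemma floor_pow_strict_mono: assumes "1 \<le> \<alpha>" "m < n" shows "floor_pow \<alpha> m < floor_pow \<alpha> n"
  using floor_pow_add_le[OF assms(1), of m "n - m"] assms(2) by simp

lemma floor_pow_inj: assumes "1 \<le> \<alpha>" shows "floor_pow \<alpha> m = floor_pow \<alpha> n \<longleftrightarrow> m = n"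
  using floor_pow_strict_mono[OF assms] by (metis less_irrefl nat_neq_iff)

lemma floor_pow_bounds: "of_int (floor_pow \<alpha> m) \<le> real m powr \<alpha>" "real m powr \<alpha> < of_int (floor_pow \<alpha> m) + 1"
  unfolding floor_pow_def by linarith+

lemma card_spaced:
  fixes S :: "nat set" and d l :: real
  assumes "finite S" "d > 0" "l \<ge> 0"
    and "\<And>m n. m \<in> S \<Longrightarrow> n \<in> S \<Longrightarrow> m < n \<Longrightarrow> real m + d \<le> real n \<and> real n - real m \<le> l"
  shows "real (card S) \<le> l / d + 1"
proof (cases "S = {}")
  case False
  define c where "c = Min S"
  define f where "f = (\<lambda>m. nat \<lfloor>(real m - real c) / d\<rfloor>)"
  have c: "c \<in> S" "\<And>m. m \<in> S \<Longrightarrow> c \<le> m" using assms(1) False by (auto simp: c_def)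
  have lt: "f m < f n" if "m \<in> S" "n \<in> S" "m < n" for m n
  proof -
    have "(real m - real c) / d + 1 \<le> (real n - real c) / d"
    proof -
      have "(real m - real c) / d + 1 = (real m + d - real c) / d" using assms(2) by (simp add: add_divide_distrib diff_divide_distrib)
      also have "\<dots> \<le> (real n - real c) / d" using assms(4)[OF that] assms(2) by (intro divide_right_mono) auto
      finally show ?thesis .
    qed
    hence "\<lfloor>(real m - real c) / d\<rfloor> + 1 \<le> \<lfloor>(real n - real c) / d\<rfloor>" by linarith
    moreover have "0 \<le> \<lfloor>(real m - real c) / d\<rfloor>" using c(2)[OF that(1)] assms(2) by simp
    ultimately show ?thesis unfolding f_def by linarith
  qed
  have "inj_on f S" by (rule inj_onI) (metis lt less_irrefl nat_neq_iff)
  moreover have "f ` S \<subseteq> {..nat \<lfloor>l / d\<rfloor>}"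
  proof
    fix k assume "k \<in> f ` S"
    then obtain m where m: "m \<in> S" "k = f m" by blast
    have "real m - real c \<le> l" using assms(3,4) c m by (cases "c = m") (auto simp: le_less)
    hence "(real m - real c) / d \<le> l / d" using assms(2) by (simp add: divide_right_mono)
    thus "k \<in> {..nat \<lfloor>l / d\<rfloor>}" unfolding m(2) f_def by (simp add: nat_mono floor_mono)
  qed
  ultimately have "card S \<le> card {..nat \<lfloor>l / d\<rfloor>}" by (intro card_inj_on_le) auto
  also have "real (card {..nat \<lfloor>l / d\<rfloor>}) \<le> l / d + 1" using assms(2,3) by simp
  finally show ?thesis by simp
qed (use assms in auto)

lemma sum_inverse_le_ln: assumes "1 \<le> D" shows "(\<Sum>d=1..D. 1 / real d) \<le> 1 + ln (real D)"
  using assms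
proof (induction D rule: dec_induct)
  case (step n)
  have "ln (real n / (real n + 1)) \<le> real n / (real n + 1) - 1" using step by (intro ln_le_minus_one) auto
  also have "\<dots> = - (1 / (real n + 1))" by (simp add: field_simps)
  finally have "1 / (real n + 1) \<le> ln (real n + 1) - ln (real n)" using step by (simp add: ln_div)
  thus ?case using step by (simp add: add.commute)
qed auto

text \<open>Fix the difference \<open>h\<close> of the two integers. As a function of the smaller one, the difference of the powers grows at rate at
least \<open>\<kappa> h\<close> and must stay in a window of length \<open>2\<close>, which leaves at most \<open>2 / (\<kappa> h) + 1\<close> possibilities. Moreover
\<open>h \<le> z\<close>, since integer parts of powers grow at least as fast as the integers.\<close>

lemma card_floor_pow_diff_pos:
  assumes "1 < \<alpha>" "\<alpha> < 2" "0 < b" "0 < z"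
  defines "\<kappa> \<equiv> \<alpha> * (\<alpha> - 1) * b powr (\<alpha> - 2)"
  shows "real (card {(m, n). 0 < m \<and> real m \<le> b \<and> 0 < n \<and> real n \<le> b \<and> floor_pow \<alpha> m - floor_pow \<alpha> n = z})
    \<le> 2 / \<kappa> * (1 + ln (real_of_int z)) + real_of_int z"
proof -
  have k: "\<kappa> > 0" using assms by (auto simp: \<kappa>_def)
  let ?D = "{(m, n). 0 < m \<and> real m \<le> b \<and> 0 < n \<and> real n \<le> b \<and> floor_pow \<alpha> m - floor_pow \<alpha> n = z}"
  define S where "S = (\<lambda>h. {n. 0 < n \<and> real (n + h) \<le> b \<and> floor_pow \<alpha> (n + h) - floor_pow \<alpha> n = z})"
  have finS: "finite (S h)" for h
    by (rule finite_subset[of _ "{..nat \<lfloor>b\<rfloor>}"]) (auto simp: S_def le_nat_floor)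
  have sub: "?D \<subseteq> (\<Union>h\<in>{1..nat z}. (\<lambda>n. (n + h, n)) ` S h)"
  proof safe
    fix m n assume a: "0 < m" "real m \<le> b" "0 < n" "real n \<le> b" "z = floor_pow \<alpha> m - floor_pow \<alpha> n"
    have mn: "n < m" using a assms(1,4) floor_pow_strict_mono[of \<alpha> m n] floor_pow_inj[of \<alpha> m n] by (cases m n rule: linorder_cases) auto
    have "int (m - n) \<le> z" using floor_pow_add_le[of \<alpha> n "m - n"] mn a(5) assms(1) by simp
    thus "(m, n) \<in> (\<Union>h\<in>{1..nat (floor_pow \<alpha> m - floor_pow \<alpha> n)}. (\<lambda>n. (n + h, n)) ` S h)"
      using mn a by (intro UN_I[of "m - n"] image_eqI[of _ _ n]) (auto simp: S_def)
  qed
  have cS: "real (card (S h)) \<le> 2 / (\<kappa> * real h) + 1" if "h \<in> {1..nat z}" for h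
  proof -
    have "real (card (S h)) \<le> (2 / (\<kappa> * real h)) / 1 + 1"
    proof (rule card_spaced[OF finS])
      show "0 \<le> 2 / (\<kappa> * real h)" using k by simp
      fix m n assume mn: "m \<in> S h" "n \<in> S h" "m < n"
      have "\<kappa> * real h * (real n - real m) \<le>
        ((real n + real h) powr \<alpha> - real n powr \<alpha>) - ((real m + real h) powr \<alpha> - real m powr \<alpha>)"
        unfolding \<kappa>_def using mn assms(1,2) by (intro powr_second_difference) (auto simp: S_def)
      also have "\<dots> \<le> 2"
      proof -
        have "floor_pow \<alpha> (n + h) - floor_pow \<alpha> n = z" "floor_pow \<alpha> (m + h) - floor_pow \<alpha> m = z"
          using mn(1,2) unfolding S_def by blast+
        hence "real_of_int z = of_int (floor_pow \<alpha> (n + h)) - of_int (floor_pow \<alpha> n)" "real_of_int z = of_int (floor_pow \<alpha> (m + h)) - of_int (floor_pow \<alpha> m)"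
          by (metis of_int_diff)+
        thus ?thesis using floor_pow_bounds[where m = n and \<alpha> = \<alpha>] floor_pow_bounds[where m = m and \<alpha> = \<alpha>]
          floor_pow_bounds[where m = "n + h" and \<alpha> = \<alpha>] floor_pow_bounds[where m = "m + h" and \<alpha> = \<alpha>]
          unfolding of_nat_add by linarith
      qed
      finally have "real n - real m \<le> 2 / (\<kappa> * real h)"
        using k that by (simp add: pos_le_divide_eq mult_ac)
      thus "real m + 1 \<le> real n \<and> real n - real m \<le> 2 / (\<kappa> * real h)" using mn(3) by simp
    qed simp
    thus ?thesis by simp
  qed
  have "card ?D \<le> card (\<Union>h\<in>{1..nat z}. (\<lambda>n. (n + h, n)) ` S h)"
    using finS by (intro card_mono[OF _ sub]) auto
  also have "\<dots> \<le> (\<Sum>h=1..nat z. card ((\<lambda>n. (n + h, n)) ` S h))" by (rule card_UN_le) simp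
  also have "\<dots> \<le> (\<Sum>h=1..nat z. card (S h))" by (intro sum_mono card_image_le finS)
  finally have "real (card ?D) \<le> real (\<Sum>h=1..nat z. card (S h))" by (rule of_nat_mono)
  also have "\<dots> = (\<Sum>h=1..nat z. real (card (S h)))" by simp
  also have "\<dots> \<le> (\<Sum>h=1..nat z. 2 / \<kappa> * (1 / real h) + 1)" using cS by (intro sum_mono) simp
  also have "\<dots> = 2 / \<kappa> * (\<Sum>h=1..nat z. 1 / real h) + real (nat z)"
    by (simp only: sum.distrib sum_distrib_left) simp
  also have "\<dots> \<le> 2 / \<kappa> * (1 + ln (real (nat z))) + real (nat z)"
    using k assms(4) by (intro add_right_mono mult_left_mono sum_inverse_le_ln) auto
  finally show ?thesis using assms(4) by simp
qed

lemma card_floor_pow_diff: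
  assumes "1 < \<alpha>" "\<alpha> < 2" "0 < b" "real_of_int \<bar>z\<bar> \<le> Z" "1 \<le> Z"
  defines "\<kappa> \<equiv> \<alpha> * (\<alpha> - 1) * b powr (\<alpha> - 2)"
  shows "real (card {(m, n). 0 < m \<and> real m \<le> b \<and> 0 < n \<and> real n \<le> b \<and> m \<noteq> n \<and> floor_pow \<alpha> m - floor_pow \<alpha> n = z})
    \<le> 2 / \<kappa> * (1 + ln Z) + Z" (is "real (card (?D z)) \<le> ?R Z")
proof -
  have k: "\<kappa> > 0" using assms by (auto simp: \<kappa>_def)
  have fin: "finite {(m, n). 0 < m \<and> real m \<le> b \<and> 0 < n \<and> real n \<le> b \<and> floor_pow \<alpha> m - floor_pow \<alpha> n = z}" for z
    by (rule finite_subset[of _ "{..nat \<lfloor>b\<rfloor>} \<times> {..nat \<lfloor>b\<rfloor>}"]) (auto simp: le_nat_floor)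
  have pos: "real (card (?D z)) \<le> ?R Z" if "0 < z" "real_of_int z \<le> Z" for z
  proof -
    have "real (card (?D z)) \<le> ?R (real_of_int z)"
      by (rule order.trans[OF _ card_floor_pow_diff_pos[OF assms(1-3) that(1), folded \<kappa>_def]])
         (auto intro!: card_mono fin)
    also have "\<dots> \<le> ?R Z" using that k by (intro add_mono mult_left_mono) auto
    finally show ?thesis by simp
  qed
  consider "z > 0" | "z < 0" | "z = 0" by linarith
  thus ?thesis
  proof cases
    case 1 thus ?thesis using pos assms(4) by simp
  next
    case 2
    have "?D z = (\<lambda>(m, n). (n, m)) ` ?D (- z)" by (auto simp: image_iff)
    moreover have "inj_on (\<lambda>(m, n). (n, m)) (?D (- z))" by (auto simp: inj_on_def)
    ultimately have "card (?D z) = card (?D (- z))" by (simp add: card_image)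
    thus ?thesis using pos[of "- z"] 2 assms(4) by simp
  next
    case 3
    have e: "?D z = {}" using 3 floor_pow_inj[of \<alpha>] assms(1) by auto
    have "0 \<le> ?R Z" using k assms(5) by (intro add_nonneg_nonneg mult_nonneg_nonneg) auto
    thus ?thesis unfolding e by simp
  qed
qed

text \<open>An argument in the style of Jarnik's bound for lattice points on convex curves. Let \<open>(m, n)\<close> and \<open>(m + d, n - e)\<close>
be consecutive solutions. Then \<open>((m + d) powr \<alpha> - m powr \<alpha>) - (n powr \<alpha> - (n - e) powr \<alpha>)\<close> lies between
\<open>-2\<close> and \<open>2\<close>. As \<open>m\<close> grows, \<open>n\<close> decreases, so by convexity this expression increases at rate at least
\<open>\<kappa> d\<close>. For fixed \<open>(d, e)\<close> the possible \<open>m\<close> therefore lie in an interval of length \<open>4 / (\<kappa> d)\<close>, and they are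
\<open>d\<close> apart, so there are at most \<open>4 / (\<kappa> d\<^sup>2) + 1\<close> of them. Summing over the \<open>O(d)\<close> values of \<open>e\<close> and
over \<open>d \<le> D\<close> gives the last summand; gaps longer than \<open>D\<close> occur at most \<open>b / D + 1\<close> times.\<close>

lemma card_floor_pow_sum:
  fixes \<alpha> a b K :: real and D :: nat and x :: int
  assumes "1 < \<alpha>" "\<alpha> < 2" "1 \<le> a" "a \<le> b" "b \<le> K * a" "1 \<le> D"
  defines "\<kappa> \<equiv> \<alpha> * (\<alpha> - 1) * b powr (\<alpha> - 2)"
  shows "real (card {(m, n). a \<le> real m \<and> real m \<le> b \<and> a \<le> real n \<and> real n \<le> b \<and> floor_pow \<alpha> m + floor_pow \<alpha> n = x})
    \<le> 2 + b / real D + (2 * K + 2) * (4 / \<kappa> * (1 + ln (real D)) + (real D)\<^sup>2)"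
proof -
  have k: "\<kappa> > 0" using assms by (auto simp: \<kappa>_def)
  have K: "K \<ge> 1"
  proof (rule ccontr)
    assume "\<not> K \<ge> 1"
    hence "K * a < 1 * a" using assms(3) by (intro mult_strict_right_mono) auto
    thus False using assms(4,5) by linarith
  qed
  define Sol where "Sol = {(m, n). a \<le> real m \<and> real m \<le> b \<and> a \<le> real n \<and> real n \<le> b \<and> floor_pow \<alpha> m + floor_pow \<alpha> n = x}"
  define S where "S = fst ` Sol"
  have finSol: "finite Sol"
    by (rule finite_subset[of _ "{..nat \<lfloor>b\<rfloor>} \<times> {..nat \<lfloor>b\<rfloor>}"]) (auto simp: Sol_def le_nat_floor)
  hence finS: "finite S" by (simp add: S_def)
  have inj: "inj_on fst Sol"
  proof (rule inj_onI)
    fix p q assume pq: "p \<in> Sol" "q \<in> Sol" "fst p = fst q"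
    hence "floor_pow \<alpha> (snd p) = floor_pow \<alpha> (snd q)" by (auto simp: Sol_def)
    thus "p = q" using floor_pow_inj[of \<alpha>] assms(1) pq(3) by (simp add: prod_eq_iff)
  qed
  define nx where "nx = (\<lambda>m. SOME n. (m, n) \<in> Sol)"
  have nx: "(m, nx m) \<in> Sol" if "m \<in> S" for m
    using that unfolding S_def nx_def by (auto intro: someI)
  have nx_less: "nx n < nx m" if "m \<in> S" "n \<in> S" "m < n" for m n
  proof (rule ccontr)
    assume "\<not> nx n < nx m"
    hence "floor_pow \<alpha> (nx m) \<le> floor_pow \<alpha> (nx n)" using floor_pow_strict_mono[of \<alpha> "nx m" "nx n"] assms(1) by (cases "nx m = nx n") auto
    moreover have "floor_pow \<alpha> m < floor_pow \<alpha> n" using floor_pow_strict_mono[of \<alpha> m n] that assms(1) by simp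
    ultimately show False using nx[OF that(1)] nx[OF that(2)] by (auto simp: Sol_def)
  qed
  define S' where "S' = S - {Max S}"
  (* The solution following m; Max S has none and is counted separately. *)
  define next_sol where "next_sol = (\<lambda>m. Min {n \<in> S. m < n})"
  have nxt: "next_sol m \<in> S" "m < next_sol m" "\<And>n. n \<in> S \<Longrightarrow> m < n \<Longrightarrow> next_sol m \<le> n" if "m \<in> S'" for m
  proof -
    have "Max S \<in> S" "m < Max S" using that finS Max_in[OF finS] Max_ge[OF finS, of m] unfolding S'_def
      by (blast, simp add: le_less)
    hence ne: "{n \<in> S. m < n} \<noteq> {}" by blast
    show "next_sol m \<in> S" "m < next_sol m" using Min_in[OF _ ne] finS by (auto simp: next_sol_def)
    show "next_sol m \<le> n" if "n \<in> S" "m < n" for n using that finS by (auto simp: next_sol_def)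
  qed
  define \<delta> where "\<delta> = (\<lambda>m. next_sol m - m)"
  define \<epsilon> where "\<epsilon> = (\<lambda>m. nx m - nx (next_sol m))"
  have \<delta>: "1 \<le> \<delta> m" "next_sol m = m + \<delta> m" if "m \<in> S'" for m using nxt(2)[OF that] by (auto simp: \<delta>_def)
  have \<epsilon>: "1 \<le> \<epsilon> m" "nx m = nx (next_sol m) + \<epsilon> m" if "m \<in> S'" for m
    using nx_less[OF _ nxt(1,2)[OF that]] that by (auto simp: \<epsilon>_def S'_def)
  define A where "A = (\<lambda>m. (real m + real (\<delta> m)) powr \<alpha> - real m powr \<alpha>)"
  define B where "B = (\<lambda>m. (real (nx (next_sol m)) + real (\<epsilon> m)) powr \<alpha> - real (nx (next_sol m)) powr \<alpha>)"
  (* Taking integer parts perturbs each of the four powers by less than one. *)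
  have AB: "\<bar>A m - B m\<bar> \<le> 2" if m: "m \<in> S'" for m
  proof -
    have "floor_pow \<alpha> m + floor_pow \<alpha> (nx m) = x" "floor_pow \<alpha> (next_sol m) + floor_pow \<alpha> (nx (next_sol m)) = x"
      using nx[of m] nx[of "next_sol m"] m nxt(1)[OF m] by (auto simp: Sol_def S'_def)
    hence "real_of_int (floor_pow \<alpha> m) + of_int (floor_pow \<alpha> (nx m)) = of_int (floor_pow \<alpha> (next_sol m)) + of_int (floor_pow \<alpha> (nx (next_sol m)))"
      by (metis of_int_add)
    moreover have "A m - B m = (real (next_sol m) powr \<alpha> - real m powr \<alpha>) - (real (nx m) powr \<alpha> - real (nx (next_sol m)) powr \<alpha>)"
      unfolding A_def B_def using \<delta>(2)[OF m] \<epsilon>(2)[OF m] by (metis of_nat_add)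
    ultimately show ?thesis
      using floor_pow_bounds[where m = m and \<alpha> = \<alpha>] floor_pow_bounds[where m = "nx m" and \<alpha> = \<alpha>]
       floor_pow_bounds[where m = "next_sol m" and \<alpha> = \<alpha>] floor_pow_bounds[where m = "nx (next_sol m)" and \<alpha> = \<alpha>] by linarith
  qed
  have rng: "a \<le> real m" "real m \<le> b" "a \<le> real (nx m)" "real (nx m) \<le> b" if "m \<in> S" for m
    using nx[OF that] by (auto simp: Sol_def)
  have rng': "m \<in> S" "next_sol m \<in> S" if "m \<in> S'" for m using that nxt(1) by (auto simp: S'_def)
  define E where "E = (\<lambda>d::nat. nat \<lfloor>(2 * K + 2) * real d\<rfloor>)"
  (* The two increments nearly agree and all arguments are comparable, so e is O(d). *)
  have eE: "\<epsilon> m \<le> E (\<delta> m)" if m: "m \<in> S'" for m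
  proof -
    have "real (\<epsilon> m) * a powr (\<alpha> - 1) \<le> real (\<epsilon> m) * real (nx (next_sol m)) powr (\<alpha> - 1)"
      using rng[OF rng'(2)[OF m]] assms by (intro mult_left_mono powr_mono2) auto
    also have "\<dots> \<le> B m" unfolding B_def
      using rng[OF rng'(2)[OF m]] assms by (intro powr_increment_lower) auto
    also have "\<dots> \<le> A m + 2" using AB[OF m] by linarith
    also have "A m \<le> \<alpha> * real (\<delta> m) * (real m + real (\<delta> m)) powr (\<alpha> - 1)" unfolding A_def
      using rng[OF rng'(1)[OF m]] assms by (intro powr_increment_upper) auto
    also have "\<dots> \<le> 2 * real (\<delta> m) * (K * a powr (\<alpha> - 1))"
    proof (intro mult_mono)
      have "(real m + real (\<delta> m)) powr (\<alpha> - 1) \<le> (K * a) powr (\<alpha> - 1)"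
        using rng[OF rng'(2)[OF m]] \<delta>(2)[OF m] assms by (intro powr_mono2) auto
      also have "\<dots> = K powr (\<alpha> - 1) * a powr (\<alpha> - 1)" by (rule powr_mult)
      also have "\<dots> \<le> K powr 1 * a powr (\<alpha> - 1)" using K assms by (intro mult_right_mono powr_mono) auto
      finally show "(real m + real (\<delta> m)) powr (\<alpha> - 1) \<le> K * a powr (\<alpha> - 1)" using K by simp
    qed (use assms in auto)
    also have "2 * real (\<delta> m) * (K * a powr (\<alpha> - 1)) + 2 \<le> ((2 * K + 2) * real (\<delta> m)) * a powr (\<alpha> - 1)"
    proof -
      have "1 \<le> a powr (\<alpha> - 1)" using assms by (intro ge_one_powr_ge_zero) auto
      hence "1 * 1 \<le> real (\<delta> m) * a powr (\<alpha> - 1)" using \<delta>(1)[OF m] by (intro mult_mono) auto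
      thus ?thesis by (simp add: algebra_simps)
    qed
    finally have "real (\<epsilon> m) \<le> (2 * K + 2) * real (\<delta> m)" using assms(3) by simp
    thus ?thesis unfolding E_def by (rule le_nat_floor)
  qed
  define S1 where "S1 = {m \<in> S'. D < \<delta> m}"
  define S2 where "S2 = (\<lambda>d e. {m \<in> S'. \<delta> m = d \<and> \<epsilon> m = e})"
  have fin2: "finite S1" "finite (S2 d e)" for d e using finS by (auto simp: S1_def S2_def S'_def)
  have sub: "S \<subseteq> insert (Max S) (S1 \<union> (\<Union>d\<in>{1..D}. \<Union>e\<in>{1..E d}. S2 d e))"
  proof
    fix m assume m: "m \<in> S"
    show "m \<in> insert (Max S) (S1 \<union> (\<Union>d\<in>{1..D}. \<Union>e\<in>{1..E d}. S2 d e))"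
    proof (cases "m = Max S \<or> m \<in> S1")
      case False
      hence m': "m \<in> S'" "\<delta> m \<le> D" using m by (auto simp: S'_def S1_def)
      hence "\<delta> m \<in> {1..D}" "\<epsilon> m \<in> {1..E (\<delta> m)}" "m \<in> S2 (\<delta> m) (\<epsilon> m)" using \<delta>(1) \<epsilon>(1) eE by (auto simp: S2_def)
      thus ?thesis by blast
    qed auto
  qed
  have c1: "real (card S1) \<le> b / real D + 1"
  proof (rule card_spaced[OF fin2(1)])
    fix m n assume mn: "m \<in> S1" "n \<in> S1" "m < n"
    hence m': "m \<in> S'" "n \<in> S" "D < \<delta> m" by (auto simp: S1_def S'_def)
    have "m + \<delta> m \<le> n" using nxt(3)[OF m'(1,2) mn(3)] \<delta>(2)[OF m'(1)] by simp
    hence "real m + real D \<le> real n" using m'(3) by linarith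
    thus "real m + real D \<le> real n \<and> real n - real m \<le> b" using rng[OF m'(2)] by simp
  qed (use assms in auto)
  have c2: "real (card (S2 d e)) \<le> 4 / (\<kappa> * (real d)\<^sup>2) + 1" if d: "1 \<le> d" for d e
  proof -
    have "real (card (S2 d e)) \<le> (4 / (\<kappa> * real d)) / real d + 1"
    proof (rule card_spaced[OF fin2(2)])
      show "0 \<le> 4 / (\<kappa> * real d)" using k by simp
      fix m n assume mn: "m \<in> S2 d e" "n \<in> S2 d e" "m < n"
      hence m': "m \<in> S'" "n \<in> S'" "\<delta> m = d" "\<delta> n = d" "\<epsilon> m = e" "\<epsilon> n = e" by (auto simp: S2_def)
      note r = rng[OF rng'(1)[OF m'(1)]] rng[OF rng'(2)[OF m'(1)]] rng[OF rng'(1)[OF m'(2)]] rng[OF rng'(2)[OF m'(2)]]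
      have le: "m + d \<le> n" using nxt(3)[OF m'(1) rng'(1)[OF m'(2)] mn(3)] \<delta>(2)[OF m'(1)] m'(3) by simp
      have "nx n < nx m" by (rule nx_less[OF rng'(1)[OF m'(1)] rng'(1)[OF m'(2)] mn(3)])
      hence nn: "nx (next_sol n) \<le> nx (next_sol m)" using \<epsilon>(2)[OF m'(1)] \<epsilon>(2)[OF m'(2)] m' by linarith
      have "\<kappa> * real d * (real n - real m) \<le> A n - A m"
        unfolding A_def m'(3,4) \<kappa>_def using mn(3) assms(1-3) r \<delta>(2)[OF m'(2)] m'(4)
        by (intro powr_second_difference) auto
      also have "\<dots> \<le> 4"
      proof -
        have "\<alpha> * (\<alpha> - 1) * b powr (\<alpha> - 2) * real e * (real (nx (next_sol m)) - real (nx (next_sol n))) \<le> B m - B n"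
          unfolding B_def m'(5,6) using nn assms(1-3) r \<epsilon>(2)[OF m'(1)] m'(5)
          by (intro powr_second_difference) auto
        moreover have "0 \<le> \<alpha> * (\<alpha> - 1) * b powr (\<alpha> - 2) * real e * (real (nx (next_sol m)) - real (nx (next_sol n)))"
          using nn assms(1,2) by (intro mult_nonneg_nonneg) auto
        ultimately show ?thesis using AB[OF m'(1)] AB[OF m'(2)] by linarith
      qed
      finally have "real n - real m \<le> 4 / (\<kappa> * real d)"
        using k d by (simp add: pos_le_divide_eq mult_ac)
      thus "real m + real d \<le> real n \<and> real n - real m \<le> 4 / (\<kappa> * real d)" using le by linarith
    qed (use d in auto)
    thus ?thesis by (simp add: power2_eq_square mult.assoc)
  qed
  define X where "X = (\<Union>d\<in>{1..D}. \<Union>e\<in>{1..E d}. S2 d e)"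
  have finX: "finite X" using fin2 by (auto simp: X_def)
  have cX: "card X \<le> (\<Sum>d=1..D. \<Sum>e=1..E d. card (S2 d e))"
    unfolding X_def by (rule order.trans[OF card_UN_le]) (auto intro!: sum_mono card_UN_le)
  have "card S \<le> card (insert (Max S) (S1 \<union> X))"
    using fin2 finX sub unfolding X_def[symmetric] by (intro card_mono) auto
  also have "\<dots> \<le> Suc (card (S1 \<union> X))" using fin2 finX by (simp add: card_insert_if)
  also have "\<dots> \<le> Suc (card S1 + card X)" using card_Un_le[of S1 X] by simp
  also have "\<dots> \<le> Suc (card S1 + (\<Sum>d=1..D. \<Sum>e=1..E d. card (S2 d e)))" using cX by simp
  finally have "real (card S) \<le> real (Suc (card S1 + (\<Sum>d=1..D. \<Sum>e=1..E d. card (S2 d e))))" by (rule of_nat_mono)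
  moreover have "card Sol = card S" unfolding S_def using card_image[OF inj] by simp
  ultimately have "real (card Sol) \<le> 1 + real (card S1) + (\<Sum>d=1..D. \<Sum>e=1..E d. real (card (S2 d e)))"
    by simp
  also have "(\<Sum>d=1..D. \<Sum>e=1..E d. real (card (S2 d e))) \<le> (\<Sum>d=1..D. (2 * K + 2) * (4 / \<kappa> * (1 / real d) + real d))"
  proof (rule sum_mono)
    fix d assume d: "d \<in> {1..D}"
    have "(\<Sum>e=1..E d. real (card (S2 d e))) \<le> (\<Sum>e=1..E d. 4 / (\<kappa> * (real d)\<^sup>2) + 1)"
      using c2 d by (intro sum_mono) auto
    also have "\<dots> = real (E d) * (4 / (\<kappa> * (real d)\<^sup>2) + 1)" by simp
    also have "\<dots> \<le> ((2 * K + 2) * real d) * (4 / (\<kappa> * (real d)\<^sup>2) + 1)"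
      using k K by (intro mult_right_mono) (auto simp: E_def)
    also have "\<dots> = (2 * K + 2) * (real d * (4 / (\<kappa> * (real d)\<^sup>2) + 1))" by (rule mult.assoc)
    also have "real d * (4 / (\<kappa> * (real d)\<^sup>2) + 1) = 4 / \<kappa> * (1 / real d) + real d"
      using d by (simp add: distrib_left power2_eq_square)
    finally show "(\<Sum>e=1..E d. real (card (S2 d e))) \<le> (2 * K + 2) * (4 / \<kappa> * (1 / real d) + real d)" .
  qed
  also have "\<dots> = (2 * K + 2) * (4 / \<kappa> * (\<Sum>d=1..D. 1 / real d) + (\<Sum>d=1..D. real d))"
    by (simp only: sum_distrib_left distrib_left sum.distrib)
  also have "\<dots> \<le> (2 * K + 2) * (4 / \<kappa> * (1 + ln (real D)) + (real D)\<^sup>2)"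
  proof (intro mult_left_mono add_mono sum_inverse_le_ln)
    have "(\<Sum>d=1..D. real d) \<le> (\<Sum>d=1..D. real D)" by (intro sum_mono) auto
    thus "(\<Sum>d=1..D. real d) \<le> (real D)\<^sup>2" by (simp add: power2_eq_square)
  qed (use k K assms in auto)
  finally show ?thesis using c1 unfolding Sol_def[symmetric] by linarith
qed

section \<open>Energies of sums of point masses\<close>

definition delta :: "int \<Rightarrow> complex" where "delta x = (if x = 0 then 1 else 0)"

lemma finite_support_sqsum:
  assumes "finite X" "\<And>x. x \<notin> X \<Longrightarrow> F x = 0"
  shows "F \<in> ell2" "sqsum F = (\<Sum>x\<in>X. (cmod (F x))\<^sup>2)"
proof -
  have "(\<lambda>x. (cmod (F x))\<^sup>2) summable_on UNIV \<longleftrightarrow> (\<lambda>x. (cmod (F x))\<^sup>2) summable_on X"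
    by (rule summable_on_cong_neutral) (use assms in auto)
  thus "F \<in> ell2" using assms(1) by (simp add: ell2_def)
  have "infsum (\<lambda>x. (cmod (F x))\<^sup>2) UNIV = infsum (\<lambda>x. (cmod (F x))\<^sup>2) X"
    by (rule infsum_cong_neutral) (use assms in auto)
  thus "sqsum F = (\<Sum>x\<in>X. (cmod (F x))\<^sup>2)" using assms(1) by (simp add: sqsum_def)
qed

lemma delta_ell2: "delta \<in> ell2" and sqsum_delta: "sqsum delta = 1"
  using finite_support_sqsum[of "{0}" delta] by (auto simp: delta_def)

lemma delta_ell1: "delta \<in> ell1" and ell1_norm_delta: "ell1_norm delta = 1"
proof -
  have "(\<lambda>x. cmod (delta x)) summable_on UNIV \<longleftrightarrow> (\<lambda>x. cmod (delta x)) summable_on {0}"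
    by (rule summable_on_cong_neutral) (auto simp: delta_def)
  thus "delta \<in> ell1" by (simp add: ell1_def)
  have "infsum (\<lambda>x. cmod (delta x)) UNIV = infsum (\<lambda>x. cmod (delta x)) {0}"
    by (rule infsum_cong_neutral) (auto simp: delta_def)
  thus "ell1_norm delta = 1" by (simp add: ell1_norm_def delta_def)
qed

text \<open>Collisions between atoms are the only source of interaction in the squared norm.\<close>

lemma sqsum_atoms_le:
  fixes u :: "'p \<Rightarrow> complex" and g :: "'p \<Rightarrow> int"
  assumes "finite S" "\<And>x. F x = (\<Sum>p\<in>S. u p * delta (x - g p))"
  shows "F \<in> ell2" "sqsum F \<le> (\<Sum>p\<in>S. \<Sum>q\<in>S. if g q = g p then cmod (u p) * cmod (u q) else 0)"
proof -
  have F: "F x = (\<Sum>p\<in>{p\<in>S. g p = x}. u p)" for x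
    unfolding assms(2) sum.inter_filter[OF assms(1)] by (intro sum.cong) (auto simp: delta_def)
  have z: "F x = 0" if "x \<notin> g ` S" for x
  proof -
    have e: "{p\<in>S. g p = x} = {}" using that by auto
    show ?thesis unfolding F e by simp
  qed
  note fs = finite_support_sqsum[of "g ` S" F, OF finite_imageI[OF assms(1)] z]
  show "F \<in> ell2" by (rule fs)
  have "sqsum F = (\<Sum>x\<in>g ` S. (cmod (F x))\<^sup>2)" by (rule fs)
  also have "\<dots> \<le> (\<Sum>x\<in>g ` S. \<Sum>p\<in>{p\<in>S. g p = x}. \<Sum>q\<in>S. if g q = g p then cmod (u p) * cmod (u q) else 0)"
  proof (rule sum_mono)
    fix x
    have "(cmod (F x))\<^sup>2 \<le> (\<Sum>p\<in>{p\<in>S. g p = x}. cmod (u p))\<^sup>2"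
      unfolding F by (intro power_mono norm_sum) auto
    also have "\<dots> = (\<Sum>p\<in>{p\<in>S. g p = x}. \<Sum>q\<in>{q\<in>S. g q = x}. cmod (u p) * cmod (u q))"
      by (simp add: power2_eq_square sum_product)
    also have "\<dots> = (\<Sum>p\<in>{p\<in>S. g p = x}. \<Sum>q\<in>S. if g q = g p then cmod (u p) * cmod (u q) else 0)"
    proof (rule sum.cong[OF refl])
      fix p assume "p \<in> {p\<in>S. g p = x}"
      thus "(\<Sum>q\<in>{q\<in>S. g q = x}. cmod (u p) * cmod (u q)) = (\<Sum>q\<in>S. if g q = g p then cmod (u p) * cmod (u q) else 0)"
        unfolding sum.inter_filter[OF assms(1)] by simp
    qed
    finally show "(cmod (F x))\<^sup>2 \<le> (\<Sum>p\<in>{p\<in>S. g p = x}. \<Sum>q\<in>S. if g q = g p then cmod (u p) * cmod (u q) else 0)" .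
  qed
  also have "\<dots> = (\<Sum>p\<in>S. \<Sum>q\<in>S. if g q = g p then cmod (u p) * cmod (u q) else 0)"
    by (rule sum.group) (use assms in auto)
  finally show "sqsum F \<le> (\<Sum>p\<in>S. \<Sum>q\<in>S. if g q = g p then cmod (u p) * cmod (u q) else 0)" .
qed

text \<open>The additive energy of the points \<open>y i\<close>, bounded by the largest number of representations times the number of
pairs.\<close>

lemma sqsum_shift_sum_twice_le:
  fixes y :: "'i \<Rightarrow> int"
  assumes "finite J" "\<And>i. i \<in> J \<Longrightarrow> \<bar>w i\<bar> \<le> W" "0 \<le> W"
    "\<And>x. real (card {(i, j). i \<in> J \<and> j \<in> J \<and> y i + y j = x}) \<le> r"
  shows "sqsum (shift_sum J w y (shift_sum J w y delta)) \<le> W ^ 4 * r * (real (card J))\<^sup>2"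
proof -
  define u where "u = (\<lambda>(i, j). complex_of_real (w i) * of_real (w j))"
  define g where "g = (\<lambda>(i, j). y i + y j)"
  have "shift_sum J w y (shift_sum J w y delta) x = (\<Sum>p\<in>J \<times> J. u p * delta (x - g p))" for x
    by (simp add: shift_sum_def sum_distrib_left sum.cartesian_product u_def g_def split_def algebra_simps)
  from sqsum_atoms_le(2)[OF finite_cartesian_product[OF assms(1,1)] this]
  have "sqsum (shift_sum J w y (shift_sum J w y delta))
    \<le> (\<Sum>p\<in>J\<times>J. \<Sum>q\<in>J\<times>J. if g q = g p then cmod (u p) * cmod (u q) else 0)" .
  also have "\<dots> \<le> (\<Sum>p\<in>J\<times>J. \<Sum>q\<in>J\<times>J. if g q = g p then W ^ 4 else 0)"
  proof (intro sum_mono)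
    fix p q assume pq: "p \<in> J \<times> J" "q \<in> J \<times> J"
    have cu: "cmod (u p) \<le> W * W" if "p \<in> J \<times> J" for p
      using that assms(2,3) by (auto simp: u_def norm_mult intro!: mult_mono)
    have "cmod (u p) * cmod (u q) \<le> (W * W) * (W * W)"
      using cu[OF pq(1)] cu[OF pq(2)] assms(3) by (intro mult_mono) auto
    thus "(if g q = g p then cmod (u p) * cmod (u q) else 0) \<le> (if g q = g p then W ^ 4 else 0)"
      by (simp add: power4_eq_xxxx mult.assoc)
  qed
  also have "\<dots> = (\<Sum>p\<in>J\<times>J. W ^ 4 * real (card {q\<in>J\<times>J. g q = g p}))"
    by (intro sum.cong refl) (simp add: sum.inter_filter[symmetric] assms(1))
  also have "\<dots> \<le> (\<Sum>p\<in>J\<times>J. W ^ 4 * r)"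
  proof (intro sum_mono mult_left_mono)
    fix p
    have "{q\<in>J\<times>J. g q = g p} = {(i, j). i \<in> J \<and> j \<in> J \<and> y i + y j = g p}" by (auto simp: g_def)
    thus "real (card {q\<in>J\<times>J. g q = g p}) \<le> r" using assms(4) by simp
  qed (use assms(3) in auto)
  finally show ?thesis by (simp add: power2_eq_square card_cartesian_product mult_ac)
qed

text \<open>Were the translates of \<open>g\<close> disjoint, the squared norms would add up, which is the first summand. The second one
accounts for translates that overlap, weighted by how often two of the points \<open>y i\<close> differ by a given difference of points of
\<open>Z\<close>.\<close>

lemma sqsum_shift_sum_le_almost_orthogonal:
  fixes y :: "'i \<Rightarrow> int"
  assumes "finite J" "\<And>i. i \<in> J \<Longrightarrow> \<bar>w i\<bar> \<le> W" "0 \<le> W"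
    and Z: "finite Z" "\<And>x. x \<notin> Z \<Longrightarrow> g x = 0"
    and \<rho>: "\<And>z z'. z \<in> Z \<Longrightarrow> z' \<in> Z \<Longrightarrow> real (card {(i, j). i \<in> J \<and> j \<in> J \<and> i \<noteq> j \<and> y i - y j = z' - z}) \<le> \<rho>"
  shows "sqsum (shift_sum J w y g) \<le> W\<^sup>2 * real (card J) * sqsum g + W\<^sup>2 * \<rho> * (\<Sum>z\<in>Z. cmod (g z))\<^sup>2"
proof -
  define u where "u = (\<lambda>(i, z). complex_of_real (w i) * g z)"
  define h where "h = (\<lambda>(i, z). y i + z)"
  have gZ: "g x = (\<Sum>z\<in>Z. g z * delta (x - z))" for x
  proof -
    have "(\<Sum>z\<in>Z. g z * delta (x - z)) = (\<Sum>z\<in>Z. if z = x then g z else 0)"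
      by (intro sum.cong) (auto simp: delta_def)
    thus ?thesis using Z by (simp add: sum.delta)
  qed
  have eq: "shift_sum J w y g x = (\<Sum>p\<in>J \<times> Z. u p * delta (x - h p))" for x
    unfolding shift_sum_def
    by (subst gZ) (simp add: sum_distrib_left sum.cartesian_product u_def h_def split_def algebra_simps)
  have cu: "cmod (u (i, z)) \<le> W * cmod (g z)" if "i \<in> J" for i z
    using that assms(2,3) by (auto simp: u_def norm_mult intro!: mult_right_mono)
  have "sqsum (shift_sum J w y g) \<le> (\<Sum>p\<in>J\<times>Z. \<Sum>q\<in>J\<times>Z. if h q = h p then cmod (u p) * cmod (u q) else 0)"
    using sqsum_atoms_le(2)[OF finite_cartesian_product[OF assms(1) Z(1)] eq] .
  also have "\<dots> = (\<Sum>i\<in>J. \<Sum>z\<in>Z. \<Sum>j\<in>J. \<Sum>z'\<in>Z. if y j + z' = y i + z then cmod (u (i, z)) * cmod (u (j, z')) else 0)"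
  proof -
    have "(\<Sum>p\<in>J\<times>Z. f p) = (\<Sum>i\<in>J. \<Sum>z\<in>Z. f (i, z))" for f :: "'i \<times> int \<Rightarrow> real"
      by (simp add: sum.cartesian_product)
    thus ?thesis by (simp add: h_def)
  qed
  also have "\<dots> \<le> (\<Sum>i\<in>J. \<Sum>z\<in>Z. \<Sum>j\<in>J. \<Sum>z'\<in>Z.
      (if j = i then (if z' = z then W\<^sup>2 * (cmod (g z))\<^sup>2 else 0) else 0)
      + (if i \<noteq> j \<and> y i - y j = z' - z then W\<^sup>2 * (cmod (g z) * cmod (g z')) else 0))"
  proof (intro sum_mono)
    fix i z j z' assume ij: "i \<in> J" "z \<in> Z" "j \<in> J" "z' \<in> Z"
    have "cmod (u (i, z)) * cmod (u (j, z')) \<le> (W * cmod (g z)) * (W * cmod (g z'))"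
      using cu ij assms(3) by (intro mult_mono) auto
    thus "(if y j + z' = y i + z then cmod (u (i, z)) * cmod (u (j, z')) else 0) \<le>
      (if j = i then (if z' = z then W\<^sup>2 * (cmod (g z))\<^sup>2 else 0) else 0)
      + (if i \<noteq> j \<and> y i - y j = z' - z then W\<^sup>2 * (cmod (g z) * cmod (g z')) else 0)"
      by (auto simp: power2_eq_square mult_ac)
  qed
  also have "\<dots> = (\<Sum>i\<in>J. \<Sum>z\<in>Z. \<Sum>j\<in>J. \<Sum>z'\<in>Z. if j = i then (if z' = z then W\<^sup>2 * (cmod (g z))\<^sup>2 else 0) else 0)
     + (\<Sum>i\<in>J. \<Sum>z\<in>Z. \<Sum>j\<in>J. \<Sum>z'\<in>Z. if i \<noteq> j \<and> y i - y j = z' - z then W\<^sup>2 * (cmod (g z) * cmod (g z')) else 0)"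
    by (simp only: sum.distrib)
  also have "(\<Sum>i\<in>J. \<Sum>z\<in>Z. \<Sum>j\<in>J. \<Sum>z'\<in>Z. if j = i then (if z' = z then W\<^sup>2 * (cmod (g z))\<^sup>2 else 0) else 0)
     = W\<^sup>2 * real (card J) * sqsum g"
  proof -
    have "(\<Sum>j\<in>J. \<Sum>z'\<in>Z. if j = i then (if z' = z then W\<^sup>2 * (cmod (g z))\<^sup>2 else 0) else 0) = W\<^sup>2 * (cmod (g z))\<^sup>2"
      if "i \<in> J" "z \<in> Z" for i z
    proof -
      have "(\<Sum>z'\<in>Z. if j = i then (if z' = z then W\<^sup>2 * (cmod (g z))\<^sup>2 else 0) else 0) = (if j = i then W\<^sup>2 * (cmod (g z))\<^sup>2 else 0)" for j
        using that Z(1) by (simp add: sum.delta)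
      thus ?thesis using that assms(1) by (simp add: sum.delta)
    qed
    hence "(\<Sum>i\<in>J. \<Sum>z\<in>Z. \<Sum>j\<in>J. \<Sum>z'\<in>Z. if j = i then (if z' = z then W\<^sup>2 * (cmod (g z))\<^sup>2 else 0) else 0)
      = (\<Sum>i\<in>J. \<Sum>z\<in>Z. W\<^sup>2 * (cmod (g z))\<^sup>2)" by (intro sum.cong refl) auto
    thus ?thesis using finite_support_sqsum(2)[OF Z] by (simp add: sum_distrib_left mult_ac)
  qed
  also have "(\<Sum>i\<in>J. \<Sum>z\<in>Z. \<Sum>j\<in>J. \<Sum>z'\<in>Z. if i \<noteq> j \<and> y i - y j = z' - z then W\<^sup>2 * (cmod (g z) * cmod (g z')) else 0)
     = (\<Sum>z\<in>Z. \<Sum>z'\<in>Z. \<Sum>p\<in>J\<times>J. if fst p \<noteq> snd p \<and> y (fst p) - y (snd p) = z' - z then W\<^sup>2 * (cmod (g z) * cmod (g z')) else 0)"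
  proof -
    have "(\<Sum>i\<in>J. \<Sum>z\<in>Z. \<Sum>j\<in>J. \<Sum>z'\<in>Z. f i z j z') = (\<Sum>z\<in>Z. \<Sum>z'\<in>Z. \<Sum>p\<in>J\<times>J. f (fst p) z (snd p) z')" for f :: "'i \<Rightarrow> int \<Rightarrow> 'i \<Rightarrow> int \<Rightarrow> real"
    proof -
      have "(\<Sum>i\<in>J. \<Sum>z\<in>Z. \<Sum>j\<in>J. \<Sum>z'\<in>Z. f i z j z') = (\<Sum>z\<in>Z. \<Sum>i\<in>J. \<Sum>j\<in>J. \<Sum>z'\<in>Z. f i z j z')" by (rule sum.swap)
      also have "\<dots> = (\<Sum>z\<in>Z. \<Sum>i\<in>J. \<Sum>z'\<in>Z. \<Sum>j\<in>J. f i z j z')" by (intro sum.cong refl) (rule sum.swap)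
      also have "\<dots> = (\<Sum>z\<in>Z. \<Sum>z'\<in>Z. \<Sum>i\<in>J. \<Sum>j\<in>J. f i z j z')" by (intro sum.cong refl) (rule sum.swap)
      finally show ?thesis by (simp add: sum.cartesian_product split_def)
    qed
    thus ?thesis .
  qed
  also have "\<dots> \<le> (\<Sum>z\<in>Z. \<Sum>z'\<in>Z. W\<^sup>2 * \<rho> * (cmod (g z) * cmod (g z')))"
  proof (intro sum_mono)
    fix z z' assume zz: "z \<in> Z" "z' \<in> Z"
    have "(\<Sum>p\<in>J\<times>J. if fst p \<noteq> snd p \<and> y (fst p) - y (snd p) = z' - z then W\<^sup>2 * (cmod (g z) * cmod (g z')) else 0)
      = real (card {p\<in>J\<times>J. fst p \<noteq> snd p \<and> y (fst p) - y (snd p) = z' - z}) * (W\<^sup>2 * (cmod (g z) * cmod (g z')))"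
      by (simp add: sum.inter_filter[symmetric] assms(1))
    also have "{p\<in>J\<times>J. fst p \<noteq> snd p \<and> y (fst p) - y (snd p) = z' - z} = {(i, j). i \<in> J \<and> j \<in> J \<and> i \<noteq> j \<and> y i - y j = z' - z}"
      by auto
    also have "real (card \<dots>) * (W\<^sup>2 * (cmod (g z) * cmod (g z'))) \<le> \<rho> * (W\<^sup>2 * (cmod (g z) * cmod (g z')))"
      using \<rho>[OF zz] by (intro mult_right_mono) auto
    finally show "(\<Sum>p\<in>J\<times>J. if fst p \<noteq> snd p \<and> y (fst p) - y (snd p) = z' - z then W\<^sup>2 * (cmod (g z) * cmod (g z')) else 0)
      \<le> W\<^sup>2 * \<rho> * (cmod (g z) * cmod (g z'))" by (simp add: mult_ac)
  qed
  also have "\<dots> = W\<^sup>2 * \<rho> * (\<Sum>z\<in>Z. cmod (g z))\<^sup>2"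
  proof -
    have "(\<Sum>z\<in>Z. cmod (g z))\<^sup>2 = (\<Sum>z\<in>Z. \<Sum>z'\<in>Z. cmod (g z) * cmod (g z'))"
      unfolding power2_eq_square by (rule sum_product)
    thus ?thesis by (simp only: sum_distrib_left)
  qed
  finally show ?thesis by simp
qed

lemma odd_sum_alt: "odd_sum I w y f x = (\<Sum>i\<in>I. of_real (w i) * (f (x - y i) - f (x + y i)))"
  by (simp add: odd_sum_def shift_sum_def algebra_simps sum_subtractf)

lemma odd_sum_l1_bound:
  assumes "\<And>Z. finite Z \<Longrightarrow> (\<Sum>z\<in>Z. cmod (f z)) \<le> B" "finite Z"
  shows "(\<Sum>z\<in>Z. cmod (odd_sum I w y f z)) \<le> 2 * (\<Sum>i\<in>I. \<bar>w i\<bar>) * B"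
proof -
  have "(\<Sum>z\<in>Z. cmod (odd_sum I w y f z)) \<le> (\<Sum>z\<in>Z. \<Sum>i\<in>I. \<bar>w i\<bar> * (cmod (f (z - y i)) + cmod (f (z + y i))))"
    unfolding odd_sum_alt
    by (intro sum_mono order.trans[OF norm_sum] )
       (auto simp: norm_mult intro!: mult_left_mono norm_triangle_ineq4)
  also have "\<dots> = (\<Sum>i\<in>I. \<Sum>z\<in>Z. \<bar>w i\<bar> * (cmod (f (z - y i)) + cmod (f (z + y i))))" by (rule sum.swap)
  also have "\<dots> = (\<Sum>i\<in>I. \<bar>w i\<bar> * ((\<Sum>z\<in>(\<lambda>z. z - y i) ` Z. cmod (f z)) + (\<Sum>z\<in>(\<lambda>z. z + y i) ` Z. cmod (f z))))"
    by (subst (1 2) sum.reindex) (simp_all add: inj_on_def sum.distrib sum_distrib_left[symmetric])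
  also have "\<dots> \<le> (\<Sum>i\<in>I. \<bar>w i\<bar> * (B + B))"
    using assms by (intro sum_mono mult_left_mono add_mono) auto
  also have "\<dots> = 2 * (\<Sum>i\<in>I. \<bar>w i\<bar>) * B" by (simp add: sum_distrib_right sum_distrib_left mult_ac)
  finally show ?thesis .
qed

lemma odd_sum_support:
  assumes "\<And>z. f z \<noteq> 0 \<Longrightarrow> \<bar>z\<bar> \<le> s" "\<And>i. i \<in> I \<Longrightarrow> \<bar>y i\<bar> \<le> Y" "odd_sum I w y f z \<noteq> 0"
  shows "\<bar>z\<bar> \<le> s + Y"
proof -
  obtain i where i: "i \<in> I" "f (z - y i) \<noteq> 0 \<or> f (z + y i) \<noteq> 0"
    using assms(3) unfolding odd_sum_alt by (metis (no_types, lifting) diff_self mult_zero_right sum.neutral)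
  thus ?thesis using assms(1)[of "z - y i"] assms(1)[of "z + y i"] assms(2)[OF i(1)] by auto
qed

section \<open>Expansion of the resolvent and level sets\<close>

text \<open>Here \<open>u\<close> and \<open>r\<close> are \<open>(1 + A + B)\<^sup>-\<^sup>1 d\<close> and \<open>(1 + A)\<^sup>-\<^sup>1 d\<close>. With \<open>q = (1 + A)\<^sup>-\<^sup>1 r\<close>,
the errors are \<open>e\<^sub>1 = u - r + B q\<close> and \<open>e\<^sub>2 = B (q - d + 2 A d)\<close>. Applying \<open>1 + A + B\<close> to the first and
\<open>(1 + A)\<^sup>2\<close> to the second leaves \<open>B B q\<close> and \<open>3 B A A d + 2 A B A A d\<close>, so the a priori inequality for
skew operators bounds both without any expression for an inverse.\<close>

lemma resolvent_expansion:
  fixes yA :: "'i \<Rightarrow> int" and yB :: "'j \<Rightarrow> int" and yH :: "'k \<Rightarrow> int"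
    and v :: "'i \<Rightarrow> real" and w :: "'j \<Rightarrow> real" and wH :: "'k \<Rightarrow> real"
  assumes fin: "finite L" "finite J" "finite I"
  defines "A \<equiv> odd_sum L v yA" and "B \<equiv> odd_sum J w yB" and "H \<equiv> odd_sum I wH yH"
  assumes H: "\<And>f x. H f x = A f x + B f x"
    and u: "u \<in> ell2" "\<And>x. u x + H u x = d x"
    and r: "r \<in> ell2" "\<And>x. r x + A r x = d x"
    and d: "d \<in> ell2"
  obtains e1 e2 where "e1 \<in> ell2" "e2 \<in> ell2" "sqsum e1 \<le> sqsum (B (B d))"
    "sqsum e2 \<le> (18 + 32 * (\<Sum>i\<in>L. \<bar>v i\<bar>)\<^sup>2) * sqsum (B (A (A d)))"
    "\<And>x. u x - r x + B d x - 2 * A (B d) x = e1 x - e2 x"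
proof -
  have lin: "A (\<lambda>x. f x + g x) = (\<lambda>x. A f x + A g x)" "A (\<lambda>x. f x - g x) = (\<lambda>x. A f x - A g x)" "A (\<lambda>x. c * f x) = (\<lambda>x. c * A f x)"
    "B (\<lambda>x. f x + g x) = (\<lambda>x. B f x + B g x)" "B (\<lambda>x. f x - g x) = (\<lambda>x. B f x - B g x)" "B (\<lambda>x. c * f x) = (\<lambda>x. c * B f x)" for f g c
    by (simp_all add: A_def B_def odd_sum_add odd_sum_diff odd_sum_scale)
  have comm: "B (A f) = A (B f)" for f unfolding A_def B_def by (rule odd_sum_comm)
  have l2: "A f \<in> ell2" "B f \<in> ell2" if "f \<in> ell2" for f
    using that fin unfolding A_def B_def by (auto intro: odd_sum_ell2)
  have apA: "sqsum f \<le> sqsum (\<lambda>x. f x + A f x)" if "f \<in> ell2" for f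
    unfolding A_def by (rule sqsum_le_one_plus_odd[OF fin(1) that])
  have apH: "sqsum f \<le> sqsum (\<lambda>x. f x + H f x)" if "f \<in> ell2" for f
    unfolding H_def by (rule sqsum_le_one_plus_odd[OF fin(3) that])
  obtain q where q: "q \<in> ell2" "(\<lambda>x. q x + A q x) = r"
    using one_plus_odd_surj[OF fin(1) r(1)] unfolding A_def by blast
  have dq: "(\<lambda>x. r x + A r x) = d" using r(2) by auto
  have du: "(\<lambda>x. u x + A u x + B u x) = d" using u(2) H by (auto simp: algebra_simps)
  define e1 where "e1 = (\<lambda>x. u x - r x + B q x)"
  have e1: "e1 \<in> ell2" unfolding e1_def using u r q by (intro ell2_add ell2_diff l2)
  have "(\<lambda>x. e1 x + H e1 x) = B (B q)"
  proof
    fix x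
    have "e1 x + H e1 x = (u x + A u x + B u x) - (r x + A r x) - B r x + (B q x + A (B q) x) + B (B q) x"
      by (simp add: H e1_def lin)
    also have "B q x + A (B q) x = B (\<lambda>x. q x + A q x) x" by (simp add: lin comm)
    also have "\<dots> = B r x" by (simp only: q(2))
    finally show "e1 x + H e1 x = B (B q) x" using fun_cong[OF du, of x] fun_cong[OF dq, of x] by simp
  qed
  hence "sqsum e1 \<le> sqsum (B (B q))" using apH[OF e1] by simp
  also have "\<dots> \<le> sqsum (B (B r))"
  proof -
    have "(\<lambda>x. B (B q) x + A (B (B q)) x) = B (B (\<lambda>x. q x + A q x))" by (simp add: lin comm)
    thus ?thesis using apA[OF l2(2)[OF l2(2)[OF q(1)]]] by (simp add: q(2))
  qed
  also have "\<dots> \<le> sqsum (B (B d))"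
  proof -
    have "(\<lambda>x. B (B r) x + A (B (B r)) x) = B (B (\<lambda>x. r x + A r x))" by (simp add: lin comm)
    thus ?thesis using apA[OF l2(2)[OF l2(2)[OF r(1)]]] by (simp add: dq)
  qed
  finally have n1: "sqsum e1 \<le> sqsum (B (B d))" .
  define e2 where "e2 = (\<lambda>x. B q x - B d x + 2 * B (A d) x)"
  have e2: "e2 \<in> ell2" unfolding e2_def using d q by (intro ell2_add ell2_diff ell2_scale l2)
  define E where "E = (\<lambda>x. e2 x + A e2 x)"
  have E: "E \<in> ell2" unfolding E_def using e2 by (intro ell2_add l2)
  define G where "G = B (A (A d))"
  have G: "G \<in> ell2" unfolding G_def using d by (intro l2)
  have "(\<lambda>x. E x + A E x) = (\<lambda>x. 3 * G x + 2 * A G x)"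
  proof
    fix x
    have Bq: "(\<lambda>x. B q x + A (B q) x) = B r" using q(2) by (simp add: lin(4)[symmetric] comm[symmetric])
    have ABq: "A (B q) x + A (A (B q)) x = A (B r) x" using arg_cong[OF Bq, of A] by (simp add: lin fun_eq_iff)
    have Br: "B r x + A (B r) x = B d x" using dq by (simp add: fun_cong[OF lin(4), symmetric] comm[symmetric])
    have "B q x + (A (A (B q)) x + 2 * A (B q) x) = (B q x + A (B q) x) + (A (B q) x + A (A (B q)) x)" by simp
    also have "\<dots> = B d x" using fun_cong[OF Bq, of x] ABq Br by simp
    finally show "E x + A E x = 3 * G x + 2 * A G x"
      unfolding E_def e2_def G_def by (simp add: lin comm algebra_simps)
  qed
  hence "sqsum e2 \<le> sqsum (\<lambda>x. 3 * G x + 2 * A G x)"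
    using apA[OF e2] apA[OF E] unfolding E_def[symmetric] by simp
  also have "\<dots> \<le> 2 * sqsum (\<lambda>x. 3 * G x) + 2 * sqsum (\<lambda>x. 2 * A G x)"
    using G by (intro ell2_add(2) ell2_scale l2)
  also have "\<dots> = 18 * sqsum G + 8 * sqsum (A G)" using ell2_scale(2)[OF G, of 3] ell2_scale(2)[OF l2(1)[OF G], of 2] by simp
  also have "\<dots> \<le> 18 * sqsum G + 8 * (4 * (\<Sum>i\<in>L. \<bar>v i\<bar>)\<^sup>2 * sqsum G)"
    using sqsum_odd_sum_bound[OF fin(1) G, of v yA] unfolding A_def by (simp add: mult.commute)
  also have "\<dots> = (18 + 32 * (\<Sum>i\<in>L. \<bar>v i\<bar>)\<^sup>2) * sqsum G" by (simp add: algebra_simps)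
  finally have n2: "sqsum e2 \<le> (18 + 32 * (\<Sum>i\<in>L. \<bar>v i\<bar>)\<^sup>2) * sqsum G" .
  show thesis
    by (rule that[OF e1 e2 n1 n2[unfolded G_def]]) (simp add: e1_def e2_def comm)
qed

lemma card_level_set_le:
  assumes "f \<in> ell2" "t > 0" "finite X"
  shows "real (card {x\<in>X. cmod (f x) > t}) \<le> sqsum f / t\<^sup>2"
proof -
  have "real (card {x\<in>X. cmod (f x) > t}) * t\<^sup>2 = (\<Sum>x\<in>{x\<in>X. cmod (f x) > t}. t\<^sup>2)" by simp
  also have "\<dots> \<le> (\<Sum>x\<in>{x\<in>X. cmod (f x) > t}. (cmod (f x))\<^sup>2)"
    using assms(2) by (intro sum_mono power_mono) auto
  also have "\<dots> \<le> sqsum f" using assms by (intro finite_sum_le_sqsum) auto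
  finally show ?thesis using assms(2) by (simp add: pos_le_divide_eq)
qed

text \<open>If a sum of four functions exceeds \<open>4 t\<close>, one of them exceeds \<open>t\<close>. Level sets of the two errors are estimated
by Chebyshev's inequality.\<close>

lemma card_le_level_sets:
  fixes X :: "int set"
  assumes "finite X" "t > 0" "e1 \<in> ell2" "e2 \<in> ell2"
    and eq: "\<And>x. x \<in> X \<Longrightarrow> u x - r x - p x = e1 x - e2 x" "\<And>x. x \<in> X \<Longrightarrow> cmod (p x) > 4 * t"
    and fu: "finite {x. cmod (u x) > t}" "finite {x. cmod (r x) > t}"
  shows "real (card X) \<le> real (card {x. cmod (u x) > t}) + real (card {x. cmod (r x) > t}) + (sqsum e1 + sqsum e2) / t\<^sup>2"
proof -
  have "X \<subseteq> {x. cmod (u x) > t} \<union> ({x. cmod (r x) > t} \<union> ({x\<in>X. cmod (e1 x) > t} \<union> {x\<in>X. cmod (e2 x) > t}))"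
  proof (rule ccontr)
    assume "\<not> ?thesis"
    then obtain x where x: "x \<in> X" "cmod (u x) \<le> t" "cmod (r x) \<le> t" "cmod (e1 x) \<le> t" "cmod (e2 x) \<le> t" by force
    have "p x = (u x - r x) - (e1 x - e2 x)" using eq(1)[OF x(1)] by (simp add: algebra_simps)
    hence "cmod (p x) \<le> cmod (u x - r x) + cmod (e1 x - e2 x)" by (simp add: norm_triangle_ineq4)
    also have "\<dots> \<le> (cmod (u x) + cmod (r x)) + (cmod (e1 x) + cmod (e2 x))"
      by (intro add_mono norm_triangle_ineq4)
    finally show False using x eq(2)[OF x(1)] by simp
  qed
  hence "card X \<le> card ({x. cmod (u x) > t} \<union> ({x. cmod (r x) > t} \<union> ({x\<in>X. cmod (e1 x) > t} \<union> {x\<in>X. cmod (e2 x) > t})))"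
    using fu assms(1) by (intro card_mono) auto
  also have "\<dots> \<le> card {x. cmod (u x) > t} + (card {x. cmod (r x) > t} + (card {x\<in>X. cmod (e1 x) > t} + card {x\<in>X. cmod (e2 x) > t}))"
    by (intro order.trans[OF card_Un_le] add_left_mono order.refl)
  finally have "real (card X) \<le> real (card {x. cmod (u x) > t} + (card {x. cmod (r x) > t} + (card {x\<in>X. cmod (e1 x) > t} + card {x\<in>X. cmod (e2 x) > t})))"
    by (rule of_nat_mono)
  thus ?thesis using card_level_set_le[OF assms(3,2,1)] card_level_set_le[OF assms(4,2,1)] by (simp add: add_divide_distrib)
qed

text \<open>At a point with a single representation as a large \<open>y m\<close> plus or minus a small \<open>y l\<close> nothing cancels. The value
\<open>z = 0\<close> is included in the hypothesis so that \<open>B \<delta>\<close> itself vanishes at the point.\<close>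

lemma product_at_good_point:
  fixes y :: "'i \<Rightarrow> int"
  assumes fin: "finite J" "finite L" and ml: "m0 \<in> J" "l0 \<in> L"
    and pos: "\<And>m l. m \<in> J \<Longrightarrow> l \<in> L \<Longrightarrow> 0 < y l \<and> y l < y m"
    and inj: "inj_on y L"
    and good: "\<And>m z. m \<in> J \<Longrightarrow> m \<noteq> m0 \<Longrightarrow> z \<in> {0} \<union> y ` L \<union> (\<lambda>l. - y l) ` L \<Longrightarrow> y m0 + y l0 \<noteq> y m + z"
  shows "odd_sum J w y delta (y m0 + y l0) = 0"
    and "odd_sum L v y (odd_sum J w y delta) (y m0 + y l0) = of_real (v l0 * w m0)"
proof -
  let ?x = "y m0 + y l0"
  show "odd_sum J w y delta ?x = 0"
    unfolding odd_sum_alt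
  proof (intro sum.neutral ballI)
    fix m assume m: "m \<in> J"
    have "?x - y m \<noteq> 0" using good[OF m, of 0] pos[OF ml] by (cases "m = m0") auto
    moreover have "?x + y m \<noteq> 0" using pos[OF ml] pos[OF m ml(2)] by linarith
    ultimately show "complex_of_real (w m) * (delta (?x - y m) - delta (?x + y m)) = 0" by (simp add: delta_def)
  qed
  have B1: "odd_sum J w y delta (?x - y l) = (if l = l0 then of_real (w m0) else 0)" if l: "l \<in> L" for l
  proof -
    have "odd_sum J w y delta (?x - y l) = (\<Sum>m\<in>J. if m = m0 then (if l = l0 then of_real (w m0) else 0) else 0)"
      unfolding odd_sum_alt
    proof (rule sum.cong[OF refl])
      fix m assume m: "m \<in> J"
      have "?x - y l + y m \<noteq> 0" using pos[OF ml(1) l] pos[OF m ml(2)] by linarith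
      moreover have "?x - y l - y m = 0 \<longleftrightarrow> m = m0 \<and> l = l0"
      proof (cases "m = m0")
        case True thus ?thesis using inj l ml(2) by (auto simp: inj_on_def)
      next
        case False
        have "?x \<noteq> y m + y l" using good[OF m False, of "y l"] l by blast
        thus ?thesis using False by auto
      qed
      ultimately show "complex_of_real (w m) * (delta (?x - y l - y m) - delta (?x - y l + y m)) = (if m = m0 then (if l = l0 then of_real (w m0) else 0) else 0)"
        by (auto simp: delta_def)
    qed
    thus ?thesis using fin(1) ml(1) by (simp add: sum.delta)
  qed
  have B2: "odd_sum J w y delta (?x + y l) = 0" if l: "l \<in> L" for l
    unfolding odd_sum_alt
  proof (intro sum.neutral ballI)
    fix m assume m: "m \<in> J"
    have "?x + y l - y m \<noteq> 0"
    proof (cases "m = m0")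
      case True thus ?thesis using pos[OF ml] pos[OF m l] by auto
    next
      case False
      have "?x \<noteq> y m + - y l" using good[OF m False, of "- y l"] l by blast
      thus ?thesis by linarith
    qed
    moreover have "?x + y l + y m \<noteq> 0" using pos[OF ml] pos[OF m l] by linarith
    ultimately show "complex_of_real (w m) * (delta (?x + y l - y m) - delta (?x + y l + y m)) = 0" by (simp add: delta_def)
  qed
  have "odd_sum L v y (odd_sum J w y delta) ?x = (\<Sum>l\<in>L. if l = l0 then of_real (v l0 * w m0) else 0)"
    unfolding odd_sum_alt[of L] by (intro sum.cong refl) (simp add: B1 B2)
  thus "odd_sum L v y (odd_sum J w y delta) ?x = of_real (v l0 * w m0)" using fin(2) ml(2) by (simp add: sum.delta)
qed

section \<open>Energy estimates for one group of scales\<close>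

definition block :: "real \<Rightarrow> real \<Rightarrow> nat set" where "block K n = {m. n / 2 \<le> real m \<and> real m \<le> K * n}"

text \<open>The order of magnitude of the number of representations of an integer as a sum of two integer parts of powers, taken over
arguments comparable to \<open>x\<close>. The second term is the expected number with a logarithmic loss; the first one bounds what is left
in \<open>card_floor_pow_sum\<close> when \<open>D\<close> is about \<open>x powr (1/3)\<close>.\<close>

definition rep_rate :: "real \<Rightarrow> real \<Rightarrow> real" where
  "rep_rate \<alpha> x = x powr (2/3) + x powr (2 - \<alpha>) * (1 + ln x)"

lemma finite_block: "finite (block K n)"
  by (rule finite_subset[of _ "{..nat \<lfloor>K * n\<rfloor>}"]) (auto simp: block_def le_nat_floor)

lemma card_block_le: assumes "1 \<le> n" "1 \<le> K" shows "real (card (block K n)) \<le> 2 * K * n"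
proof -
  have n: "1 * 1 \<le> K * n" using assms by (intro mult_mono) auto
  have "block K n \<subseteq> {..nat \<lfloor>K * n\<rfloor>}" by (auto simp: block_def le_nat_floor)
  hence "card (block K n) \<le> nat \<lfloor>K * n\<rfloor> + 1" using card_mono[of "{..nat \<lfloor>K * n\<rfloor>}" "block K n"] by simp
  moreover have "real (nat \<lfloor>K * n\<rfloor>) \<le> K * n" using n by simp
  ultimately show ?thesis using n by linarith
qed

lemma floor_pow_block_le:
  assumes "1 < \<alpha>" "\<alpha> < 2" "2 \<le> p" "l \<in> block K p"
  shows "real_of_int \<bar>floor_pow \<alpha> l\<bar> \<le> K\<^sup>2 * p\<^sup>2"
proof -
  have l1: "1 \<le> real l" using assms(3,4) by (simp add: block_def)
  have "real_of_int \<bar>floor_pow \<alpha> l\<bar> \<le> real l powr \<alpha>" unfolding floor_pow_def by simp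
  also have "\<dots> \<le> real l powr 2" using l1 assms by (intro powr_mono) auto
  also have "\<dots> = (real l)\<^sup>2" using l1 by simp
  also have "\<dots> \<le> (K * p)\<^sup>2" using assms(4) by (intro power_mono) (auto simp: block_def)
  finally show ?thesis by (simp add: power_mult_distrib)
qed

lemma sum_abs_block_le:
  assumes "1 \<le> p" "1 \<le> K" "0 \<le> c" "\<forall>l\<in>block K p. \<bar>v l\<bar> \<le> c / p"
  shows "(\<Sum>l\<in>block K p. \<bar>v l\<bar>) \<le> 2 * K * c"
proof -
  have "(\<Sum>l\<in>block K p. \<bar>v l\<bar>) \<le> real (card (block K p)) * (c / p)" using assms(4) by (intro sum_bounded_above) auto
  also have "\<dots> \<le> (2 * K * p) * (c / p)" using card_block_le[OF assms(1,2)] assms by (intro mult_right_mono) auto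
  finally show ?thesis using assms(1) by simp
qed

lemma rep_rate_pos: assumes "1 \<le> x" shows "1 \<le> rep_rate \<alpha> x"
proof -
  have "1 \<le> x powr (2/3)" using assms by (intro ge_one_powr_ge_zero) auto
  moreover have "0 \<le> x powr (2 - \<alpha>) * (1 + ln x)" using assms by simp
  ultimately show ?thesis unfolding rep_rate_def by linarith
qed

lemma inverse_kappa:
  fixes \<alpha> K n :: real
  assumes "1 < \<alpha>" "1 \<le> K" "1 \<le> n"
  shows "1 / (\<alpha> * (\<alpha> - 1) * (K * n) powr (\<alpha> - 2)) = K powr (2 - \<alpha>) / (\<alpha> * (\<alpha> - 1)) * n powr (2 - \<alpha>)"
proof -
  have "(K * n) powr (\<alpha> - 2) = 1 / (K powr (2 - \<alpha>) * n powr (2 - \<alpha>))"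
    using powr_minus_divide[of "K * n" "2 - \<alpha>"] by (simp add: powr_mult)
  thus ?thesis by simp
qed

text \<open>The choice \<open>D \<approx> n powr (1/3)\<close> balances \<open>n / D\<close> against \<open>D\<^sup>2\<close>.\<close>

lemma card_block_sum:
  assumes "1 < \<alpha>" "\<alpha> < 2" "1 \<le> K"
  shows "\<exists>C\<ge>0. \<forall>n\<ge>2. \<forall>x. real (card {(i, j). i \<in> block K n \<and> j \<in> block K n \<and> floor_pow \<alpha> i + floor_pow \<alpha> j = x}) \<le> C * rep_rate \<alpha> n"
proof -
  define c where "c = K powr (2 - \<alpha>) / (\<alpha> * (\<alpha> - 1))"
  have c: "c \<ge> 0" using assms by (simp add: c_def)
  define C where "C = 2 + K + (4 * K + 2) * (8 * c + 4)"
  have "real (card {(i, j). i \<in> block K n \<and> j \<in> block K n \<and> floor_pow \<alpha> i + floor_pow \<alpha> j = x}) \<le> C * rep_rate \<alpha> n"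
    if n: "n \<ge> 2" for n x
  proof -
    define D where "D = nat \<lceil>n powr (1/3)\<rceil>"
    have n3: "1 \<le> n powr (1/3)" using n by (intro ge_one_powr_ge_zero) auto
    have D: "1 \<le> D" "n powr (1/3) \<le> real D" "real D \<le> 2 * n powr (1/3)"
      using n3 unfolding D_def by linarith+
    have Kn: "n / 2 \<le> K * n" using mult_right_mono[of 1 K n] assms(3) n by linarith
    have "real (card {(i, j). n/2 \<le> real i \<and> real i \<le> K * n \<and> n/2 \<le> real j \<and> real j \<le> K * n \<and> floor_pow \<alpha> i + floor_pow \<alpha> j = x})
      \<le> 2 + K * n / real D + (2 * (2 * K) + 2) * (4 / (\<alpha> * (\<alpha> - 1) * (K * n) powr (\<alpha> - 2)) * (1 + ln (real D)) + (real D)\<^sup>2)"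
      by (rule card_floor_pow_sum[OF assms(1,2) _ Kn _ D(1)]) (use n in auto)
    also have "4 / (\<alpha> * (\<alpha> - 1) * (K * n) powr (\<alpha> - 2)) = 4 * (c * n powr (2 - \<alpha>))"
      using inverse_kappa[OF assms(1,3), of n] n unfolding c_def by simp
    also have "2 + K * n / real D + (2 * (2 * K) + 2) * (4 * (c * n powr (2 - \<alpha>)) * (1 + ln (real D)) + (real D)\<^sup>2)
      \<le> 2 * rep_rate \<alpha> n + K * rep_rate \<alpha> n + (4 * K + 2) * (8 * c * rep_rate \<alpha> n + 4 * rep_rate \<alpha> n)"
    proof (intro add_mono)
      have l: "0 \<le> n powr (2 - \<alpha>) * (1 + ln n)" using n by simp
      hence r1: "n powr (2/3) \<le> rep_rate \<alpha> n" unfolding rep_rate_def by linarith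
      have r2: "n powr (2 - \<alpha>) * (1 + ln n) \<le> rep_rate \<alpha> n" unfolding rep_rate_def by simp
      show "2 \<le> 2 * rep_rate \<alpha> n" using rep_rate_pos[of n \<alpha>] n by simp
      have "K * n / real D \<le> K * n / n powr (1/3)" using D n3 n assms(3) by (intro divide_left_mono) auto
      also have "\<dots> = K * (n powr 1 / n powr (1/3))" using n by simp
      also have "n powr 1 / n powr (1/3) = n powr (2/3)" using powr_diff[of n 1 "1/3"] by (simp del: powr_one powr_one_gt_zero_iff)
      also have "K * n powr (2/3) \<le> K * rep_rate \<alpha> n" using r1 assms(3) by (intro mult_left_mono) auto
      finally show "K * n / real D \<le> K * rep_rate \<alpha> n" .
      have "ln (real D) \<le> 1 + 2 * ln n"
      proof -
        have "real D \<le> 2 * n powr 1" using D(3) powr_mono[of "1/3" 1 n] n by simp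
        hence "ln (real D) \<le> ln (2 * n)" using D(1) n by simp
        also have "\<dots> = ln 2 + ln n" using n by (simp add: ln_mult)
        also have "\<dots> \<le> 1 + 2 * ln n" using ln_2_less_1 ln_ge_zero[of n] n by linarith
        finally show ?thesis .
      qed
      hence "4 * (c * n powr (2 - \<alpha>)) * (1 + ln (real D)) \<le> 4 * (c * n powr (2 - \<alpha>)) * (2 * (1 + ln n))"
        using c by (intro mult_left_mono) auto
      also have "\<dots> = 8 * c * (n powr (2 - \<alpha>) * (1 + ln n))" by simp
      also have "\<dots> \<le> 8 * c * rep_rate \<alpha> n" using r2 c by (intro mult_left_mono) auto
      finally have a: "4 * (c * n powr (2 - \<alpha>)) * (1 + ln (real D)) \<le> 8 * c * rep_rate \<alpha> n" .
      have "(real D)\<^sup>2 \<le> (2 * n powr (1/3))\<^sup>2" using D by (intro power_mono) auto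
      also have "\<dots> = 4 * n powr (2/3)" by (simp add: power2_eq_square powr_add[symmetric])
      also have "\<dots> \<le> 4 * rep_rate \<alpha> n" using r1 by simp
      finally have b: "(real D)\<^sup>2 \<le> 4 * rep_rate \<alpha> n" .
      show "(2 * (2 * K) + 2) * (4 * (c * n powr (2 - \<alpha>)) * (1 + ln (real D)) + (real D)\<^sup>2)
        \<le> (4 * K + 2) * (8 * c * rep_rate \<alpha> n + 4 * rep_rate \<alpha> n)"
        using mult_left_mono[OF add_mono[OF a b], of "4 * K + 2"] assms(3) by simp
    qed
    also have "\<dots> = C * rep_rate \<alpha> n" unfolding C_def by (simp add: algebra_simps)
    finally show ?thesis by (simp add: block_def conj_assoc)
  qed
  moreover have "C \<ge> 0" using c assms(3) by (simp add: C_def)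
  ultimately show ?thesis by blast
qed

lemma card_block_diff:
  assumes "1 < \<alpha>" "\<alpha> < 2" "1 \<le> K" "1 \<le> b"
  shows "\<exists>C\<ge>0. \<forall>n\<ge>2. \<forall>p z. 1 \<le> p \<longrightarrow> p \<le> n \<longrightarrow> real_of_int \<bar>z\<bar> \<le> b * p\<^sup>2 \<longrightarrow>
    real (card {(i, j). i \<in> block K n \<and> j \<in> block K n \<and> i \<noteq> j \<and> floor_pow \<alpha> i - floor_pow \<alpha> j = z}) \<le> C * (rep_rate \<alpha> n + p\<^sup>2)"
proof -
  define c where "c = K powr (2 - \<alpha>) / (\<alpha> * (\<alpha> - 1))"
  have c: "c \<ge> 0" using assms by (simp add: c_def)
  define C where "C = 2 * c * (3 + ln b) + b"
  have "real (card {(i, j). i \<in> block K n \<and> j \<in> block K n \<and> i \<noteq> j \<and> floor_pow \<alpha> i - floor_pow \<alpha> j = z}) \<le> C * (rep_rate \<alpha> n + p\<^sup>2)"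
    if n: "n \<ge> 2" and p: "1 \<le> p" "p \<le> n" "real_of_int \<bar>z\<bar> \<le> b * p\<^sup>2" for n p z
  proof -
    have Kn: "0 < K * n" using assms(3) n by simp
    have p2: "1 \<le> p\<^sup>2" using p by simp
    have b1: "1 \<le> b * p\<^sup>2" using mult_mono[of 1 b 1 "p\<^sup>2"] p2 assms(4) by simp
    have "real (card {(i, j). i \<in> block K n \<and> j \<in> block K n \<and> i \<noteq> j \<and> floor_pow \<alpha> i - floor_pow \<alpha> j = z})
      \<le> real (card {(i, j). 0 < i \<and> real i \<le> K * n \<and> 0 < j \<and> real j \<le> K * n \<and> i \<noteq> j \<and> floor_pow \<alpha> i - floor_pow \<alpha> j = z})"
    proof (intro of_nat_mono card_mono)
      show "finite {(i, j). 0 < i \<and> real i \<le> K * n \<and> 0 < j \<and> real j \<le> K * n \<and> i \<noteq> j \<and> floor_pow \<alpha> i - floor_pow \<alpha> j = z}"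
        by (rule finite_subset[of _ "{..nat \<lfloor>K * n\<rfloor>} \<times> {..nat \<lfloor>K * n\<rfloor>}"]) (auto simp: le_nat_floor)
    qed (use n in \<open>auto simp: block_def\<close>)
    also have "\<dots> \<le> 2 / (\<alpha> * (\<alpha> - 1) * (K * n) powr (\<alpha> - 2)) * (1 + ln (b * p\<^sup>2)) + b * p\<^sup>2"
      by (rule card_floor_pow_diff[OF assms(1,2) Kn p(3) b1])
    also have "2 / (\<alpha> * (\<alpha> - 1) * (K * n) powr (\<alpha> - 2)) = 2 * c * n powr (2 - \<alpha>)"
      using inverse_kappa[OF assms(1,3), of n] n unfolding c_def by simp
    also have "2 * c * n powr (2 - \<alpha>) * (1 + ln (b * p\<^sup>2)) \<le> 2 * c * n powr (2 - \<alpha>) * ((3 + ln b) * (1 + ln n))"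
    proof (intro mult_left_mono)
      have "ln (b * p\<^sup>2) = ln b + 2 * ln p" using assms(4) p by (simp add: ln_mult ln_realpow)
      also have "ln p \<le> ln n" using p by simp
      finally have "1 + ln (b * p\<^sup>2) \<le> 1 + ln b + 2 * ln n" by simp
      also have "\<dots> \<le> (3 + ln b) * (1 + ln n)" using n assms(4) by (simp add: algebra_simps)
      finally show "1 + ln (b * p\<^sup>2) \<le> (3 + ln b) * (1 + ln n)" .
    qed (use c in auto)
    also have "\<dots> = 2 * c * (3 + ln b) * (n powr (2 - \<alpha>) * (1 + ln n))" by simp
    also have "\<dots> \<le> 2 * c * (3 + ln b) * rep_rate \<alpha> n" unfolding rep_rate_def
      using c assms(4) by (intro mult_left_mono) auto
    also have "2 * c * (3 + ln b) * rep_rate \<alpha> n + b * p\<^sup>2 \<le> C * rep_rate \<alpha> n + C * p\<^sup>2"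
      unfolding C_def using c assms(4) rep_rate_pos[of n \<alpha>] n by (intro add_mono mult_right_mono) auto
    finally show ?thesis by (simp add: algebra_simps)
  qed
  moreover have "C \<ge> 0" using c assms(4) by (simp add: C_def)
  ultimately show ?thesis by blast
qed

lemma sqsum_odd_twice_block:
  assumes "1 < \<alpha>" "\<alpha> < 2" "1 \<le> K" "0 \<le> c"
  shows "\<exists>C\<ge>0. \<forall>n\<ge>2. \<forall>w. (\<forall>m\<in>block K n. \<bar>w m\<bar> \<le> c / n) \<longrightarrow>
    sqsum (odd_sum (block K n) w (floor_pow \<alpha>) (odd_sum (block K n) w (floor_pow \<alpha>) delta)) \<le> C * (rep_rate \<alpha> n / n\<^sup>2)"
proof -
  obtain C0 where C0: "C0 \<ge> 0" "\<And>n x. n \<ge> 2 \<Longrightarrow> 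
    real (card {(i, j). i \<in> block K n \<and> j \<in> block K n \<and> floor_pow \<alpha> i + floor_pow \<alpha> j = x}) \<le> C0 * rep_rate \<alpha> n"
    using card_block_sum[OF assms(1-3)] by blast
  have "sqsum (odd_sum (block K n) w (floor_pow \<alpha>) (odd_sum (block K n) w (floor_pow \<alpha>) delta)) \<le> (64 * c ^ 4 * C0 * K\<^sup>2) * (rep_rate \<alpha> n / n\<^sup>2)"
    if n: "n \<ge> 2" and w: "\<forall>m\<in>block K n. \<bar>w m\<bar> \<le> c / n" for n w
  proof -
    let ?J = "block K n" let ?B = "odd_sum ?J w (floor_pow \<alpha>)" and ?P = "shift_sum ?J w (floor_pow \<alpha>)"
    have fin: "finite ?J" by (rule finite_block)
    have "sqsum (?B (?B delta)) \<le> 4 * sqsum (?P (?B delta))"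
      by (rule sqsum_odd_sum_le[OF fin odd_sum_ell2[OF fin delta_ell2]])
    also have "?P (?B delta) = ?B (?P delta)" by (rule odd_shift_comm[symmetric])
    also have "sqsum (?B (?P delta)) \<le> 4 * sqsum (?P (?P delta))"
      by (rule sqsum_odd_sum_le[OF fin shift_sum_ell2[OF fin delta_ell2]])
    also have "sqsum (?P (?P delta)) \<le> (c / n) ^ 4 * (C0 * rep_rate \<alpha> n) * (real (card ?J))\<^sup>2"
      by (rule sqsum_shift_sum_twice_le[OF fin]) (use w n assms(4) C0 in auto)
    also have "\<dots> \<le> (c / n) ^ 4 * (C0 * rep_rate \<alpha> n) * (2 * K * n)\<^sup>2"
      using card_block_le[of n K] n assms(3,4) C0(1) rep_rate_pos[of n \<alpha>]
      by (intro mult_left_mono power_mono mult_nonneg_nonneg) auto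
    also have "4 * (4 * \<dots>) = (64 * c ^ 4 * C0 * K\<^sup>2) * (rep_rate \<alpha> n / n\<^sup>2)"
      using n by (simp add: power_divide power_mult_distrib field_simps power2_eq_square power4_eq_xxxx)
    finally show ?thesis by simp
  qed
  moreover have "0 \<le> 64 * c ^ 4 * C0 * K\<^sup>2" using assms C0(1) by simp
  ultimately show ?thesis by blast
qed

text \<open>Here \<open>g = A A \<delta>\<close> has bounded \<open>\<ell>\<^sup>1\<close> norm and support of length \<open>O(p\<^sup>2)\<close>, because
\<open>l powr \<alpha> \<le> l\<^sup>2\<close>. Hence only differences of size \<open>O(p\<^sup>2)\<close> between the points of \<open>B\<close> matter.\<close>

lemma sqsum_odd_mixed_block:
  assumes "1 < \<alpha>" "\<alpha> < 2" "1 \<le> K" "0 \<le> c"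
  shows "\<exists>C\<ge>0. \<forall>n p w v. 2 \<le> p \<longrightarrow> p \<le> n \<longrightarrow> (\<forall>m\<in>block K n. \<bar>w m\<bar> \<le> c / n) \<longrightarrow> (\<forall>l\<in>block K p. \<bar>v l\<bar> \<le> c / p) \<longrightarrow>
    sqsum (odd_sum (block K n) w (floor_pow \<alpha>) (odd_sum (block K p) v (floor_pow \<alpha>) (odd_sum (block K p) v (floor_pow \<alpha>) delta)))
      \<le> C * (rep_rate \<alpha> p / (n * p\<^sup>2) + (rep_rate \<alpha> n + p\<^sup>2) / n\<^sup>2)"
proof -
  obtain C1 where C1: "C1 \<ge> 0" "\<And>n w. n \<ge> 2 \<Longrightarrow> \<forall>m\<in>block K n. \<bar>w m\<bar> \<le> c / n \<Longrightarrow>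
    sqsum (odd_sum (block K n) w (floor_pow \<alpha>) (odd_sum (block K n) w (floor_pow \<alpha>) delta)) \<le> C1 * (rep_rate \<alpha> n / n\<^sup>2)"
    using sqsum_odd_twice_block[OF assms] by blast
  have K2: "1 \<le> 4 * K\<^sup>2" using one_le_power[OF assms(3), of 2] by linarith
  obtain C2 where C2: "C2 \<ge> 0" "\<And>n p z. n \<ge> 2 \<Longrightarrow> 1 \<le> p \<Longrightarrow> p \<le> n \<Longrightarrow> real_of_int \<bar>z\<bar> \<le> 4 * K\<^sup>2 * p\<^sup>2 \<Longrightarrow>
    real (card {(i, j). i \<in> block K n \<and> j \<in> block K n \<and> i \<noteq> j \<and> floor_pow \<alpha> i - floor_pow \<alpha> j = z}) \<le> C2 * (rep_rate \<alpha> n + p\<^sup>2)"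
    using card_block_diff[OF assms(1-3) K2] by blast
  define V where "V = (4 * K * c)\<^sup>2"
  have "sqsum (odd_sum (block K n) w (floor_pow \<alpha>) (odd_sum (block K p) v (floor_pow \<alpha>) (odd_sum (block K p) v (floor_pow \<alpha>) delta)))
      \<le> (8 * K * c\<^sup>2 * C1 + 4 * c\<^sup>2 * C2 * V\<^sup>2) * (rep_rate \<alpha> p / (n * p\<^sup>2) + (rep_rate \<alpha> n + p\<^sup>2) / n\<^sup>2)"
    if p: "2 \<le> p" "p \<le> n" and w: "\<forall>m\<in>block K n. \<bar>w m\<bar> \<le> c / n" and v: "\<forall>l\<in>block K p. \<bar>v l\<bar> \<le> c / p" for n p w v
  proof -
    let ?J = "block K n" let ?L = "block K p" let ?B = "odd_sum ?J w (floor_pow \<alpha>)" and ?A = "odd_sum ?L v (floor_pow \<alpha>)"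
    have fJ: "finite ?J" and fL: "finite ?L" by (rule finite_block)+
    define g where "g = ?A (?A delta)"
    have g2: "g \<in> ell2" unfolding g_def by (intro odd_sum_ell2 fL delta_ell2)
    (* Y bounds the points of A, so A A \<delta> lives on [-2 Y, 2 Y]. *)
    define Y where "Y = \<lfloor>(K * p)\<^sup>2\<rfloor>"
    have Y: "\<bar>floor_pow \<alpha> l\<bar> \<le> Y" if "l \<in> ?L" for l
      using floor_pow_block_le[OF assms(1,2) p(1) that] unfolding Y_def by (simp add: le_floor_iff power_mult_distrib)
    have sup: "\<bar>z\<bar> \<le> 2 * Y" if "g z \<noteq> 0" for z
    proof -
      have "\<bar>z\<bar> \<le> 0 + Y" if "?A delta z \<noteq> 0" for z
        using odd_sum_support[where f = delta and s = 0, OF _ Y that] by (simp add: delta_def split: if_splits)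
      from odd_sum_support[where f = "?A delta", OF this Y that[unfolded g_def]] show ?thesis by simp
    qed
    define Z where "Z = {- 2 * Y .. 2 * Y}"
    have gz: "g z = 0" if "z \<notin> Z" for z
    proof (rule ccontr)
      assume "g z \<noteq> 0"
      hence "\<bar>z\<bar> \<le> 2 * Y" by (rule sup)
      thus False using that by (simp add: Z_def abs_le_iff)
    qed
    have Vb: "(\<Sum>l\<in>?L. \<bar>v l\<bar>) \<le> 2 * K * c" by (rule sum_abs_block_le[OF _ assms(3,4) v]) (use p in simp)
    have V0: "0 \<le> (\<Sum>l\<in>?L. \<bar>v l\<bar>)" by (simp add: sum_nonneg)
    have l1: "(\<Sum>z\<in>Z. cmod (g z)) \<le> V"
    proof -
      have d1: "(\<Sum>z\<in>F. cmod (delta z)) \<le> 1" if "finite F" for F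
        using that by (simp add: delta_def if_distrib sum.delta cong: if_cong)
      have "(\<Sum>z\<in>Z. cmod (g z)) \<le> 2 * (\<Sum>l\<in>?L. \<bar>v l\<bar>) * (2 * (\<Sum>l\<in>?L. \<bar>v l\<bar>) * 1)"
        unfolding g_def by (rule odd_sum_l1_bound[OF odd_sum_l1_bound[OF d1]]) (auto simp: Z_def)
      also have "\<dots> \<le> (4 * K * c) * (4 * K * c)"
      proof -
        have V4: "2 * (\<Sum>l\<in>?L. \<bar>v l\<bar>) \<le> 4 * K * c" using Vb by simp
        show ?thesis using mult_mono[OF V4 V4] V0 assms(3,4) by simp
      qed
      finally show ?thesis by (simp add: V_def power2_eq_square)
    qed
    have "sqsum (?B g) \<le> 4 * sqsum (shift_sum ?J w (floor_pow \<alpha>) g)" by (rule sqsum_odd_sum_le[OF fJ g2])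
    also have "sqsum (shift_sum ?J w (floor_pow \<alpha>) g) \<le> (c / n)\<^sup>2 * real (card ?J) * sqsum g
        + (c / n)\<^sup>2 * (C2 * (rep_rate \<alpha> n + p\<^sup>2)) * (\<Sum>z\<in>Z. cmod (g z))\<^sup>2"
    proof (rule sqsum_shift_sum_le_almost_orthogonal[OF fJ _ _ _ gz])
      fix z z' assume "z \<in> Z" "z' \<in> Z"
      hence "\<bar>z' - z\<bar> \<le> 4 * Y" by (auto simp: Z_def)
      hence "real_of_int \<bar>z' - z\<bar> \<le> 4 * real_of_int Y" by linarith
      also have "\<dots> \<le> 4 * (K * p)\<^sup>2" unfolding Y_def by simp
      finally have "real_of_int \<bar>z' - z\<bar> \<le> 4 * K\<^sup>2 * p\<^sup>2" by (simp add: power_mult_distrib)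
      thus "real (card {(i, j). i \<in> ?J \<and> j \<in> ?J \<and> i \<noteq> j \<and> floor_pow \<alpha> i - floor_pow \<alpha> j = z' - z}) \<le> C2 * (rep_rate \<alpha> n + p\<^sup>2)"
        using p by (intro C2(2)) auto
    qed (use w p assms(4) in \<open>auto simp: Z_def\<close>)
    also have "\<dots> \<le> (c / n)\<^sup>2 * (2 * K * n) * (C1 * (rep_rate \<alpha> p / p\<^sup>2)) + (c / n)\<^sup>2 * (C2 * (rep_rate \<alpha> n + p\<^sup>2)) * V\<^sup>2"
    proof (intro add_mono mult_mono)
      show "real (card ?J) \<le> 2 * K * n" using p assms(3) by (intro card_block_le) auto
      show "sqsum g \<le> C1 * (rep_rate \<alpha> p / p\<^sup>2)" unfolding g_def using C1(2)[OF p(1) v] .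
      show "(\<Sum>z\<in>Z. cmod (g z))\<^sup>2 \<le> V\<^sup>2" using l1 by (intro power_mono) (auto intro: sum_nonneg)
    qed (use p assms C2(1) rep_rate_pos[of n \<alpha>] in \<open>auto simp: sqsum_nonneg\<close>)
    also have "4 * \<dots> = (8 * K * c\<^sup>2 * C1) * (rep_rate \<alpha> p / (n * p\<^sup>2)) + (4 * c\<^sup>2 * C2 * V\<^sup>2) * ((rep_rate \<alpha> n + p\<^sup>2) / n\<^sup>2)"
      using p by (simp add: power_divide power2_eq_square mult_ac)
    also have "\<dots> \<le> (8 * K * c\<^sup>2 * C1 + 4 * c\<^sup>2 * C2 * V\<^sup>2) * (rep_rate \<alpha> p / (n * p\<^sup>2))
       + (8 * K * c\<^sup>2 * C1 + 4 * c\<^sup>2 * C2 * V\<^sup>2) * ((rep_rate \<alpha> n + p\<^sup>2) / n\<^sup>2)"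
      using p assms C1(1) C2(1) rep_rate_pos[of n \<alpha>] rep_rate_pos[of p \<alpha>] by (intro add_mono mult_right_mono) auto
    finally show ?thesis unfolding g_def by (simp add: distrib_left)
  qed
  moreover have "0 \<le> 8 * K * c\<^sup>2 * C1 + 4 * c\<^sup>2 * C2 * V\<^sup>2" using assms C1(1) C2(1) by simp
  ultimately show ?thesis by blast
qed

section \<open>Groups of consecutive dyadic scales\<close>

text \<open>Exponents are two apart, so the bumps at different scales of one group have disjoint supports.\<close>

definition scale_exps :: "nat \<Rightarrow> nat \<Rightarrow> nat set" where "scale_exps b N = (\<lambda>i. b + 2 * i) ` {..<N}"

text \<open>The kernel of a truncated Hilbert transform at the point \<open>\<lfloor>m powr \<alpha>\<rfloor>\<close>, when the active dyadic scales are
\<open>2 ^ e\<close> with \<open>e \<in> E\<close>.\<close>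

definition weight :: "real \<Rightarrow> nat set \<Rightarrow> nat \<Rightarrow> real" where
  "weight \<alpha> E m = (\<Sum>e\<in>E. bump (real m powr \<alpha> / 2 ^ e)) / real m"

text \<open>The solution \<open>m\<close> of \<open>m powr \<alpha> = 2 ^ b\<close>: indices of this size belong to the scale \<open>2 ^ b\<close>.\<close>

definition scale_root :: "real \<Rightarrow> nat \<Rightarrow> real" where "scale_root \<alpha> b = 2 powr (real b / \<alpha>)"

lemma finite_scale_exps: "finite (scale_exps b N)" by (simp add: scale_exps_def)

lemma card_scale_exps: "card (scale_exps b N) = N"
  unfolding scale_exps_def by (subst card_image) (auto simp: inj_on_def)

lemma scale_root_pos: "0 < scale_root \<alpha> b" by (simp add: scale_root_def)

lemma scale_root_powr: "1 < \<alpha> \<Longrightarrow> scale_root \<alpha> b powr \<alpha> = 2 ^ b"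
  by (simp add: scale_root_def powr_powr powr_realpow)

lemma weight_nonneg: "0 \<le> weight \<alpha> E m"
  by (simp add: weight_def sum_nonneg bump_nonneg)

lemma weight_le: assumes "1 \<le> N" "m \<in> block K n" "2 \<le> n" shows "\<bar>weight \<alpha> (scale_exps b N) m\<bar> \<le> 2 * real N / n"
proof -
  have m: "n / 2 \<le> real m" using assms(2) by (simp add: block_def)
  have "(\<Sum>e\<in>scale_exps b N. bump (real m powr \<alpha> / 2 ^ e)) \<le> real (card (scale_exps b N)) * 1"
    using bump_le_1 by (intro sum_bounded_above) auto
  hence "weight \<alpha> (scale_exps b N) m \<le> real N / real m" unfolding weight_def card_scale_exps by (intro divide_right_mono) auto
  also have "\<dots> \<le> real N / (n / 2)" using m assms(3) by (intro divide_left_mono) auto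
  finally show ?thesis using weight_nonneg[of \<alpha> "scale_exps b N" m] by (simp add: mult.commute)
qed

lemma weight_support:
  assumes "1 < \<alpha>" "weight \<alpha> (scale_exps b N) m \<noteq> 0"
  shows "m \<in> block (4 ^ N) (scale_root \<alpha> b)"
proof -
  obtain e where "e \<in> scale_exps b N" "bump (real m powr \<alpha> / 2 ^ e) \<noteq> 0"
    using assms(2) unfolding weight_def by (metis (no_types, lifting) div_0 sum.neutral)
  then obtain i where i: "i < N" "bump (real m powr \<alpha> / 2 ^ (b + 2 * i)) \<noteq> 0" by (auto simp: scale_exps_def)
  have lo: "3/4 * 2 ^ (b + 2 * i) < real m powr \<alpha>" and hi: "real m powr \<alpha> < 7/4 * 2 ^ (b + 2 * i)"
    using bump_nonzero[OF i(2)] by (simp_all add: pos_less_divide_eq pos_divide_less_eq)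
  have m0: "0 < real m"
  proof (rule ccontr)
    assume "\<not> 0 < real m"
    hence "real m powr \<alpha> = 0" by simp
    moreover have "0 < (3/4 * 2 ^ (b + 2 * i) :: real)" by simp
    ultimately show False using lo by linarith
  qed
  let ?n = "scale_root \<alpha> b"
  have "(?n / 2) powr \<alpha> = 2 ^ b / 2 powr \<alpha>" using scale_root_powr[OF assms(1)] by (simp add: powr_divide)
  also have "\<dots> \<le> 2 ^ b / 2 powr 1" using assms(1) by (intro divide_left_mono powr_mono) auto
  also have "\<dots> < 3/4 * 2 ^ b" by simp
  also have "\<dots> \<le> 3/4 * 2 ^ (b + 2 * i)" by simp
  also note lo
  finally have "?n / 2 < real m" using powr_less_cancel2[of \<alpha> "?n / 2" "real m"] m0 assms(1) scale_root_pos[of \<alpha> b] by simp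
  moreover have "real m < 4 ^ N * ?n"
  proof -
    have "(7/4 * 2 ^ (b + 2 * i) :: real) \<le> 2 ^ b * 4 ^ (Suc i)" by (simp add: power_add power_mult)
    also have "\<dots> \<le> 2 ^ b * 4 ^ N" using i(1) by (intro mult_left_mono power_increasing) auto
    also have "\<dots> = ?n powr \<alpha> * (4 ^ N) powr 1" using scale_root_powr[OF assms(1)] by simp
    also have "\<dots> \<le> ?n powr \<alpha> * (4 ^ N) powr \<alpha>" using assms(1) by (intro mult_left_mono powr_mono) auto
    also have "\<dots> = (4 ^ N * ?n) powr \<alpha>" by (simp add: powr_mult)
    finally have "real m powr \<alpha> < (4 ^ N * ?n) powr \<alpha>" using hi by linarith
    thus ?thesis using powr_less_cancel2[of \<alpha> "real m" "4 ^ N * ?n"] m0 assms(1) scale_root_pos[of \<alpha> b] by simp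
  qed
  ultimately show ?thesis by (simp add: block_def)
qed

text \<open>Indices at which the bump of the scale \<open>b + 2 i\<close> is bounded below: since \<open>\<alpha> < 2\<close>, their powers lie between
\<open>2 ^ (b + 2 i)\<close> and \<open>5/4\<close> times that number.\<close>

definition core_block :: "real \<Rightarrow> nat \<Rightarrow> nat \<Rightarrow> nat set" where
  "core_block \<alpha> b i = {m. scale_root \<alpha> (b + 2 * i) \<le> real m \<and> real m \<le> 11 / 10 * scale_root \<alpha> (b + 2 * i)}"

lemma weight_core_block:
  assumes "1 < \<alpha>" "\<alpha> < 2" "i < N" "m \<in> core_block \<alpha> b i"
  shows "exp (-8) / real m \<le> weight \<alpha> (scale_exps b N) m" "m \<in> block (4 ^ N) (scale_root \<alpha> b)"
proof -
  let ?m = "scale_root \<alpha> (b + 2 * i)"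
  have m: "?m \<le> real m" "real m \<le> 11 / 10 * ?m" using assms(4) by (auto simp: core_block_def)
  have m0: "0 < real m" using m scale_root_pos[of \<alpha> "b + 2 * i"] by linarith
  have "?m powr \<alpha> \<le> real m powr \<alpha>" using m assms scale_root_pos[of \<alpha> "b + 2 * i"] by (intro powr_mono2) auto
  hence lo: "1 \<le> real m powr \<alpha> / 2 ^ (b + 2 * i)" using scale_root_powr[OF assms(1)] by simp
  have "real m powr \<alpha> \<le> (11/10 * ?m) powr \<alpha>" using m assms by (intro powr_mono2) auto
  also have "\<dots> = (11/10) powr \<alpha> * 2 ^ (b + 2 * i)" unfolding powr_mult scale_root_powr[OF assms(1)] by (rule refl)
  also have "\<dots> \<le> (11/10) powr 2 * 2 ^ (b + 2 * i)" using assms by (intro mult_right_mono powr_mono) auto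
  also have "\<dots> \<le> 5/4 * 2 ^ (b + 2 * i)" by (simp add: power2_eq_square)
  finally have hi: "real m powr \<alpha> / 2 ^ (b + 2 * i) \<le> 5/4" by (simp add: pos_divide_le_eq)
  have "exp (-8) \<le> bump (real m powr \<alpha> / 2 ^ (b + 2 * i))" by (rule bump_lower[OF lo hi])
  also have "\<dots> \<le> (\<Sum>e\<in>scale_exps b N. bump (real m powr \<alpha> / 2 ^ e))"
    using assms(3) by (intro member_le_sum) (auto simp: scale_exps_def bump_nonneg)
  finally show w: "exp (-8) / real m \<le> weight \<alpha> (scale_exps b N) m" unfolding weight_def by (intro divide_right_mono) auto
  have "0 < exp (-8) / real m" using m0 by simp
  thus "m \<in> block (4 ^ N) (scale_root \<alpha> b)" using w by (intro weight_support[OF assms(1)]) auto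
qed

lemma finite_core_block: "finite (core_block \<alpha> b i)"
  by (rule finite_subset[of _ "{..nat \<lfloor>11 / 10 * scale_root \<alpha> (b + 2 * i)\<rfloor>}"]) (auto simp: core_block_def le_nat_floor)

lemma card_core_block: assumes "20 \<le> scale_root \<alpha> (b + 2 * i)" shows "scale_root \<alpha> (b + 2 * i) / 20 \<le> real (card (core_block \<alpha> b i))"
proof -
  let ?m = "scale_root \<alpha> (b + 2 * i)"
  have "{nat \<lceil>?m\<rceil>..nat \<lfloor>11/10 * ?m\<rfloor>} \<subseteq> core_block \<alpha> b i"
  proof
    fix k assume k: "k \<in> {nat \<lceil>?m\<rceil>..nat \<lfloor>11/10 * ?m\<rfloor>}"
    hence "?m \<le> real k" by (simp add: nat_ceiling_le_eq)
    moreover have "real k \<le> 11/10 * ?m" using k assms by (simp add: le_nat_iff le_floor_iff)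
    ultimately show "k \<in> core_block \<alpha> b i" by (simp add: core_block_def)
  qed
  from card_mono[OF finite_core_block this]
  have "nat \<lfloor>11/10 * ?m\<rfloor> + 1 \<le> card (core_block \<alpha> b i) + nat \<lceil>?m\<rceil>" by simp
  hence "real (nat \<lfloor>11/10 * ?m\<rfloor>) + 1 \<le> real (card (core_block \<alpha> b i)) + real (nat \<lceil>?m\<rceil>)" by linarith
  moreover have "real (nat \<lfloor>11/10 * ?m\<rfloor>) \<ge> 11/10 * ?m - 1" "real (nat \<lceil>?m\<rceil>) \<le> ?m + 1" using assms by linarith+
  ultimately show ?thesis using assms by linarith
qed

lemma scale_root_mono: "1 < \<alpha> \<Longrightarrow> b \<le> c \<Longrightarrow> scale_root \<alpha> b \<le> scale_root \<alpha> c"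
  unfolding scale_root_def by (intro powr_mono divide_right_mono) auto

lemma scale_root_mult: "scale_root \<alpha> b * scale_root \<alpha> c = scale_root \<alpha> (b + c)"
  by (simp add: scale_root_def powr_add[symmetric] add_divide_distrib)

lemma core_block_disjoint:
  assumes "1 < \<alpha>" "\<alpha> < 2" "m \<in> core_block \<alpha> b i" "m \<in> core_block \<alpha> b j"
  shows "i = j"
proof -
  have F: False if a: "m \<in> core_block \<alpha> b i" "m \<in> core_block \<alpha> b j" "i < j" for i j
  proof -
    have "2 * scale_root \<alpha> (b + 2 * i) \<le> scale_root \<alpha> 2 * scale_root \<alpha> (b + 2 * i)"
    proof (intro mult_right_mono)
      have "2 powr 1 \<le> 2 powr (2 / \<alpha>)" using assms by (intro powr_mono) auto
      thus "2 \<le> scale_root \<alpha> 2" by (simp add: scale_root_def)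
    qed (use scale_root_pos[of \<alpha>] in \<open>auto intro: less_imp_le\<close>)
    also have "\<dots> = scale_root \<alpha> (2 + (b + 2 * i))" by (rule scale_root_mult)
    also have "\<dots> \<le> scale_root \<alpha> (b + 2 * j)" using a(3) by (intro scale_root_mono[OF assms(1)]) auto
    also have "\<dots> \<le> 11 / 10 * scale_root \<alpha> (b + 2 * i)" using a by (auto simp: core_block_def)
    finally show False using scale_root_pos[of \<alpha> "b + 2 * i"] by linarith
  qed
  show ?thesis using F[of i j] F[of j i] assms(3,4) by (cases i j rule: linorder_cases) auto
qed

text \<open>A second representation of \<open>\<lfloor>m powr \<alpha>\<rfloor> + \<lfloor>l powr \<alpha>\<rfloor>\<close> forces a small nonzero difference of two points of
\<open>B\<close>. There are \<open>O(p\<^sup>2)\<close> such differences, and each is attained rarely. The value \<open>z = 0\<close> accounts for sums that are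
themselves points of \<open>B\<close>.\<close>

lemma card_bad_pairs:
  assumes "1 < \<alpha>" "\<alpha> < 2" "1 \<le> K"
  shows "\<exists>C\<ge>0. \<forall>n p. 2 \<le> p \<longrightarrow> p \<le> n \<longrightarrow>
    real (card {(m, l). m \<in> block K n \<and> l \<in> block K p \<and> (\<exists>m'\<in>block K n. m' \<noteq> m \<and>
        (\<exists>z \<in> {0} \<union> floor_pow \<alpha> ` block K p \<union> (\<lambda>l. - floor_pow \<alpha> l) ` block K p. floor_pow \<alpha> m + floor_pow \<alpha> l = floor_pow \<alpha> m' + z))})
      \<le> C * (p\<^sup>2 * (rep_rate \<alpha> n + p\<^sup>2))"
proof -
  have K2: "1 \<le> 4 * K\<^sup>2" using one_le_power[OF assms(3), of 2] by linarith
  obtain C2 where C2: "C2 \<ge> 0" "\<And>n p z. n \<ge> 2 \<Longrightarrow> 1 \<le> p \<Longrightarrow> p \<le> n \<Longrightarrow> real_of_int \<bar>z\<bar> \<le> 4 * K\<^sup>2 * p\<^sup>2 \<Longrightarrow>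
    real (card {(i, j). i \<in> block K n \<and> j \<in> block K n \<and> i \<noteq> j \<and> floor_pow \<alpha> i - floor_pow \<alpha> j = z}) \<le> C2 * (rep_rate \<alpha> n + p\<^sup>2)"
    using card_block_diff[OF assms(1-3) K2] by blast
  have "real (card {(m, l). m \<in> block K n \<and> l \<in> block K p \<and> (\<exists>m'\<in>block K n. m' \<noteq> m \<and>
        (\<exists>z \<in> {0} \<union> floor_pow \<alpha> ` block K p \<union> (\<lambda>l. - floor_pow \<alpha> l) ` block K p. floor_pow \<alpha> m + floor_pow \<alpha> l = floor_pow \<alpha> m' + z))})
      \<le> (12 * K\<^sup>2 * C2) * (p\<^sup>2 * (rep_rate \<alpha> n + p\<^sup>2))" if p: "2 \<le> p" "p \<le> n" for n p
  proof -
    let ?J = "block K n" let ?L = "block K p"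
    define Z where "Z = {0} \<union> floor_pow \<alpha> ` ?L \<union> (\<lambda>l. - floor_pow \<alpha> l) ` ?L"
    define R where "R = C2 * (rep_rate \<alpha> n + p\<^sup>2)"
    have R0: "R \<ge> 0" unfolding R_def using C2(1) rep_rate_pos[of n \<alpha>] p by simp
    have finZ: "finite Z" unfolding Z_def by (intro finite_UnI finite_imageI finite_block) auto
    note pwl = floor_pow_block_le[OF assms(1,2) p(1)]
    define T where "T = (\<lambda>l z. {(i, j). i \<in> ?J \<and> j \<in> ?J \<and> i \<noteq> j \<and> floor_pow \<alpha> i - floor_pow \<alpha> j = z - floor_pow \<alpha> l})"
    have finT: "finite (T l z)" for l z
      by (rule finite_subset[of _ "?J \<times> ?J"]) (auto simp: T_def finite_block)
    have cT: "real (card (T l z)) \<le> R" if "l \<in> ?L" "z \<in> Z" for l z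
    proof -
      have "real_of_int \<bar>z\<bar> \<le> K\<^sup>2 * p\<^sup>2" using that(2) pwl unfolding Z_def by auto
      hence "real_of_int \<bar>z - floor_pow \<alpha> l\<bar> \<le> 2 * (K\<^sup>2 * p\<^sup>2)" using pwl[OF that(1)] by linarith
      also have "\<dots> \<le> 4 * K\<^sup>2 * p\<^sup>2" by simp
      finally show ?thesis unfolding T_def R_def using p by (intro C2(2)) auto
    qed
    have "{(m, l). m \<in> ?J \<and> l \<in> ?L \<and> (\<exists>m'\<in>?J. m' \<noteq> m \<and> (\<exists>z\<in>Z. floor_pow \<alpha> m + floor_pow \<alpha> l = floor_pow \<alpha> m' + z))}
      \<subseteq> (\<Union>l\<in>?L. \<Union>z\<in>Z. (\<lambda>(i, j). (i, l)) ` T l z)" (is "?Bad \<subseteq> ?U")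
    proof safe
      fix m l m' z assume a: "m \<in> ?J" "l \<in> ?L" "m' \<in> ?J" "m' \<noteq> m" "z \<in> Z" "floor_pow \<alpha> m + floor_pow \<alpha> l = floor_pow \<alpha> m' + z"
      hence "(m, m') \<in> T l z" by (auto simp: T_def)
      hence "(m, l) \<in> (\<lambda>(i, j). (i, l)) ` T l z" by (rule rev_image_eqI) simp
      thus "(m, l) \<in> ?U" using a(2,5) by blast
    qed
    hence "card ?Bad \<le> card ?U" using finite_block finZ finT by (intro card_mono) auto
    also have "\<dots> \<le> (\<Sum>l\<in>?L. \<Sum>z\<in>Z. card (T l z))"
      using finZ finT finite_block
      by (intro order.trans[OF card_UN_le] sum_mono order.trans[OF card_UN_le] card_image_le) auto
    finally have "real (card ?Bad) \<le> real (\<Sum>l\<in>?L. \<Sum>z\<in>Z. card (T l z))" by (rule of_nat_mono)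
    also have "\<dots> = (\<Sum>l\<in>?L. \<Sum>z\<in>Z. real (card (T l z)))" by simp
    also have "\<dots> \<le> (\<Sum>l\<in>?L. \<Sum>z\<in>Z. R)" using cT by (intro sum_mono) auto
    also have "\<dots> = real (card ?L) * (real (card Z) * R)" by simp
    also have "\<dots> \<le> (2 * K * p) * ((6 * K * p) * R)"
    proof (intro mult_mono)
      show cL: "real (card ?L) \<le> 2 * K * p" using p assms(3) by (intro card_block_le) auto
      have "card Z \<le> card ({0::int} \<union> floor_pow \<alpha> ` ?L) + card ((\<lambda>l. - floor_pow \<alpha> l) ` ?L)" unfolding Z_def by (rule card_Un_le)
      also have "\<dots> \<le> (card {0::int} + card (floor_pow \<alpha> ` ?L)) + card ((\<lambda>l. - floor_pow \<alpha> l) ` ?L)"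
        by (intro add_right_mono card_Un_le)
      also have "\<dots> \<le> (1 + card ?L) + card ?L" by (intro add_mono card_image_le finite_block) auto
      finally have "real (card Z) \<le> 1 + 2 * real (card ?L)" by linarith
      also have "\<dots> \<le> K * p + 2 * (2 * K * p)" using cL mult_mono[of 1 K 1 p] p assms(3) by linarith
      finally show "real (card Z) \<le> 6 * K * p" using assms(3) p by (simp add: mult_right_mono)
    qed (use p assms(3) R0 in auto)
    also have "\<dots> = (12 * K\<^sup>2 * C2) * (p\<^sup>2 * (rep_rate \<alpha> n + p\<^sup>2))" unfolding R_def by (simp add: power2_eq_square)
    finally show ?thesis unfolding Z_def .
  qed
  moreover have "0 \<le> 12 * K\<^sup>2 * C2" using C2(1) by simp
  ultimately show ?thesis by blast
qed

section \<open>A weak type bound limits the number of scales\<close>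

text \<open>The size, relative to the main term, of everything that is discarded. The first summand tends to \<open>0\<close> only when \<open>p\<close> is of
smaller order than \<open>n powr (\<alpha> - 1)\<close>; this is where \<open>\<theta> < \<alpha> - 1\<close> enters.\<close>

definition err_rate :: "real \<Rightarrow> real \<Rightarrow> real \<Rightarrow> real" where
  "err_rate \<alpha> n p = p * (rep_rate \<alpha> n + p\<^sup>2) / n + rep_rate \<alpha> p / p"

definition weak_le :: "real \<Rightarrow> (int \<Rightarrow> complex) \<Rightarrow> bool" where
  "weak_le C f \<longleftrightarrow> (\<forall>t>0. finite {x. cmod (f x) > t} \<and> real (card {x. cmod (f x) > t}) \<le> C / t)"

definition group_op :: "real \<Rightarrow> nat \<Rightarrow> nat \<Rightarrow> (int \<Rightarrow> complex) \<Rightarrow> int \<Rightarrow> complex" where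
  "group_op \<alpha> b N = odd_sum (block (4 ^ N) (scale_root \<alpha> b)) (weight \<alpha> (scale_exps b N)) (floor_pow \<alpha>)"

text \<open>A uniform weak type bound \<open>C'\<close> caps the number \<open>N\<close> of scales, up to an error that vanishes as the two groups of scales
move to infinity. The operator \<open>1 + A + B\<close> is presented through its own family of translations because the a priori inequality
needs it to be skew as a whole.\<close>

definition scale_count_bound :: "real \<Rightarrow> nat \<Rightarrow> real \<Rightarrow> bool" where
  "scale_count_bound \<alpha> N C \<longleftrightarrow> (\<forall>\<sigma> \<tau> I (wH :: nat \<Rightarrow> real) yH u r C'.
    40 \<le> scale_root \<alpha> \<sigma> \<longrightarrow> (2 * 4 ^ N * scale_root \<alpha> \<sigma>)\<^sup>2 < scale_root \<alpha> \<tau> \<longrightarrow> finite I \<longrightarrow>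
    (\<forall>f x. odd_sum I wH yH f x = group_op \<alpha> \<sigma> N f x + group_op \<alpha> \<tau> N f x) \<longrightarrow>
    u \<in> ell2 \<longrightarrow> (\<forall>x. u x + odd_sum I wH yH u x = delta x) \<longrightarrow>
    r \<in> ell2 \<longrightarrow> (\<forall>x. r x + group_op \<alpha> \<sigma> N r x = delta x) \<longrightarrow>
    weak_le C' u \<longrightarrow> weak_le C' r \<longrightarrow>
    real N / 400 \<le> 8 * exp 16 * C' + C * err_rate \<alpha> (scale_root \<alpha> \<tau>) (scale_root \<alpha> \<sigma>))"

text \<open>Let \<open>Q\<close> be the product of the sizes of \<open>m\<close> and \<open>l\<close> for a pair of scales with \<open>i + j = N - 1\<close>, which is the
same for all \<open>N\<close> pairs. The set \<open>X\<close> of uniquely represented sums has at least \<open>N Q / 400\<close> elements up to the bad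
pairs, and \<open>2 A B \<delta>\<close> exceeds \<open>exp (-16) / Q\<close> on it. Counting \<open>X\<close> through the level sets of \<open>u\<close>,
\<open>r\<close> and the two errors bounds its size by \<open>O(C' Q)\<close> plus \<open>Q\<^sup>2\<close> times the squared norms of the errors.
Division by \<open>Q\<close> gives the claim.\<close>

lemma weak_bound_forces_few_scales:
  assumes al: "1 < \<alpha>" "\<alpha> < 2" and N: "1 \<le> N"
  shows "\<exists>C\<ge>0. scale_count_bound \<alpha> N C"
proof -
  define K :: real where "K = 4 ^ N"
  have K: "1 \<le> K" unfolding K_def by simp
  define c where "c = 2 * real N"
  have c: "0 \<le> c" by (simp add: c_def)
  obtain C1 where C1: "C1 \<ge> 0" "\<And>n w. n \<ge> 2 \<Longrightarrow> \<forall>m\<in>block K n. \<bar>w m\<bar> \<le> c / n \<Longrightarrow>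
    sqsum (odd_sum (block K n) w (floor_pow \<alpha>) (odd_sum (block K n) w (floor_pow \<alpha>) delta)) \<le> C1 * (rep_rate \<alpha> n / n\<^sup>2)"
    using sqsum_odd_twice_block[OF al K c] by blast
  obtain C2 where C2: "C2 \<ge> 0" "\<And>n p w v. 2 \<le> p \<Longrightarrow> p \<le> n \<Longrightarrow> \<forall>m\<in>block K n. \<bar>w m\<bar> \<le> c / n \<Longrightarrow> \<forall>l\<in>block K p. \<bar>v l\<bar> \<le> c / p \<Longrightarrow>
    sqsum (odd_sum (block K n) w (floor_pow \<alpha>) (odd_sum (block K p) v (floor_pow \<alpha>) (odd_sum (block K p) v (floor_pow \<alpha>) delta)))
      \<le> C2 * (rep_rate \<alpha> p / (n * p\<^sup>2) + (rep_rate \<alpha> n + p\<^sup>2) / n\<^sup>2)"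
    using sqsum_odd_mixed_block[OF al K c] by blast
  obtain C3 where C3: "C3 \<ge> 0" "\<And>n p. 2 \<le> p \<Longrightarrow> p \<le> n \<Longrightarrow>
    real (card {(m, l). m \<in> block K n \<and> l \<in> block K p \<and> (\<exists>m'\<in>block K n. m' \<noteq> m \<and>
        (\<exists>z \<in> {0} \<union> floor_pow \<alpha> ` block K p \<union> (\<lambda>l. - floor_pow \<alpha> l) ` block K p. floor_pow \<alpha> m + floor_pow \<alpha> l = floor_pow \<alpha> m' + z))})
      \<le> C3 * (p\<^sup>2 * (rep_rate \<alpha> n + p\<^sup>2))"
    using card_bad_pairs[OF al K] by blast
  define V where "V = 18 + 32 * (2 * K * c)\<^sup>2"
  have V: "V \<ge> 0" by (simp add: V_def)
  define C where "C = C3 + 16 * exp 32 * K * (C1 + V * C2)"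
  have "real N / 400 \<le> 8 * exp 16 * C' + C * err_rate \<alpha> (scale_root \<alpha> \<tau>) (scale_root \<alpha> \<sigma>)"
    if p40: "40 \<le> scale_root \<alpha> \<sigma>" and sep: "(2 * K * scale_root \<alpha> \<sigma>)\<^sup>2 < scale_root \<alpha> \<tau>" and I: "finite I"
    and H: "\<forall>f x. odd_sum I wH yH f x = group_op \<alpha> \<sigma> N f x + group_op \<alpha> \<tau> N f x"
    and u: "u \<in> ell2" "\<forall>x. u x + odd_sum I wH yH u x = delta x"
    and r: "r \<in> ell2" "\<forall>x. r x + group_op \<alpha> \<sigma> N r x = delta x"
    and Wu: "weak_le C' u"
    and Wr: "weak_le C' r"
    for \<sigma> \<tau> I and wH :: "nat \<Rightarrow> real" and yH u r C'
  proof -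
    note wu = Wu[unfolded weak_le_def] and wr = Wr[unfolded weak_le_def]
    define n where "n = scale_root \<alpha> \<tau>"
    define p where "p = scale_root \<alpha> \<sigma>"
    let ?J = "block K n" let ?L = "block K p" let ?y = "floor_pow \<alpha>"
    define w where "w = weight \<alpha> (scale_exps \<tau> N)"
    define v where "v = weight \<alpha> (scale_exps \<sigma> N)"
    let ?A = "odd_sum ?L v ?y" let ?B = "odd_sum ?J w ?y"
    have fJ: "finite ?J" and fL: "finite ?L" by (rule finite_block)+
    have p: "40 \<le> p" using p40 by (simp add: p_def)
    have Kp: "1 * 40 \<le> K * p" using K p by (intro mult_mono) auto
    have sepn: "(2 * (K * p))\<^sup>2 < n" using sep by (simp add: n_def p_def mult.assoc)
    have "2 * (K * p) * 80 \<le> (2 * (K * p))\<^sup>2" unfolding power2_eq_square using Kp by (intro mult_left_mono) auto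
    hence Kpn: "160 * (K * p) < n" using sepn by linarith
    have pn: "p \<le> K * p" using mult_right_mono[of 1 K p] K p by simp
    have n: "2 \<le> n" "p \<le> n" "0 < n" using Kpn pn Kp by linarith+
    have w: "\<forall>m\<in>?J. \<bar>w m\<bar> \<le> c / n" unfolding w_def c_def using weight_le[OF N _ n(1)] by blast
    have v: "\<forall>l\<in>?L. \<bar>v l\<bar> \<le> c / p" unfolding v_def c_def using weight_le[OF N, where K = K and n = p and \<alpha> = \<alpha> and b = \<sigma>] p by force
    have H': "odd_sum I wH yH f x = ?A f x + ?B f x" for f x using H unfolding w_def v_def n_def p_def K_def group_op_def by blast
    have u': "u x + odd_sum I wH yH u x = delta x" for x using u(2) by blast
    have r': "r x + ?A r x = delta x" for x using r(2) unfolding v_def p_def K_def group_op_def by blast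
    obtain e1 e2 where e: "e1 \<in> ell2" "e2 \<in> ell2" "sqsum e1 \<le> sqsum (?B (?B delta))"
      "sqsum e2 \<le> (18 + 32 * (\<Sum>l\<in>?L. \<bar>v l\<bar>)\<^sup>2) * sqsum (?B (?A (?A delta)))"
      "\<And>x. u x - r x + ?B delta x - 2 * ?A (?B delta) x = e1 x - e2 x"
      by (rule resolvent_expansion[OF fL fJ I H' u(1) u' r(1) r' delta_ell2])  (rule that)
    have "(\<Sum>l\<in>?L. \<bar>v l\<bar>) \<le> 2 * K * c" by (rule sum_abs_block_le[OF _ K c v]) (use p in simp)
    hence Vv: "18 + 32 * (\<Sum>l\<in>?L. \<bar>v l\<bar>)\<^sup>2 \<le> V" unfolding V_def by (auto intro!: power_mono sum_nonneg)
    have e1b: "sqsum e1 \<le> C1 * (rep_rate \<alpha> n / n\<^sup>2)" using e(3) C1(2)[OF n(1) w] by linarith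
    have e2b: "sqsum e2 \<le> V * (C2 * (rep_rate \<alpha> p / (n * p\<^sup>2) + (rep_rate \<alpha> n + p\<^sup>2) / n\<^sup>2))"
      by (rule order.trans[OF e(4)], rule mult_mono[OF Vv C2(2)[OF _ n(2) w v]])
         (use p V in \<open>auto simp: sqsum_nonneg\<close>)
    define Q where "Q = scale_root \<alpha> (\<sigma> + \<tau> + 2 * (N - 1))"
    have Q1: "n * p \<le> Q" unfolding n_def p_def Q_def scale_root_mult using scale_root_mono[OF al(1)] by simp
    have Q2: "Q \<le> K * (n * p)"
    proof -
      have "2 * real (N - 1) / \<alpha> \<le> 2 * real N / 1" using al by (intro frac_le) auto
      hence "scale_root \<alpha> (2 * (N - 1)) \<le> 2 powr (2 * real N)" unfolding scale_root_def by (intro powr_mono) auto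
      also have "\<dots> = 2 powr real (2 * N)" by simp
      also have "\<dots> = 2 ^ (2 * N)" by (rule powr_realpow) simp
      also have "\<dots> = K" unfolding K_def by (simp add: power_mult)
      finally have "scale_root \<alpha> (2 * (N - 1)) * (n * p) \<le> K * (n * p)" using n p by (intro mult_right_mono) auto
      moreover have "scale_root \<alpha> (2 * (N - 1)) * (n * p) = Q" unfolding n_def p_def Q_def scale_root_mult by (simp add: add_ac)
      ultimately show ?thesis by simp
    qed
    have np: "0 < n * p" using n p by simp
    hence Q0: "0 < Q" using Q1 by linarith
    (* A quarter of the guaranteed size of 2 A B \<delta>; exp (-16) is the product of two lower bounds for the bump. *)
    define t where "t = exp (-16) / (4 * Q)"
    have t: "0 < t" "1 / t = 4 * exp 16 * Q" using Q0 by (auto simp: t_def exp_minus field_simps)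
    (* Scales are paired so that the product of the two sizes does not depend on j. *)
    define Pairs where "Pairs = (\<Union>j\<in>{..<N}. core_block \<alpha> \<tau> j \<times> core_block \<alpha> \<sigma> (N - 1 - j))"
    define Bad where "Bad = {(m, l). m \<in> ?J \<and> l \<in> ?L \<and> (\<exists>m'\<in>?J. m' \<noteq> m \<and>
        (\<exists>z \<in> {0} \<union> ?y ` ?L \<union> (\<lambda>l. - ?y l) ` ?L. ?y m + ?y l = ?y m' + z))}"
    have core: "m \<in> ?J" "l \<in> ?L" "exp (-16) / Q < 2 * (v l * w m)" if ml: "(m, l) \<in> Pairs" for m l
    proof -
      obtain j where j: "j < N" "m \<in> core_block \<alpha> \<tau> j" "l \<in> core_block \<alpha> \<sigma> (N - 1 - j)"
        using ml by (auto simp: Pairs_def)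
      have j': "N - 1 - j < N" using N by simp
      show "m \<in> ?J" "l \<in> ?L" using weight_core_block(2)[OF al j(1,2)] weight_core_block(2)[OF al j' j(3)] by (auto simp: K_def n_def p_def)
      have wl: "exp (-8) / real m \<le> w m" "exp (-8) / real l \<le> v l"
        using weight_core_block(1)[OF al j(1,2)] weight_core_block(1)[OF al j' j(3)] by (auto simp: w_def v_def)
      have m0: "0 < real m" "0 < real l" using j(2,3) scale_root_pos[of \<alpha> "\<tau> + 2 * j"] scale_root_pos[of \<alpha> "\<sigma> + 2 * (N - 1 - j)"]
        unfolding core_block_def mem_Collect_eq by linarith+
      have "real l * real m \<le> (11/10 * scale_root \<alpha> (\<sigma> + 2 * (N - 1 - j))) * (11/10 * scale_root \<alpha> (\<tau> + 2 * j))"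
        using j(2,3) m0 by (intro mult_mono) (auto simp: core_block_def)
      also have "\<dots> = 121/100 * (scale_root \<alpha> (\<sigma> + 2 * (N - 1 - j)) * scale_root \<alpha> (\<tau> + 2 * j))" by simp
      also have "scale_root \<alpha> (\<sigma> + 2 * (N - 1 - j)) * scale_root \<alpha> (\<tau> + 2 * j) = Q"
      proof -
        have eq: "\<sigma> + 2 * (N - 1 - j) + (\<tau> + 2 * j) = \<sigma> + \<tau> + 2 * (N - 1)" using j(1) by simp
        show ?thesis unfolding scale_root_mult Q_def eq ..
      qed
      finally have lm: "real l * real m < 2 * Q" using Q0 by simp
      have "exp (-16) / Q = 2 * (exp (-16) / (2 * Q))" by simp
      also have "\<dots> < 2 * (exp (-16) / (real l * real m))"
        using lm m0 Q0 by (intro mult_strict_left_mono divide_strict_left_mono mult_pos_pos) auto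
      also have "exp (-16) / (real l * real m) = (exp (-8) / real l) * (exp (-8) / real m)"
        by (simp add: exp_add[symmetric])
      also have "2 * \<dots> \<le> 2 * (v l * w m)" using wl m0 by (intro mult_left_mono mult_mono) (auto intro: order.trans[of 0 "exp (-8) / real l"])
      finally show "exp (-16) / Q < 2 * (v l * w m)" .
    qed
    have pos: "0 < ?y l \<and> ?y l < ?y m" if "m \<in> ?J" "l \<in> ?L" for m l
    proof
      have l1: "1 \<le> l" using that(2) p by (auto simp: block_def)
      have "?y 0 < ?y l" using floor_pow_strict_mono[of \<alpha> 0 l] l1 al by simp
      thus "0 < ?y l" by (simp add: floor_pow_def)
      have "real l < real m" using that Kpn Kp by (auto simp: block_def)
      thus "?y l < ?y m" using floor_pow_strict_mono[of \<alpha> l m] al by simp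
    qed
    have inj: "inj_on ?y ?L" using floor_pow_inj[of \<alpha>] al by (auto simp: inj_on_def)
    have finPairs: "finite Pairs" unfolding Pairs_def by (intro finite_UN_I finite_cartesian_product finite_core_block) auto
    have finBad: "finite Bad" by (rule finite_subset[of _ "?J \<times> ?L"]) (auto simp: Bad_def fJ fL)
    define X where "X = (\<lambda>(m, l). ?y m + ?y l) ` (Pairs - Bad)"
    have good: "?y m + ?y l \<noteq> ?y m' + z"
      if "(m, l) \<in> Pairs - Bad" "m' \<in> ?J" "m' \<noteq> m" "z \<in> {0} \<union> ?y ` ?L \<union> (\<lambda>l. - ?y l) ` ?L" for m l m' z
    proof
      assume "?y m + ?y l = ?y m' + z"
      hence "(m, l) \<in> Bad" using that core(1,2)[of m l] unfolding Bad_def by blast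
      thus False using that(1) by blast
    qed
    have injX: "inj_on (\<lambda>(m, l). ?y m + ?y l) (Pairs - Bad)"
    proof (rule inj_onI, safe)
      fix m l m' l' assume a: "(m, l) \<in> Pairs" "(m, l) \<notin> Bad" "(m', l') \<in> Pairs" "(m', l') \<notin> Bad" "?y m + ?y l = ?y m' + ?y l'"
      have mm: "m' = m"
      proof (rule ccontr)
        assume "m' \<noteq> m"
        thus False using good[of m l m' "?y l'"] core(1,2)[OF a(3)] a by blast
      qed
      thus "m = m'" by simp
      show "l = l'" using a(5) mm floor_pow_inj[of \<alpha> l l'] al by simp
    qed
    have X: "?B delta x = 0" "cmod (2 * ?A (?B delta) x) > 4 * t" if x: "x \<in> X" for x
    proof -
      obtain m l where ml: "(m, l) \<in> Pairs - Bad" "x = ?y m + ?y l" using x by (auto simp: X_def)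
      note pp = product_at_good_point[OF fJ fL _ _ pos inj good[OF ml(1)]]
      have ml': "m \<in> ?J" "l \<in> ?L" "exp (-16) / Q < 2 * (v l * w m)" using core[of m l] ml(1) by auto
      show "?B delta x = 0" unfolding ml(2) using ml' by (intro pp(1)) auto
      have "?A (?B delta) x = of_real (v l * w m)" unfolding ml(2) using ml' by (intro pp(2)) auto
      hence "cmod (2 * ?A (?B delta) x) = 2 * \<bar>v l * w m\<bar>" by (simp add: norm_mult abs_mult)
      also have "\<dots> \<ge> 2 * (v l * w m)" by simp
      finally show "cmod (2 * ?A (?B delta) x) > 4 * t" using ml'(3) unfolding t_def by simp
    qed
    have "real (card X) \<le> real (card {x. cmod (u x) > t}) + real (card {x. cmod (r x) > t}) + (sqsum e1 + sqsum e2) / t\<^sup>2"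
    proof (rule card_le_level_sets[OF _ t(1) e(1,2)])
      show "finite X" unfolding X_def using finPairs by simp
      show "u x - r x - 2 * ?A (?B delta) x = e1 x - e2 x" if "x \<in> X" for x using e(5)[of x] X(1)[OF that] by simp
    qed (use X(2) wu wr t(1) in auto)
    also have "\<dots> \<le> C' / t + C' / t + (sqsum e1 + sqsum e2) / t\<^sup>2"
      using wu wr t(1) by (intro add_mono) auto
    also have "\<dots> = 8 * exp 16 * C' * Q + 16 * exp 32 * Q\<^sup>2 * (sqsum e1 + sqsum e2)"
    proof -
      have "C' / t = C' * (1 / t)" "(sqsum e1 + sqsum e2) / t\<^sup>2 = (sqsum e1 + sqsum e2) * (1 / t)\<^sup>2"
        by (simp_all add: power_one_over)
      thus ?thesis unfolding t(2) by (simp add: power_mult_distrib power2_eq_square exp_add[symmetric] mult_ac)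
    qed
    finally have upper: "real (card X) \<le> 8 * exp 16 * C' * Q + 16 * exp 32 * Q\<^sup>2 * (sqsum e1 + sqsum e2)" .
    have cardPairs: "real N * Q / 400 \<le> real (card Pairs)"
    proof -
      have "card Pairs = (\<Sum>j<N. card (core_block \<alpha> \<tau> j \<times> core_block \<alpha> \<sigma> (N - 1 - j)))"
        unfolding Pairs_def
        by (rule card_UN_disjoint) (auto intro: finite_core_block dest: core_block_disjoint[OF al])
      hence "real (card Pairs) = (\<Sum>j<N. real (card (core_block \<alpha> \<tau> j)) * real (card (core_block \<alpha> \<sigma> (N - 1 - j))))"
        by (simp add: card_cartesian_product)
      also have "\<dots> \<ge> (\<Sum>j<N. Q / 400)"
      proof (rule sum_mono)
        fix j assume j: "j \<in> {..<N}"
        have a: "20 \<le> scale_root \<alpha> (\<tau> + 2 * j)" using scale_root_mono[OF al(1), of \<tau> "\<tau> + 2 * j"] Kpn Kp unfolding n_def by simp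
        have b: "20 \<le> scale_root \<alpha> (\<sigma> + 2 * (N - 1 - j))" using scale_root_mono[OF al(1), of \<sigma> "\<sigma> + 2 * (N - 1 - j)"] p unfolding p_def by simp
        have eq: "\<sigma> + \<tau> + 2 * (N - 1) = \<tau> + 2 * j + (\<sigma> + 2 * (N - 1 - j))" using j by simp
        have "Q / 400 = (scale_root \<alpha> (\<tau> + 2 * j) / 20) * (scale_root \<alpha> (\<sigma> + 2 * (N - 1 - j)) / 20)"
          unfolding Q_def eq scale_root_mult[symmetric] by simp
        also have "\<dots> \<le> real (card (core_block \<alpha> \<tau> j)) * real (card (core_block \<alpha> \<sigma> (N - 1 - j)))"
          using card_core_block[OF a] card_core_block[OF b] a b by (intro mult_mono) auto
        finally show "Q / 400 \<le> real (card (core_block \<alpha> \<tau> j)) * real (card (core_block \<alpha> \<sigma> (N - 1 - j)))" .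
      qed
      finally show ?thesis by simp
    qed
    have "card X = card (Pairs - Bad)" unfolding X_def by (rule card_image[OF injX])
    moreover have "card Pairs - card Bad \<le> card (Pairs - Bad)" by (rule diff_card_le_card_Diff[OF finBad])
    ultimately have lower: "real (card Pairs) \<le> real (card X) + real (card Bad)" by linarith
    have bad: "real (card Bad) \<le> C3 * (p\<^sup>2 * (rep_rate \<alpha> n + p\<^sup>2))" unfolding Bad_def using C3(2)[of p n] p n by simp
    define \<eta> where "\<eta> = err_rate \<alpha> n p"
    have rp: "1 \<le> rep_rate \<alpha> n" "1 \<le> rep_rate \<alpha> p" using rep_rate_pos n p by auto
    have \<eta>: "p * (rep_rate \<alpha> n + p\<^sup>2) / n \<le> \<eta>" "0 \<le> \<eta>" using n p rp unfolding \<eta>_def err_rate_def by auto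
    have b1: "real (card Bad) \<le> C3 * \<eta> * Q"
    proof -
      have "p\<^sup>2 * (rep_rate \<alpha> n + p\<^sup>2) = (p * (rep_rate \<alpha> n + p\<^sup>2) / n) * (n * p)" using n by (simp add: power2_eq_square)
      also have "\<dots> \<le> \<eta> * Q" using \<eta> Q1 np by (intro mult_mono) auto
      finally have "C3 * (p\<^sup>2 * (rep_rate \<alpha> n + p\<^sup>2)) \<le> C3 * (\<eta> * Q)" using C3(1) by (intro mult_left_mono) auto
      thus ?thesis using bad by (simp add: mult.assoc)
    qed
    have b2: "Q * (sqsum e1 + sqsum e2) \<le> K * (C1 + V * C2) * \<eta>"
    proof -
      have i1: "(n * p) * (rep_rate \<alpha> n / n\<^sup>2) \<le> \<eta>"
      proof -
        have "(n * p) * (rep_rate \<alpha> n / n\<^sup>2) = p * rep_rate \<alpha> n / n" using n by (simp add: power2_eq_square)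
        also have "\<dots> \<le> p * (rep_rate \<alpha> n + p\<^sup>2) / n" using n p by (intro divide_right_mono mult_left_mono) auto
        finally show ?thesis using \<eta>(1) by simp
      qed
      have i2: "(n * p) * (rep_rate \<alpha> p / (n * p\<^sup>2) + (rep_rate \<alpha> n + p\<^sup>2) / n\<^sup>2) = \<eta>"
      proof -
        have "(n * p) * (R / (n * p\<^sup>2) + S / n\<^sup>2) = p * S / n + R / p" for R S
          using n p by (simp add: power2_eq_square distrib_left)
        thus ?thesis unfolding \<eta>_def err_rate_def .
      qed
      have "Q * (sqsum e1 + sqsum e2) \<le> (K * (n * p)) * (C1 * (rep_rate \<alpha> n / n\<^sup>2) + V * (C2 * (rep_rate \<alpha> p / (n * p\<^sup>2) + (rep_rate \<alpha> n + p\<^sup>2) / n\<^sup>2)))"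
        using Q2 e1b e2b K np by (intro mult_mono add_mono) (auto simp: sqsum_nonneg intro: add_nonneg_nonneg)
      also have "\<dots> = K * (C1 * ((n * p) * (rep_rate \<alpha> n / n\<^sup>2)) + V * C2 * ((n * p) * (rep_rate \<alpha> p / (n * p\<^sup>2) + (rep_rate \<alpha> n + p\<^sup>2) / n\<^sup>2)))"
        by (simp add: algebra_simps)
      also have "\<dots> \<le> K * (C1 * \<eta> + V * C2 * \<eta>)"
        unfolding i2 using i1 K C1(1) C2(1) V by (intro mult_left_mono add_mono mult_nonneg_nonneg) auto
      finally show ?thesis by (simp add: algebra_simps)
    qed
    have "real N * Q / 400 \<le> 8 * exp 16 * C' * Q + 16 * exp 32 * Q\<^sup>2 * (sqsum e1 + sqsum e2) + C3 * \<eta> * Q"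
      using cardPairs lower upper b1 by linarith
    also have "16 * exp 32 * Q\<^sup>2 * (sqsum e1 + sqsum e2) = 16 * exp 32 * Q * (Q * (sqsum e1 + sqsum e2))" by (simp add: power2_eq_square)
    also have "\<dots> \<le> 16 * exp 32 * Q * (K * (C1 + V * C2) * \<eta>)" using b2 Q0 by (intro mult_left_mono) auto
    also have "8 * exp 16 * C' * Q + 16 * exp 32 * Q * (K * (C1 + V * C2) * \<eta>) + C3 * \<eta> * Q = (8 * exp 16 * C' + C * \<eta>) * Q"
      unfolding C_def by (simp add: algebra_simps)
    finally have "real N / 400 * Q \<le> (8 * exp 16 * C' + C * \<eta>) * Q" by simp
    thus ?thesis using Q0 unfolding \<eta>_def n_def p_def by (simp add: mult_le_cancel_right)
  qed
  moreover have "0 \<le> C" using C1(1) C2(1) C3(1) V K by (simp add: C_def)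
  ultimately show ?thesis unfolding scale_count_bound_def K_def by (intro exI[of _ C] conjI allI impI) auto
qed

section \<open>Choice of the scales\<close>

text \<open>With \<open>p\<close> of order \<open>n powr \<theta>\<close>, the leading exponents are \<open>\<theta> - 1/3\<close>, \<open>\<theta> + 1 - \<alpha>\<close> and
\<open>3 \<theta> - 1\<close>, all negative.\<close>

lemma rep_rate_limits:
  assumes "0 < \<theta>" "\<theta> < \<alpha> - 1" "\<alpha> < 4 / 3"
  shows "((\<lambda>n. n powr \<theta> * (rep_rate \<alpha> n + c * n powr (2 * \<theta>)) / n) \<longlongrightarrow> 0) at_top"
    and "((\<lambda>p. rep_rate \<alpha> p / p) \<longlongrightarrow> 0) at_top"
    and "((\<lambda>n. c * n powr (2 * \<theta>) / n) \<longlongrightarrow> 0) at_top"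
proof -
  have a: "((\<lambda>n::real. n powr e) \<longlongrightarrow> 0) at_top" if "e < 0" for e using that by real_asymp
  have b: "((\<lambda>n::real. n powr e * (1 + ln n)) \<longlongrightarrow> 0) at_top" if "e < 0" for e using that by real_asymp
  have "((\<lambda>n. n powr (\<theta> - 1/3) + n powr (\<theta> + 1 - \<alpha>) * (1 + ln n) + c * n powr (3 * \<theta> - 1)) \<longlongrightarrow> 0 + 0 + c * 0) at_top"
    using assms by (intro tendsto_intros a b) auto
  moreover have "eventually (\<lambda>n. n powr (\<theta> - 1/3) + n powr (\<theta> + 1 - \<alpha>) * (1 + ln n) + c * n powr (3 * \<theta> - 1)
      = n powr \<theta> * (rep_rate \<alpha> n + c * n powr (2 * \<theta>)) / n) at_top"
    using eventually_gt_at_top[of 0]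
  proof eventually_elim
    case (elim n)
    have "n powr \<theta> * n powr (2/3) / n powr 1 = n powr (\<theta> - 1/3)"
      "n powr \<theta> * n powr (2 - \<alpha>) / n powr 1 = n powr (\<theta> + 1 - \<alpha>)"
      "n powr \<theta> * n powr (2 * \<theta>) / n powr 1 = n powr (3 * \<theta> - 1)"
      by (simp_all only: powr_add[symmetric] powr_diff[symmetric]) (simp_all add: algebra_simps)
    thus ?case using elim unfolding rep_rate_def by (simp add: field_simps)
  qed
  ultimately show "((\<lambda>n. n powr \<theta> * (rep_rate \<alpha> n + c * n powr (2 * \<theta>)) / n) \<longlongrightarrow> 0) at_top"
    using Lim_transform_eventually by force
  have "((\<lambda>p. p powr (-1/3) + p powr (1 - \<alpha>) * (1 + ln p)) \<longlongrightarrow> 0 + 0) at_top"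
    using assms by (intro tendsto_add a b) auto
  moreover have "eventually (\<lambda>p. p powr (-1/3) + p powr (1 - \<alpha>) * (1 + ln p) = rep_rate \<alpha> p / p) at_top"
    using eventually_gt_at_top[of 0]
  proof eventually_elim
    case (elim p)
    have "p powr (2/3) / p powr 1 = p powr (-1/3)" "p powr (2 - \<alpha>) / p powr 1 = p powr (1 - \<alpha>)"
      by (simp_all only: powr_diff[symmetric]) (simp_all add: algebra_simps)
    thus ?case using elim unfolding rep_rate_def by (simp add: field_simps)
  qed
  ultimately show "((\<lambda>p. rep_rate \<alpha> p / p) \<longlongrightarrow> 0) at_top"
    using Lim_transform_eventually by force
  have "((\<lambda>n. c * n powr (2 * \<theta> - 1)) \<longlongrightarrow> c * 0) at_top"
    using assms by (intro tendsto_intros a) auto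
  moreover have "eventually (\<lambda>n. c * n powr (2 * \<theta> - 1) = c * n powr (2 * \<theta>) / n) at_top"
    using eventually_gt_at_top[of 0] by eventually_elim (simp add: powr_diff)
  ultimately show "((\<lambda>n. c * n powr (2 * \<theta>) / n) \<longlongrightarrow> 0) at_top"
    using Lim_transform_eventually by force
qed

text \<open>The smaller group has to start at \<open>M powr \<theta>\<close>, where \<open>M = 2 ^ (\<tau> + 2 N)\<close> is the top of the larger one; up to
constants this makes \<open>p\<close> equal to \<open>n powr \<theta>\<close>.\<close>

lemma eventually_scales_separate:
  assumes "1 < \<alpha>" "\<alpha> < 4 / 3" "0 < \<theta>" "\<theta> < \<alpha> - 1" "0 \<le> C"
  shows "\<exists>T. \<forall>\<tau>\<ge>T. \<forall>\<sigma>. \<sigma> = nat \<lceil>\<theta> * real (\<tau> + 2 * N)\<rceil> \<longrightarrow>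
    40 \<le> scale_root \<alpha> \<sigma> \<and> (2 * 4 ^ N * scale_root \<alpha> \<sigma>)\<^sup>2 < scale_root \<alpha> \<tau> \<and> C * err_rate \<alpha> (scale_root \<alpha> \<tau>) (scale_root \<alpha> \<sigma>) \<le> 1"
proof -
  define K :: real where "K = 4 ^ N"
  have K: "1 \<le> K" by (simp add: K_def)
  (* The error is at most 2 K d + d, and 4 K d = 1 / (C + 1). *)
  define d where "d = 1 / (4 * K * (C + 1))"
  have d: "0 < d" using K assms(5) by (simp add: d_def)
  note lim = rep_rate_limits[OF assms(3,4,2)]
  have ev1: "eventually (\<lambda>n. n powr \<theta> * (rep_rate \<alpha> n + (4 * K\<^sup>2) * n powr (2 * \<theta>)) / n < d) at_top"
    by (rule order_tendstoD(2)[OF lim(1) d])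
  obtain P where P: "\<And>p. P \<le> p \<Longrightarrow> rep_rate \<alpha> p / p < d"
    using order_tendstoD(2)[OF lim(2) d] unfolding eventually_at_top_linorder by blast
  have ev2: "eventually (\<lambda>n. (16 * K ^ 4) * n powr (2 * \<theta>) / n < 1) at_top"
    by (rule order_tendstoD(2)[OF lim(3)]) simp
  have pt: "filterlim (\<lambda>n::real. n powr \<theta>) at_top at_top" using assms(3) by real_asymp
  have ev3: "eventually (\<lambda>n. max 40 P \<le> n powr \<theta>) at_top"
    using pt unfolding filterlim_at_top by blast
  have nt: "filterlim (scale_root \<alpha>) at_top sequentially"
    unfolding scale_root_def using assms(1) by real_asymp
  have "eventually (\<lambda>\<tau>. 
      scale_root \<alpha> \<tau> powr \<theta> * (rep_rate \<alpha> (scale_root \<alpha> \<tau>) + (4 * K\<^sup>2) * scale_root \<alpha> \<tau> powr (2 * \<theta>)) / scale_root \<alpha> \<tau> < d \<and>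
      (16 * K ^ 4) * scale_root \<alpha> \<tau> powr (2 * \<theta>) / scale_root \<alpha> \<tau> < 1 \<and> max 40 P \<le> scale_root \<alpha> \<tau> powr \<theta> \<and> 1 \<le> scale_root \<alpha> \<tau>) sequentially"
    using eventually_compose_filterlim[OF ev1 nt] eventually_compose_filterlim[OF ev2 nt]
      eventually_compose_filterlim[OF ev3 nt] eventually_compose_filterlim[OF eventually_ge_at_top[of 1] nt]
    by eventually_elim blast
  then obtain T where T: "\<And>\<tau>. T \<le> \<tau> \<Longrightarrow>
      scale_root \<alpha> \<tau> powr \<theta> * (rep_rate \<alpha> (scale_root \<alpha> \<tau>) + (4 * K\<^sup>2) * scale_root \<alpha> \<tau> powr (2 * \<theta>)) / scale_root \<alpha> \<tau> < d \<and>
      (16 * K ^ 4) * scale_root \<alpha> \<tau> powr (2 * \<theta>) / scale_root \<alpha> \<tau> < 1 \<and> max 40 P \<le> scale_root \<alpha> \<tau> powr \<theta> \<and> 1 \<le> scale_root \<alpha> \<tau>"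
    unfolding eventually_sequentially by blast
  have "40 \<le> scale_root \<alpha> \<sigma> \<and> (2 * K * scale_root \<alpha> \<sigma>)\<^sup>2 < scale_root \<alpha> \<tau> \<and> C * err_rate \<alpha> (scale_root \<alpha> \<tau>) (scale_root \<alpha> \<sigma>) \<le> 1"
    if "T \<le> \<tau>" and \<sigma>: "\<sigma> = nat \<lceil>\<theta> * real (\<tau> + 2 * N)\<rceil>" for \<tau> \<sigma>
  proof -
    define n where "n = scale_root \<alpha> \<tau>"
    define p where "p = scale_root \<alpha> \<sigma>"
    have t: "n powr \<theta> * (rep_rate \<alpha> n + (4 * K\<^sup>2) * n powr (2 * \<theta>)) / n < d"
      "(16 * K ^ 4) * n powr (2 * \<theta>) / n < 1" "40 \<le> n powr \<theta>" "P \<le> n powr \<theta>" "1 \<le> n"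
      using T[OF that(1)] unfolding n_def by auto
    have s: "\<theta> * real (\<tau> + 2 * N) \<le> real \<sigma>" "real \<sigma> \<le> \<theta> * real (\<tau> + 2 * N) + 1"
      unfolding \<sigma> using assms(3) mult_nonneg_nonneg[of \<theta> "real (\<tau> + 2 * N)"] by linarith+
    have nt: "n powr \<theta> = 2 powr (\<theta> * real \<tau> / \<alpha>)" unfolding n_def scale_root_def by (simp add: powr_powr mult.commute)
    have "n powr \<theta> \<le> p" unfolding nt p_def scale_root_def
    proof (intro powr_mono divide_right_mono)
      have "\<theta> * real \<tau> \<le> \<theta> * real (\<tau> + 2 * N)" using assms(3) by (intro mult_left_mono) auto
      thus "\<theta> * real \<tau> \<le> real \<sigma>" using s(1) by linarith
    qed (use assms in auto)
    note pl = this
    have ph: "p \<le> 2 * K * n powr \<theta>"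
    proof -
      have "real \<sigma> / \<alpha> \<le> (\<theta> * real \<tau> + (2 * real N * \<theta> + 1)) / \<alpha>"
        using s(2) assms(1) by (intro divide_right_mono) (auto simp: algebra_simps)
      also have "\<dots> = \<theta> * real \<tau> / \<alpha> + (2 * real N * \<theta> + 1) / \<alpha>" by (rule add_divide_distrib)
      also have "(2 * real N * \<theta> + 1) / \<alpha> \<le> (2 * real N * 1 + 1) / 1"
        using assms by (intro frac_le add_mono mult_mono) auto
      finally have "real \<sigma> / \<alpha> \<le> \<theta> * real \<tau> / \<alpha> + real (2 * N + 1)" by simp
      hence "p \<le> 2 powr (\<theta> * real \<tau> / \<alpha> + real (2 * N + 1))" unfolding p_def scale_root_def by (intro powr_mono) auto
      also have "\<dots> = n powr \<theta> * 2 ^ (2 * N + 1)" unfolding nt powr_add using powr_realpow[of 2 "2 * N + 1"] by simp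
      also have "\<dots> = 2 * K * n powr \<theta>" by (simp add: K_def power_mult)
      finally show ?thesis .
    qed
    have p0: "40 \<le> p" "P \<le> p" using pl t by linarith+
    have n2: "(n powr \<theta>)\<^sup>2 = n powr (2 * \<theta>)" by (simp add: power2_eq_square powr_add[symmetric])
    have p2: "p\<^sup>2 \<le> (4 * K\<^sup>2) * n powr (2 * \<theta>)"
    proof -
      have "p\<^sup>2 \<le> (2 * K * n powr \<theta>)\<^sup>2" using ph p0 by (intro power_mono) auto
      thus ?thesis by (simp add: power_mult_distrib n2)
    qed
    have "(2 * K * p)\<^sup>2 < n"
    proof -
      have "(2 * K * p)\<^sup>2 = 4 * K\<^sup>2 * p\<^sup>2" by (simp add: power_mult_distrib)
      also have "\<dots> \<le> 4 * K\<^sup>2 * ((4 * K\<^sup>2) * n powr (2 * \<theta>))" using p2 by (intro mult_left_mono) auto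
      also have "\<dots> = (16 * K ^ 4) * n powr (2 * \<theta>)" by (simp add: power2_eq_square power4_eq_xxxx)
      also have "\<dots> < n" using t(2,5) by (simp add: pos_divide_less_eq)
      finally show ?thesis .
    qed
    moreover have "C * err_rate \<alpha> n p \<le> 1"
    proof -
      have rp: "1 \<le> rep_rate \<alpha> n" using rep_rate_pos t(5) by auto
      have "p * (rep_rate \<alpha> n + p\<^sup>2) / n \<le> (2 * K * n powr \<theta>) * (rep_rate \<alpha> n + (4 * K\<^sup>2) * n powr (2 * \<theta>)) / n"
        using ph p2 t(5) rp p0 K by (intro divide_right_mono mult_mono add_mono) auto
      also have "\<dots> = 2 * K * (n powr \<theta> * (rep_rate \<alpha> n + (4 * K\<^sup>2) * n powr (2 * \<theta>)) / n)" by simp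
      also have "\<dots> \<le> 2 * K * d" using t(1) K by (intro mult_left_mono) auto
      finally have "err_rate \<alpha> n p \<le> 2 * K * d + d" unfolding err_rate_def using P[OF p0(2)] by linarith
      also have "\<dots> \<le> 2 * K * d + 2 * K * d" using mult_right_mono[of 1 K d] K d by simp
      also have "\<dots> = 4 * K * d" by simp
      also have "\<dots> = (4 * K * 1) / (4 * K * (C + 1))" unfolding d_def by (rule times_divide_eq_right)
      also have "\<dots> = 1 / (C + 1)" using K by (intro nonzero_mult_divide_mult_cancel_left) simp
      finally have "C * err_rate \<alpha> n p \<le> C * (1 / (C + 1))" using assms(5) by (intro mult_left_mono) auto
      also have "\<dots> \<le> 1" using assms(5) by simp
      finally show ?thesis .
    qed
    ultimately show ?thesis using p0(1) unfolding n_def p_def by blast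
  qed
  thus ?thesis unfolding K_def by blast
qed

section \<open>The truncated Hilbert transforms\<close>

definition sparse_bumps :: "nat set \<Rightarrow> nat \<Rightarrow> real \<Rightarrow> real" where
  "sparse_bumps A s = (if s \<in> (\<lambda>e. 2 ^ e) ` A then bump else (\<lambda>x. 0))"

definition window :: "real \<Rightarrow> nat set \<Rightarrow> real \<Rightarrow> nat set" where
  "window \<theta> A M = {e \<in> A. M powr \<theta> \<le> 2 ^ e \<and> 2 ^ e \<le> M}"

lemma finite_pow_le: "finite {e::nat. 2 ^ e \<le> (M::real)}"
proof (rule finite_subset)
  show "{e::nat. 2 ^ e \<le> M} \<subseteq> {..nat \<lfloor>M\<rfloor>}"
  proof
    fix e :: nat assume "e \<in> {e::nat. 2 ^ e \<le> M}"
    hence M: "2 ^ e \<le> M" by simp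
    have "real e < 2 ^ e" by (rule of_nat_less_two_power)
    hence "real e \<le> M" using M by linarith
    thus "e \<in> {..nat \<lfloor>M\<rfloor>}" by (simp add: le_nat_floor)
  qed
qed auto

lemma bump_scale_support:
  fixes M :: real
  assumes "1 < \<alpha>" "0 < m" "bump (real m powr \<alpha> / 2 ^ e) \<noteq> 0" "2 ^ e \<le> M"
  shows "m \<in> {..nat \<lfloor>2 * M\<rfloor>}"
proof -
  have "real m powr \<alpha> < 7/4 * 2 ^ e" using bump_nonzero[OF assms(3)] by (simp add: pos_divide_less_eq)
  moreover have "real m powr 1 \<le> real m powr \<alpha>" using assms(1,2) by (intro powr_mono) auto
  ultimately have "real m \<le> 2 * M" using assms(2,4) by simp
  thus ?thesis by (simp add: le_nat_floor)
qed

lemma trunc_hilbert_eq_odd_sum: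
  assumes "1 < \<alpha>"
  shows "trunc_hilbert \<alpha> \<theta> (sparse_bumps A) M f x
    = odd_sum {..nat \<lfloor>2 * M\<rfloor>} (weight \<alpha> (window \<theta> A M)) (floor_pow \<alpha>) f x"
proof -
  let ?E = "window \<theta> A M" and ?I = "{..nat \<lfloor>2 * M\<rfloor>}"
  define E' where "E' = {e::nat. M powr \<theta> \<le> 2 ^ e \<and> 2 ^ e \<le> M}"
  have finE': "finite E'" by (rule finite_subset[OF _ finite_pow_le[of M]]) (auto simp: E'_def)
  define g where "g = (\<lambda>m. f (x - floor_pow \<alpha> m) - f (x + floor_pow \<alpha> m))"
  have S: "{s. s \<in> dyadic \<and> M powr \<theta> \<le> real s \<and> real s \<le> M} = (\<lambda>e. 2 ^ e) ` E'"
    by (auto simp: dyadic_def E'_def)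
  have "trunc_hilbert \<alpha> \<theta> (sparse_bumps A) M f x = (\<Sum>e\<in>E'. \<Sum>\<^sub>\<infinity>m\<in>{0::nat<..}.
     complex_of_real (sparse_bumps A (2 ^ e) (real m powr \<alpha> / 2 ^ e)) * g m / of_nat m)"
    unfolding trunc_hilbert_def S by (subst sum.reindex) (auto simp: inj_on_def g_def floor_pow_def)
  also have "\<dots> = (\<Sum>e\<in>?E. \<Sum>\<^sub>\<infinity>m\<in>{0::nat<..}.
     complex_of_real (sparse_bumps A (2 ^ e) (real m powr \<alpha> / 2 ^ e)) * g m / of_nat m)"
  proof (rule sum.mono_neutral_right[OF finE'])
    show "?E \<subseteq> E'" by (auto simp: E'_def window_def)
    show "\<forall>e\<in>E' - ?E. (\<Sum>\<^sub>\<infinity>m\<in>{0::nat<..}. complex_of_real (sparse_bumps A (2 ^ e) (real m powr \<alpha> / 2 ^ e)) * g m / of_nat m) = 0"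
      by (auto simp: E'_def window_def sparse_bumps_def)
  qed
  also have "\<dots> = (\<Sum>e\<in>?E. \<Sum>m\<in>?I. complex_of_real (bump (real m powr \<alpha> / 2 ^ e)) * g m / of_nat m)"
  proof (rule sum.cong[OF refl])
    fix e assume e: "e \<in> ?E"
    have sb: "sparse_bumps A (2 ^ e) = bump" using e by (auto simp: sparse_bumps_def window_def)
    have "(\<Sum>\<^sub>\<infinity>m\<in>{0::nat<..}. complex_of_real (sparse_bumps A (2 ^ e) (real m powr \<alpha> / 2 ^ e)) * g m / of_nat m)
      = (\<Sum>\<^sub>\<infinity>m\<in>?I. complex_of_real (bump (real m powr \<alpha> / 2 ^ e)) * g m / of_nat m)"
      unfolding sb
    proof (rule infsum_cong_neutral)
      fix m assume m: "m \<in> {0<..} - ?I"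
      have "bump (real m powr \<alpha> / 2 ^ e) = 0"
        using bump_scale_support[OF assms, of m e M] m e by (auto simp: window_def)
      thus "complex_of_real (bump (real m powr \<alpha> / 2 ^ e)) * g m / of_nat m = 0" by simp
    qed auto
    thus "(\<Sum>\<^sub>\<infinity>m\<in>{0::nat<..}. complex_of_real (sparse_bumps A (2 ^ e) (real m powr \<alpha> / 2 ^ e)) * g m / of_nat m)
      = (\<Sum>m\<in>?I. complex_of_real (bump (real m powr \<alpha> / 2 ^ e)) * g m / of_nat m)" by simp
  qed
  also have "\<dots> = (\<Sum>m\<in>?I. \<Sum>e\<in>?E. complex_of_real (bump (real m powr \<alpha> / 2 ^ e)) * g m / of_nat m)" by (rule sum.swap)
  also have "\<dots> = (\<Sum>m\<in>?I. of_real (weight \<alpha> ?E m) * g m)"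
    unfolding weight_def by (intro sum.cong refl) (simp add: sum_distrib_right sum_divide_distrib)
  finally show ?thesis unfolding odd_sum_alt g_def .
qed

text \<open>Allows one to pass between the index range of \<open>\<H>\<^sub>M\<close> and the much shorter ranges where the weights live.\<close>

lemma odd_sum_cong_support:
  assumes "finite I" "finite J" "\<And>i. w i \<noteq> 0 \<Longrightarrow> i \<in> I \<and> i \<in> J"
  shows "odd_sum I w y = odd_sum J w y"
proof
  fix f
  show "odd_sum I w y f = odd_sum J w y f"
  proof
    fix x
    have "odd_sum I w y f x = (\<Sum>i\<in>I \<inter> J. of_real (w i) * (f (x - y i) - f (x + y i)))"
      unfolding odd_sum_alt using assms by (intro sum.mono_neutral_right) auto
    also have "\<dots> = odd_sum J w y f x"
      unfolding odd_sum_alt using assms by (intro sum.mono_neutral_left) auto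
    finally show "odd_sum I w y f x = odd_sum J w y f x" .
  qed
qed

lemma weight_Un: "finite E \<Longrightarrow> finite F \<Longrightarrow> E \<inter> F = {} \<Longrightarrow> weight \<alpha> (E \<union> F) = (\<lambda>m. weight \<alpha> E m + weight \<alpha> F m)"
  by (auto simp: weight_def sum.union_disjoint add_divide_distrib)

lemma odd_sum_weight_add: "odd_sum I (\<lambda>m. w m + w' m) y f x = odd_sum I w y f x + odd_sum I w' y f x"
  by (simp add: odd_sum_alt algebra_simps sum.distrib sum_subtractf)

lemma weight_support_window:
  fixes M :: real
  assumes "1 < \<alpha>" "\<And>e. e \<in> E \<Longrightarrow> 2 ^ e \<le> M" "weight \<alpha> E m \<noteq> 0"
  shows "m \<in> {..nat \<lfloor>2 * M\<rfloor>}"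
proof -
  obtain e where e: "e \<in> E" "bump (real m powr \<alpha> / 2 ^ e) \<noteq> 0"
    using assms(3) unfolding weight_def by (metis (no_types, lifting) div_0 sum.neutral)
  have "m \<noteq> 0" using assms(3) by (auto simp: weight_def)
  thus ?thesis using bump_scale_support[OF assms(1) _ e(2) assms(2)[OF e(1)]] by simp
qed

lemma scalar_plus_odd_sum:
  assumes "finite I" "\<And>f x. H f x = odd_sum I w y f x"
  shows "ell2_invertible (scalar_plus 1 H)"
    and "ell2_opnorm (ell2_inverse (scalar_plus 1 H)) \<le> ereal 1"
    and "ell2_inverse (scalar_plus 1 H) delta \<in> ell2"
    and "ell2_inverse (scalar_plus 1 H) delta x + odd_sum I w y (ell2_inverse (scalar_plus 1 H) delta) x = delta x"
proof -
  let ?T = "scalar_plus 1 H" and ?B = "odd_sum I w y"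
  have T: "?T f = (\<lambda>x. f x + ?B f x)" for f by (auto simp: scalar_plus_def assms(2))
  have T2: "?T f \<in> ell2" if "f \<in> ell2" for f unfolding T using that assms(1) by (intro ell2_add odd_sum_ell2)
  have inj: "inj_on ?T ell2"
  proof (rule inj_onI)
    fix f g assume fg: "f \<in> ell2" "g \<in> ell2" "?T f = ?T g"
    let ?h = "\<lambda>x. f x - g x"
    have h: "?h \<in> ell2" using fg by (intro ell2_diff)
    have "(\<lambda>x. ?h x + ?B ?h x) = (\<lambda>x. ?T f x - ?T g x)" by (auto simp: T odd_sum_diff)
    hence "sqsum ?h \<le> sqsum (\<lambda>x. 0)" using sqsum_le_one_plus_odd[OF assms(1) h, of w y] fg(3) by simp
    hence "?h = (\<lambda>x. 0)" using sqsum_zero_imp[OF h] by (simp add: sqsum_def)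
    thus "f = g" by (auto simp: fun_eq_iff)
  qed
  have surj: "?T ` ell2 = ell2"
  proof
    show "?T ` ell2 \<subseteq> ell2" using T2 by blast
    show "ell2 \<subseteq> ?T ` ell2"
    proof
      fix g assume "g \<in> ell2"
      then obtain f where "f \<in> ell2" "(\<lambda>x. f x + ?B f x) = g" using one_plus_odd_surj[OF assms(1)] by blast
      thus "g \<in> ?T ` ell2" by (intro image_eqI[of _ _ f]) (simp_all add: T)
    qed
  qed
  show "ell2_invertible ?T" unfolding ell2_invertible_def bij_betw_def using inj surj by blast
  have inv: "ell2_inverse ?T f \<in> ell2" "?T (ell2_inverse ?T f) = f" if "f \<in> ell2" for f
  proof -
    have "f \<in> ?T ` ell2" using that surj by simp
    thus "ell2_inverse ?T f \<in> ell2" "?T (ell2_inverse ?T f) = f"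
      unfolding ell2_inverse_def by (rule inv_into_into, rule f_inv_into_f)
  qed
  show "ell2_opnorm (ell2_inverse ?T) \<le> ereal 1"
    unfolding ell2_opnorm_def
  proof (rule Inf_lower, safe)
    have "ell2_norm (ell2_inverse ?T f) \<le> 1 * ell2_norm f" if "f \<in> ell2" for f
      using sqsum_le_one_plus_odd[OF assms(1) inv(1)[OF that], of w y] inv(2)[OF that]
      unfolding T ell2_norm_sqsum by simp
    thus "\<exists>A. ereal 1 = ereal A \<and> 0 \<le> A \<and> (\<forall>f\<in>ell2. ell2_inverse ?T f \<in> ell2 \<and> ell2_norm (ell2_inverse ?T f) \<le> A * ell2_norm f)"
      using inv(1) by (intro exI[of _ 1]) simp
  qed
  show "ell2_inverse ?T delta \<in> ell2" by (rule inv(1)[OF delta_ell2])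
  show "ell2_inverse ?T delta x + ?B (ell2_inverse ?T delta) x = delta x"
    using fun_cong[OF inv(2)[OF delta_ell2], of x] unfolding T .
qed

text \<open>The constant \<open>C + 1\<close> is used because the infimum defining the norm need not be attained.\<close>

lemma weak11_norm_at_delta:
  assumes "weak11_norm R \<le> ereal C"
  shows "weak_le (C + 1) (R delta)"
  unfolding weak_le_def
proof (intro allI impI)
  fix t :: real assume t: "t > 0"
  have "weak11_norm R < ereal (C + 1)" using assms by (rule le_less_trans) simp
  then obtain A where A: "A < C + 1" "\<forall>f\<in>ell1. \<forall>t>0. finite {x. cmod (R f x) > t} \<and>
        real (card {x. cmod (R f x) > t}) \<le> A * ell1_norm f / t"
    unfolding weak11_norm_def Inf_less_iff by auto
  have "finite {x. cmod (R delta x) > t}" "real (card {x. cmod (R delta x) > t}) \<le> A / t"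
    using A(2) delta_ell1 t by (auto simp: ell1_norm_delta)
  moreover have "A / t \<le> (C + 1) / t" using A(1) t by (intro divide_right_mono) auto
  ultimately show "finite {x. cmod (R delta x) > t} \<and> real (card {x. cmod (R delta x) > t}) \<le> (C + 1) / t" by linarith
qed

section \<open>Failure of the uniform weak type bound\<close>

text \<open>Consecutive configurations are placed so far apart that no truncation window can meet two of them. The factor \<open>\<theta>\<^sup>2\<close>
arises because a window of the \<open>k\<close>-th configuration may reach down to about \<open>\<theta>\<close> times its lowest exponent, which is in
turn about \<open>\<theta>\<close> times \<open>\<tau> k\<close>.\<close>

lemma exists_sparse_scales:
  fixes T :: "nat \<Rightarrow> nat" and \<theta> :: real
  assumes "0 < \<theta>" "\<theta> < 1"
  shows "\<exists>\<tau> :: nat \<Rightarrow> nat. \<forall>k. T k \<le> \<tau> k \<and>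
    (\<forall>j<k. real (\<tau> j + 2 * Suc j) < \<theta> * (\<theta> * real (\<tau> k)))"
proof -
  define \<tau> where "\<tau> = rec_nat (T 0) (\<lambda>k t. max (T (Suc k)) (t + 2 * Suc k + nat \<lceil>(real (t + 2 * Suc k) + 1) / (\<theta> * \<theta>)\<rceil>))"
  have S: "\<tau> (Suc k) = max (T (Suc k)) (\<tau> k + 2 * Suc k + nat \<lceil>(real (\<tau> k + 2 * Suc k) + 1) / (\<theta> * \<theta>)\<rceil>)" for k
    by (simp add: \<tau>_def)
  have T: "T k \<le> \<tau> k" for k by (cases k) (auto simp: S \<tau>_def)
  have mono: "\<tau> j \<le> \<tau> k" if "j \<le> k" for j k
    using that by (rule lift_Suc_mono_le[of \<tau>, rotated]) (auto simp: S)
  have "real (\<tau> j + 2 * Suc j) < \<theta> * (\<theta> * real (\<tau> k))" if "j < k" for j k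
  proof -
    define i where "i = k - 1"
    have i: "k = Suc i" using that by (simp add: i_def)
    have ji: "j \<le> i" using that i by simp
    let ?a = "real (\<tau> i + 2 * Suc i) + 1"
    have "?a / (\<theta> * \<theta>) \<le> real (nat \<lceil>?a / (\<theta> * \<theta>)\<rceil>)" by linarith
    also have "\<dots> \<le> real (\<tau> k)" unfolding i S by simp
    finally have "?a \<le> \<theta> * (\<theta> * real (\<tau> k))" using assms by (simp add: pos_divide_le_eq mult_ac)
    moreover have "\<tau> j + 2 * Suc j \<le> \<tau> i + 2 * Suc i" using mono[OF ji] ji by simp
    ultimately show ?thesis by linarith
  qed
  thus ?thesis using T by blast
qed

text \<open>The functions \<open>\<phi>\<^sub>s\<close> are built from infinitely many configurations, the \<open>k\<close>-th one with \<open>k + 1\<close> scales in each of its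
two groups. Truncation at \<open>M\<^sub>2 = 2 ^ (\<tau> k + 2 (k + 1))\<close> sees exactly the two groups of the \<open>k\<close>-th configuration,
and truncation at \<open>M\<^sub>1 = 2 ^ (\<sigma> k + 2 (k + 1))\<close> sees exactly the smaller one. The two corresponding inverses supply the
functions \<open>u\<close> and \<open>r\<close> of \<open>weak_bound_forces_few_scales\<close>.\<close>

theorem theorem4:
  fixes \<alpha> \<theta> :: real
  assumes "1 < \<alpha>" and "\<alpha> \<le> 1 + 1 / 1000"
    and "0 < \<theta>" and "\<theta> < \<alpha> - 1"
  shows "\<exists>(\<phi> :: nat \<Rightarrow> real \<Rightarrow> real) (\<Gamma> :: complex set) (C_I :: real).
    uniformly_in_Cc_smooth \<phi> (1/2) 2 \<and> compact \<Gamma> \<and>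
    (\<forall>M\<ge>0. \<forall>z\<in>\<Gamma>.
       ell2_invertible (scalar_plus z (trunc_hilbert \<alpha> \<theta> \<phi> M)) \<and>
       ell2_opnorm (ell2_inverse (scalar_plus z (trunc_hilbert \<alpha> \<theta> \<phi> M))) \<le> ereal C_I) \<and>
    \<not> (\<exists>C :: real. \<forall>M\<ge>0. \<forall>z\<in>\<Gamma>.
       weak11_norm (ell2_inverse (scalar_plus z (trunc_hilbert \<alpha> \<theta> \<phi> M))) \<le> ereal C)"
proof -
  have al: "1 < \<alpha>" "\<alpha> < 2" "\<alpha> < 4/3" and th: "\<theta> < 1" using assms by auto
  have "\<forall>k. \<exists>C\<ge>0. scale_count_bound \<alpha> (Suc k) C"
    by (intro allI weak_bound_forces_few_scales[OF al(1,2)]) simp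
  then obtain C where C: "\<And>k. 0 \<le> C k" "\<And>k. scale_count_bound \<alpha> (Suc k) (C k)" by metis
  define small where "small = (\<lambda>k \<tau> \<sigma>. 40 \<le> scale_root \<alpha> \<sigma> \<and> (2 * 4 ^ Suc k * scale_root \<alpha> \<sigma>)\<^sup>2 < scale_root \<alpha> \<tau> \<and> C k * err_rate \<alpha> (scale_root \<alpha> \<tau>) (scale_root \<alpha> \<sigma>) \<le> 1)"
  have "\<forall>k. \<exists>T. \<forall>\<tau>\<ge>T. small k \<tau> (nat \<lceil>\<theta> * real (\<tau> + 2 * Suc k)\<rceil>)"
    unfolding small_def using eventually_scales_separate[OF al(1,3) assms(3,4) C(1)] by blast
  then obtain T where T: "\<And>k \<tau>. T k \<le> \<tau> \<Longrightarrow> small k \<tau> (nat \<lceil>\<theta> * real (\<tau> + 2 * Suc k)\<rceil>)" by metis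
  obtain \<tau> where \<tau>: "\<And>k. T k \<le> \<tau> k" "\<And>j k. j < k \<Longrightarrow> real (\<tau> j + 2 * Suc j) < \<theta> * (\<theta> * real (\<tau> k))"
    using exists_sparse_scales[OF assms(3) th] by blast
  define \<sigma> where "\<sigma> = (\<lambda>k. nat \<lceil>\<theta> * real (\<tau> k + 2 * Suc k)\<rceil>)"
  have sm: "small k (\<tau> k) (\<sigma> k)" for k unfolding \<sigma>_def by (rule T[OF \<tau>(1)])
  have \<sigma>ge: "\<theta> * real (\<tau> k + 2 * Suc k) \<le> real (\<sigma> k)" for k unfolding \<sigma>_def by linarith
  have \<sigma>\<tau>: "\<sigma> k + 2 * Suc k < \<tau> k" for k
  proof (rule ccontr)
    let ?p = "scale_root \<alpha> (\<sigma> k)"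
    assume "\<not> ?thesis"
    hence "scale_root \<alpha> (\<tau> k) \<le> scale_root \<alpha> (\<sigma> k + 2 * Suc k)" by (intro scale_root_mono al) auto
    also have "\<dots> = ?p * scale_root \<alpha> (2 * Suc k)" by (rule scale_root_mult[symmetric])
    also have "scale_root \<alpha> (2 * Suc k) \<le> 4 ^ Suc k"
    proof -
      have "real (2 * Suc k) / \<alpha> \<le> real (2 * Suc k) / 1" using al by (intro divide_left_mono) auto
      hence "scale_root \<alpha> (2 * Suc k) \<le> 2 powr real (2 * Suc k)" unfolding scale_root_def by (intro powr_mono) auto
      also have "\<dots> = 2 ^ (2 * Suc k)" by (rule powr_realpow) simp
      finally show ?thesis by (simp only: power_mult) simp
    qed
    finally have le: "scale_root \<alpha> (\<tau> k) \<le> ?p * 4 ^ Suc k" using scale_root_pos[of \<alpha> "\<sigma> k"] by simp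
    have s: "40 \<le> ?p" "(2 * 4 ^ Suc k * ?p)\<^sup>2 < scale_root \<alpha> (\<tau> k)" using sm[of k] by (auto simp: small_def)
    define q where "q = 4 ^ Suc k * ?p"
    have q: "1 \<le> q" unfolding q_def using mult_mono[of 1 "4 ^ Suc k" 1 ?p] s(1) one_le_power[of "4::real" "Suc k"] by simp
    have "(2 * q)\<^sup>2 < q" using s(2) le unfolding q_def by (simp add: mult_ac)
    moreover have "q * 1 \<le> q * q" using q by (intro mult_left_mono) auto
    ultimately show False using q by (simp add: power2_eq_square)
  qed
  define A where "A = (\<Union>k. scale_exps (\<sigma> k) (Suc k) \<union> scale_exps (\<tau> k) (Suc k))"
  have mem: "b \<le> e \<and> e < b + 2 * N" if "e \<in> scale_exps b N" for e b N using that by (auto simp: scale_exps_def)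
  have A: "\<exists>j. (e \<in> scale_exps (\<sigma> j) (Suc j) \<or> e \<in> scale_exps (\<tau> j) (Suc j)) \<and> \<sigma> j \<le> e \<and> e < \<tau> j + 2 * Suc j" if e: "e \<in> A" for e
  proof -
    obtain j where "e \<in> scale_exps (\<sigma> j) (Suc j) \<or> e \<in> scale_exps (\<tau> j) (Suc j)" using e by (auto simp: A_def)
    thus ?thesis using mem[of e "\<sigma> j" "Suc j"] mem[of e "\<tau> j" "Suc j"] \<sigma>\<tau>[of j] by (intro exI[of _ j]) auto
  qed
  have sep: "real (\<tau> j + 2 * Suc j) < \<theta> * real (\<sigma> k)" if "j < k" for j k
  proof -
    have "\<theta> * real (\<tau> k) \<le> \<theta> * real (\<tau> k + 2 * Suc k)" using assms(3) by (intro mult_left_mono) auto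
    hence "\<theta> * real (\<tau> k) \<le> real (\<sigma> k)" using \<sigma>ge[of k] by linarith
    hence "\<theta> * (\<theta> * real (\<tau> k)) \<le> \<theta> * real (\<sigma> k)" using assms(3) by (intro mult_left_mono) auto
    thus ?thesis using \<tau>(2)[OF that] by linarith
  qed
  have \<theta>le: "\<theta> * real m \<le> real m" for m using th mult_right_mono[of \<theta> 1 "real m"] by simp
  have win: "(2 ^ b) powr \<theta> \<le> (2::real) ^ e \<and> (2::real) ^ e \<le> 2 ^ b \<longleftrightarrow> \<theta> * real b \<le> real e \<and> e \<le> b" for b e :: nat
  proof -
    have "((2::real) ^ b) powr \<theta> = 2 powr (\<theta> * real b)" "(2::real) ^ e = 2 powr real e"
      by (simp_all add: powr_realpow[symmetric] powr_powr mult.commute)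
    hence "(2 ^ b) powr \<theta> \<le> (2::real) ^ e \<longleftrightarrow> \<theta> * real b \<le> real e" by (simp only: powr_le_cancel_iff)
    moreover have "(2::real) ^ e \<le> 2 ^ b \<longleftrightarrow> e \<le> b" by simp
    ultimately show ?thesis by blast
  qed
  have memwin: "e \<in> window \<theta> A (2 ^ b) \<longleftrightarrow> e \<in> A \<and> \<theta> * real b \<le> real e \<and> e \<le> b" for e b
    unfolding window_def using win[of b e] by simp
  (* An exponent inside the k-th window cannot belong to another configuration. *)
  have cls: "j = k" if "\<theta> * real (\<sigma> k) \<le> real e" "e \<le> \<tau> k + 2 * Suc k" "\<sigma> j \<le> e" "e < \<tau> j + 2 * Suc j" for e j k
  proof (rule ccontr)
    assume "j \<noteq> k"
    then consider "j < k" | "k < j" by linarith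
    thus False
    proof cases
      case 1 thus False using sep[OF 1] that by linarith
    next
      case 2 thus False using sep[OF 2] \<theta>le[of "\<sigma> j"] that by linarith
    qed
  qed
  have mono\<theta>: "\<theta> * real a \<le> \<theta> * real b" if "a \<le> b" for a b using that assms(3) by (intro mult_left_mono) auto
  have W: "window \<theta> A (2 ^ b) = {e \<in> scale_exps (\<sigma> k) (Suc k) \<union> scale_exps (\<tau> k) (Suc k). e \<le> b}"
    if b: "\<sigma> k \<le> b" "b \<le> \<tau> k + 2 * Suc k" for k b
  proof (intro equalityI subsetI)
    fix e assume "e \<in> window \<theta> A (2 ^ b)"
    hence e: "e \<in> A" "\<theta> * real b \<le> real e" "e \<le> b" unfolding memwin by blast+
    obtain j where j: "e \<in> scale_exps (\<sigma> j) (Suc j) \<or> e \<in> scale_exps (\<tau> j) (Suc j)" "\<sigma> j \<le> e" "e < \<tau> j + 2 * Suc j" using A[OF e(1)] by blast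
    have "\<theta> * real (\<sigma> k) \<le> real e" using mono\<theta>[OF b(1)] e(2) by linarith
    hence "j = k" using cls[of k e j] e(3) b(2) j(2,3) by linarith
    thus "e \<in> {e \<in> scale_exps (\<sigma> k) (Suc k) \<union> scale_exps (\<tau> k) (Suc k). e \<le> b}" using j(1) e(3) by blast
  next
    fix e assume e: "e \<in> {e \<in> scale_exps (\<sigma> k) (Suc k) \<union> scale_exps (\<tau> k) (Suc k). e \<le> b}"
    hence "\<sigma> k \<le> e" using mem[of e "\<sigma> k" "Suc k"] mem[of e "\<tau> k" "Suc k"] \<sigma>\<tau>[of k] by auto
    hence "\<theta> * real b \<le> real e" using mono\<theta>[OF b(2)] \<sigma>ge[of k] by linarith
    moreover have "e \<in> A" using e unfolding A_def by blast
    ultimately show "e \<in> window \<theta> A (2 ^ b)" unfolding memwin using e by blast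
  qed
  have W1: "window \<theta> A (2 ^ (\<sigma> k + 2 * Suc k)) = scale_exps (\<sigma> k) (Suc k)" for k
    using W[of k "\<sigma> k + 2 * Suc k"] mem[of _ "\<sigma> k" "Suc k"] mem[of _ "\<tau> k" "Suc k"] \<sigma>\<tau>[of k] by fastforce
  have W2: "window \<theta> A (2 ^ (\<tau> k + 2 * Suc k)) = scale_exps (\<sigma> k) (Suc k) \<union> scale_exps (\<tau> k) (Suc k)" for k
    using W[of k "\<tau> k + 2 * Suc k"] mem[of _ "\<sigma> k" "Suc k"] mem[of _ "\<tau> k" "Suc k"] \<sigma>\<tau>[of k] by fastforce
  let ?\<phi> = "sparse_bumps A"
  let ?H = "trunc_hilbert \<alpha> \<theta> ?\<phi>"
  define I where "I = (\<lambda>M::real. {..nat \<lfloor>2 * M\<rfloor>})"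
  have H: "?H M f x = odd_sum (I M) (weight \<alpha> (window \<theta> A M)) (floor_pow \<alpha>) f x" for M f x
    unfolding I_def by (rule trunc_hilbert_eq_odd_sum[OF al(1)])
  have finI: "finite (I M)" for M by (simp add: I_def)
  note inv = scalar_plus_odd_sum[OF finI H]
  have smooth: "uniformly_in_Cc_smooth ?\<phi> (1/2) 2"
    using uniformly_in_Cc_smooth_bump[of "\<lambda>s. s \<in> (\<lambda>e. 2 ^ e) ` A"] unfolding sparse_bumps_def[abs_def] .
  have unb: False if "\<forall>M\<ge>0. weak11_norm (ell2_inverse (scalar_plus 1 (?H M))) \<le> ereal Cw" for Cw
  proof -
    (* More scales than the weak type constant Cw allows. *)
    obtain k where k: "400 * (8 * exp 16 * (Cw + 1) + 1) < real k" using reals_Archimedean2 by blast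
    let ?N = "Suc k"
    define M1 :: real where "M1 = 2 ^ (\<sigma> k + 2 * Suc k)"
    define M2 :: real where "M2 = 2 ^ (\<tau> k + 2 * Suc k)"
    define u where "u = ell2_inverse (scalar_plus 1 (?H M2)) delta"
    define r where "r = ell2_inverse (scalar_plus 1 (?H M1)) delta"
    have os: "odd_sum (I M) (weight \<alpha> (scale_exps b ?N)) (floor_pow \<alpha>) = group_op \<alpha> b ?N"
      if "scale_exps b ?N \<subseteq> window \<theta> A M" for M b
      unfolding group_op_def
    proof (rule odd_sum_cong_support[OF finI finite_block])
      fix m assume m: "weight \<alpha> (scale_exps b ?N) m \<noteq> 0"
      have "m \<in> {..nat \<lfloor>2 * M\<rfloor>}" using that by (intro weight_support_window[OF al(1) _ m]) (auto simp: window_def)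
      thus "m \<in> I M \<and> m \<in> block (4 ^ ?N) (scale_root \<alpha> b)" using weight_support[OF al(1) m] by (simp add: I_def)
    qed
    have disj: "scale_exps (\<sigma> k) ?N \<inter> scale_exps (\<tau> k) ?N = {}"
      using mem[of _ "\<sigma> k" ?N] mem[of _ "\<tau> k" ?N] \<sigma>\<tau>[of k] by fastforce
    have "real ?N / 400 \<le> 8 * exp 16 * (Cw + 1) + C k * err_rate \<alpha> (scale_root \<alpha> (\<tau> k)) (scale_root \<alpha> (\<sigma> k))"
    proof (rule C(2)[of k, unfolded scale_count_bound_def, rule_format, where u = u and r = r and I = "I M2" and wH = "weight \<alpha> (window \<theta> A M2)" and yH = "floor_pow \<alpha>"])
      show "40 \<le> scale_root \<alpha> (\<sigma> k)" "(2 * 4 ^ ?N * scale_root \<alpha> (\<sigma> k))\<^sup>2 < scale_root \<alpha> (\<tau> k)" using sm[of k] by (auto simp: small_def)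
      show "finite (I M2)" by (rule finI)
      show "odd_sum (I M2) (weight \<alpha> (window \<theta> A M2)) (floor_pow \<alpha>) f x = group_op \<alpha> (\<sigma> k) ?N f x
        + group_op \<alpha> (\<tau> k) ?N f x" for f x
      proof -
        have "scale_exps (\<sigma> k) ?N \<subseteq> window \<theta> A M2" "scale_exps (\<tau> k) ?N \<subseteq> window \<theta> A M2" unfolding M2_def W2 by auto
        thus ?thesis using os[of "\<sigma> k" M2] os[of "\<tau> k" M2] weight_Un[OF finite_scale_exps finite_scale_exps disj]
          unfolding M2_def W2 by (simp add: odd_sum_weight_add)
      qed
      show "u \<in> ell2" unfolding u_def by (rule inv(3))
      show "u x + odd_sum (I M2) (weight \<alpha> (window \<theta> A M2)) (floor_pow \<alpha>) u x = delta x" for x unfolding u_def by (rule inv(4))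
      show "r \<in> ell2" unfolding r_def by (rule inv(3))
      show "r x + group_op \<alpha> (\<sigma> k) ?N r x = delta x" for x
      proof -
        have "scale_exps (\<sigma> k) ?N \<subseteq> window \<theta> A M1" unfolding M1_def W1 by simp
        from os[OF this] have "odd_sum (I M1) (weight \<alpha> (window \<theta> A M1)) (floor_pow \<alpha>) = group_op \<alpha> (\<sigma> k) ?N"
          unfolding M1_def W1 .
        moreover have "r x + odd_sum (I M1) (weight \<alpha> (window \<theta> A M1)) (floor_pow \<alpha>) r x = delta x" unfolding r_def by (rule inv(4))
        ultimately show ?thesis by simp
      qed
      show "weak_le (Cw + 1) u" unfolding u_def using that by (intro weak11_norm_at_delta) (simp add: M2_def)
      show "weak_le (Cw + 1) r" unfolding r_def using that by (intro weak11_norm_at_delta) (simp add: M1_def)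
    qed
    also have "\<dots> \<le> 8 * exp 16 * (Cw + 1) + 1" using sm[of k] by (simp add: small_def)
    finally show False using k by simp
  qed
  have not_weak: "\<not> (\<exists>C :: real. \<forall>M\<ge>0. \<forall>z\<in>{1}.
       weak11_norm (ell2_inverse (scalar_plus z (?H M))) \<le> ereal C)"
  proof
    assume "\<exists>C :: real. \<forall>M\<ge>0. \<forall>z\<in>{1}. weak11_norm (ell2_inverse (scalar_plus z (?H M))) \<le> ereal C"
    then obtain Cw where "\<forall>M\<ge>0. weak11_norm (ell2_inverse (scalar_plus 1 (?H M))) \<le> ereal Cw" by blast
    thus False by (rule unb)
  qed
  have inverses: "\<forall>M\<ge>0. \<forall>z\<in>{1}. ell2_invertible (scalar_plus z (?H M)) \<and>
      ell2_opnorm (ell2_inverse (scalar_plus z (?H M))) \<le> ereal 1"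
    using inv(1,2) by blast
  have "compact {1 :: complex}" by simp
  thus ?thesis using smooth inverses not_weak by blast
qed

end
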